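(* Every 3-dimensional normed space $(\mathbb{R}^3,\|\cdot\|_K)$ embeds in $L_0$; that is, for every origin-symmetric convex body $K$ in $\mathbb{R}^3$ there exist a finite Borel measure $\mu$ on $S^2$ and a constant $C\in\mathbb{R}$ such that for every $x\in\mathbb{R}^3$, $\ln\|x\|_K=\int_{S^2}\ln|(x,\xi)|\,d\mu(\xi)+C$.
   Context: A convex body is a compact convex set with nonempty interior; $\|x\|_K=\min\{a\ge 0: x\in aK\}$ is the Minkowski functional of $K$. The normed space with unit ball $K$ is $(\mathbb{R}^3,\|\cdot\|_K)$. Measures are non-negative. Embedding in $L_0$ is defined by the existence of the representation displayed in the claim. *)

theory Defs
  imports "HOL-Analysis.Analysis"
begin

definition convex_body :: "'a::euclidean_space set \<Rightarrow> bool" where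
  "convex_body K \<longleftrightarrow> compact K \<and> convex K \<and> interior K \<noteq> {}"

definition origin_symmetric :: "'a::real_vector set \<Rightarrow> bool" where
  "origin_symmetric K \<longleftrightarrow> uminus ` K = K"

text \<open>The minimum exists for every origin-symmetric convex body; for other sets the
  value may be unspecified.\<close>

definition minkowski_functional :: "'a::real_vector set \<Rightarrow> 'a \<Rightarrow> real" where
  "minkowski_functional K x = (LEAST a. 0 \<le> a \<and> x \<in> (\<lambda>y. a *\<^sub>R y) ` K)"

text \<open>Since \<open>ln 0 = 0\<close> on the reals, the logarithm is taken with values in
  the extended reals, with \<open>ext_ln 0 = -\<infinity>\<close>. Only nonnegative arguments are relevant.\<close>

definition ext_ln :: "real \<Rightarrow> ereal" where
  "ext_ln t = (if t = 0 then -\<infinity> else ereal (ln t))"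

text \<open>The Lebesgue integral of an extended-real-valued measurable function, as the integral of
  the positive part minus that of the negative part (\<^const>\<open>e2ennreal\<close> truncates at 0). It is
  meaningful whenever one of the two is finite; the Bochner integral would give 0 to a function
  with integral \<open>-\<infinity>\<close>.\<close>

definition ext_integral :: "'a measure \<Rightarrow> ('a \<Rightarrow> ereal) \<Rightarrow> ereal" where
  "ext_integral M f =
     enn2ereal (\<integral>\<^sup>+ x. e2ennreal (f x) \<partial>M) - enn2ereal (\<integral>\<^sup>+ x. e2ennreal (- f x) \<partial>M)"

lemma ext_integral_ereal:
  assumes "integrable M f"
  shows "ext_integral M (\<lambda>x. ereal (f x)) = ereal (\<integral>x. f x \<partial>M)"
proof -
  have fin: "(\<integral>\<^sup>+ x. ennreal (g x) \<partial>M) < \<infinity>" if "integrable M g" for g :: "'a \<Rightarrow> real"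
    using integrableD(2)[OF that] by (simp add: top.not_eq_extremum real_integrable_def)
  have enn: "enn2ereal z = ereal (enn2real z)" if "z < \<infinity>" for z
    using that by (cases z) (auto simp: enn2ereal_ennreal)
  show ?thesis
    using fin[OF assms] fin[of "\<lambda>x. - f x"] assms
    by (simp add: ext_integral_def real_lebesgue_integral_def[OF assms] enn flip: ennreal.abs_eq)
qed

text \<open>Both sides of the representation are \<open>-\<infinity>\<close> at \<open>x = 0\<close> for a nonzero measure. For every
  \<open>x\<close> the integrand is bounded above and the measure is finite, so the positive part of the
  integrand always has a finite integral.\<close>

definition embeds_in_L0 :: "('a::euclidean_space \<Rightarrow> real) \<Rightarrow> bool" where
  "embeds_in_L0 N \<longleftrightarrow>
     (\<exists>(\<mu> :: 'a measure) (C :: real).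
        sets \<mu> = sets (restrict_space borel (sphere 0 1)) \<and> finite_measure \<mu> \<and>
        (\<forall>x. ext_ln (N x) = ext_integral \<mu> (\<lambda>\<xi>. ext_ln \<bar>x \<bullet> \<xi>\<bar>) + ereal C))"

end

theory Submission
  imports Defs "HOL-Probability.Probability"
begin

text \<open>Let \<open>p\<close> be the Minkowski functional of \<open>K\<close>. Along the ray through \<open>x\<close> the indicator function of \<open>K\<close> is 1
up to the parameter \<open>1 / p x\<close> and 0 afterwards, so the integral of \<open>1\<^sub>K(r x)\<close> against \<open>dr / r\<close> over
\<open>r > \<delta>\<close> is \<open>- ln (p x) - ln \<delta>\<close> for small \<open>\<delta>\<close>. Write a smoothed version \<open>f\<close> of \<open>1\<^sub>K\<close> as a superposition of plane
waves, \<open>f z = \<integral> w(\<xi>) B(\<xi>, z \<bullet> \<xi>) d\<gamma>(\<xi>)\<close>, where \<open>\<gamma>\<close> is the standard Gaussian measure and, by the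
symmetry of \<open>K\<close>, every \<open>B(\<xi>, \<cdot>)\<close> is even. Frullani's formula

  \<open>\<integral> (B(\<xi>, r s) - B(\<xi>, r t)) dr / r = B(\<xi>, 0) (ln \<bar>t\<bar> - ln \<bar>s\<bar>)\<close>

then turns the difference of two such ray integrals of \<open>f\<close> into an integral of
\<open>ln \<bar>y \<bullet> \<xi>\<bar> - ln \<bar>x \<bullet> \<xi>\<bar>\<close> against the density \<open>w(\<xi>) B(\<xi>, 0)\<close>. This is the representation that is
wanted, up to the smoothing error, and it is where the measure comes from.

Two facts make it work in dimension three. The kernel that smooths \<open>1\<^sub>K\<close> has to be integrable: with
\<open>ricker u = (1 - u\<^sup>2) exp (- u\<^sup>2 / 2)\<close>, the negative second derivative of a Gaussian, as wave profile
and \<open>w(\<xi>) = 1 - exp (- \<bar>\<xi>\<bar>\<^sup>2 / 2)\<close> as weight, the kernel is \<open>(1 + \<bar>z\<bar>\<^sup>2)\<^sup>-\<^sup>3\<^sup>/\<^sup>2 - (2 + \<bar>z\<bar>\<^sup>2)\<^sup>-\<^sup>3\<^sup>/\<^sup>2\<close>, which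
decays like \<open>\<bar>z\<bar>\<^sup>-\<^sup>5\<close> (\<open>plane_wave_kernel\<close>, \<open>smoothed_eq_plane_waves\<close>). And the density has to be
nonnegative: \<open>B(\<xi>, 0)\<close> is the integral over \<open>K\<close> of \<open>ricker (y \<bullet> \<xi>)\<close>, for unit \<open>\<xi>\<close> minus a smoothed second
derivative of the area of the sections of \<open>K\<close> orthogonal to \<open>\<xi>\<close>, and by Brunn's theorem that area decreases away
from the centre (\<open>ricker_section_nonneg\<close>).

To remove the smoothing error, replace \<open>K\<close> by \<open>r K\<close> with \<open>r\<close> tending to infinity. Projecting
\<open>w(\<xi>) B(\<xi>, 0) d\<gamma>(\<xi>)\<close> to the sphere and normalizing gives probability measures whose logarithmic
potentials \<open>x \<mapsto> \<integral> ln \<bar>x \<bullet> \<theta>\<bar>\<close> differ from \<open>ln (p x)\<close> by a constant plus an error that is uniform in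
\<open>x\<close> (\<open>log_discrepancy_uniform\<close>). A subsequence converges weakly
(\<open>prob_measures_on_compact_weakly_compact\<close>). The singularity of the logarithm obstructs the passage to
the limit at a single point \<open>x\<close>, so the potentials are averaged first: for independent standard
Gaussian \<open>g\<close> and \<open>\<zeta>\<close> and a unit vector \<open>\<theta>\<close>, the mean of \<open>ln \<bar>(g x + \<epsilon> \<zeta>) \<bullet> \<theta>\<bar>\<close> is
\<open>ln ((x \<bullet> \<theta>)\<^sup>2 + \<epsilon>\<^sup>2) / 2\<close> plus a universal constant, which is continuous in \<open>\<theta>\<close>. Letting \<open>\<epsilon>\<close> tend to 0
afterwards, by monotone convergence, gives the representation at every \<open>x \<noteq> 0\<close>
(\<open>log_representation_limit\<close>).\<close>

section \<open>Standard Gaussian measures\<close>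

abbreviation (input) gauss :: "real measure" where "gauss \<equiv> std_normal_distribution"

text \<open>A standard Gaussian measure on a Euclidean space is determined by its one-dimensional marginals. Taking
them as the definition makes every integral of a function of \<open>v \<bullet> x\<close> one-dimensional at once, and
keeps the notion independent of the way in which the measure is constructed.\<close>

definition standard_gaussian :: "'a::euclidean_space measure \<Rightarrow> bool" where
  "standard_gaussian M \<longleftrightarrow> prob_space M \<and> sets M = sets borel \<and>
     (\<forall>v. distr M borel (\<lambda>x. v \<bullet> x) = distr gauss borel (\<lambda>g. norm v * g))"

lemma standard_gaussianD:
  assumes "standard_gaussian M"
  shows "prob_space M" "sets M = sets borel" "space M = UNIV"
    "distr M borel (\<lambda>x. v \<bullet> x) = distr gauss borel (\<lambda>g. norm v * g)"
  using assms sets_eq_imp_space_eq[of M borel] by (auto simp: standard_gaussian_def)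

lemma char_distr_inner:
  assumes "sets M = sets borel"
  shows "char (distr M borel (\<lambda>x. v \<bullet> x)) t = (CLINT x|M. iexp (t * (v \<bullet> x)))"
proof -
  have [measurable]: "(\<lambda>x. v \<bullet> x) \<in> borel_measurable M"
    by (subst measurable_cong_sets[OF assms refl], intro borel_measurable_continuous_onI continuous_intros)
  show ?thesis unfolding char_def by (subst integral_distr) auto
qed

lemma char_distr_gauss_scale:
  "char (distr gauss borel (\<lambda>g. c * g)) t = exp (- ((t * c)^2) / 2)"
proof -
  have "char (distr gauss borel (\<lambda>g. c * g)) t = char gauss (t * c)"
    unfolding char_def by (subst integral_distr) (auto simp: mult.assoc)
  then show ?thesis by (simp add: char_std_normal_distribution)
qed

lemma prob_space_gauss: "prob_space gauss"
  using real_dist_normal_dist by (simp add: real_distribution_def)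

lemma standard_gaussian_gauss: "standard_gaussian gauss"
  unfolding standard_gaussian_def
proof (intro conjI allI prob_space_gauss)
  fix v :: real
  interpret g: prob_space gauss by (rule prob_space_gauss)
  show "distr gauss borel (\<lambda>x. v \<bullet> x) = distr gauss borel (\<lambda>g. norm v * g)"
    by (rule Levy_uniqueness)
      (auto simp: char_distr_gauss_scale power_mult_distrib intro!: ext real_distribution.intro g.prob_space_distr
         real_distribution_axioms.intro)
qed simp

text \<open>Levy's uniqueness theorem reduces the claim to characteristic functions. These multiply by Fubini, and
\<open>(norm v)\<^sup>2\<close> is the sum of the squared norms of the two components of \<open>v\<close>.\<close>

lemma standard_gaussian_pair:
  assumes "standard_gaussian M" "standard_gaussian N"
  shows "standard_gaussian (M \<Otimes>\<^sub>M N)"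
  unfolding standard_gaussian_def
proof (intro conjI allI)
  note M = standard_gaussianD[OF assms(1)] and N = standard_gaussianD[OF assms(2)]
  note [measurable_cong] = M(2) N(2)
  interpret M: prob_space M by (rule M)
  interpret N: prob_space N by (rule N)
  interpret MN: pair_prob_space M N ..
  show "prob_space (M \<Otimes>\<^sub>M N)" by (rule MN.prob_space_axioms)
  show sets: "sets (M \<Otimes>\<^sub>M N) = sets borel"
    using M(2) N(2) by (metis borel_prod sets_pair_measure_cong)
  interpret g: prob_space gauss by (rule prob_space_gauss)
  fix v :: "'a \<times> 'b"
  obtain a b where v: "v = (a, b)" by (cases v)
  have marg: "(CLINT x|L. iexp (t * (c \<bullet> x))) = exp (- ((t * norm c)^2) / 2)"
    if "standard_gaussian L" for L :: "'c::euclidean_space measure" and c t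
    using char_distr_inner[OF standard_gaussianD(2)[OF that], of c t]
    unfolding standard_gaussianD(4)[OF that] char_distr_gauss_scale by simp
  show "distr (M \<Otimes>\<^sub>M N) borel (\<lambda>x. v \<bullet> x) = distr gauss borel (\<lambda>g. norm v * g)"
  proof (rule Levy_uniqueness)
    show "real_distribution (distr (M \<Otimes>\<^sub>M N) borel (\<lambda>x. v \<bullet> x))"
      by (auto intro!: real_distribution.intro MN.prob_space_distr real_distribution_axioms.intro
          simp: measurable_cong_sets[OF sets refl])
    show "real_distribution (distr gauss borel (\<lambda>g. norm v * g))"
      by (auto intro!: real_distribution.intro g.prob_space_distr real_distribution_axioms.intro)
    show "char (distr (M \<Otimes>\<^sub>M N) borel (\<lambda>x. v \<bullet> x)) = char (distr gauss borel (\<lambda>g. norm v * g))"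
    proof
      fix t
      have "char (distr (M \<Otimes>\<^sub>M N) borel (\<lambda>x. v \<bullet> x)) t = (CLINT x|M \<Otimes>\<^sub>M N. iexp (t * (v \<bullet> x)))"
        by (rule char_distr_inner[OF sets])
      also have "\<dots> = (CLINT z|M \<Otimes>\<^sub>M N. iexp (t * (a \<bullet> fst z)) * iexp (t * (b \<bullet> snd z)))"
        by (intro Bochner_Integration.integral_cong)
          (auto simp: v inner_prod_def algebra_simps exp_add[symmetric])
      also have "\<dots> = (CLINT x|M. CLINT y|N. iexp (t * (a \<bullet> x)) * iexp (t * (b \<bullet> y)))"
        by (subst MN.integral_fst'[symmetric])
          (auto intro!: MN.integrable_const_bound[where B=1] simp: norm_mult)
      also have "\<dots> = exp (- ((t * norm a)^2) / 2) * exp (- ((t * norm b)^2) / 2)"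
        using marg[OF assms(1), of t a] marg[OF assms(2), of t b] by simp
      also have "\<dots> = exp (- ((t * norm v)^2) / 2)"
        by (simp add: exp_add[symmetric] of_real_mult[symmetric] v norm_Pair power_mult_distrib
             real_sqrt_pow2 field_simps del: of_real_mult)
      finally show "char (distr (M \<Otimes>\<^sub>M N) borel (\<lambda>x. v \<bullet> x)) t
        = char (distr gauss borel (\<lambda>g. norm v * g)) t"
        unfolding char_distr_gauss_scale .
    qed
  qed
qed

lemma standard_gaussian_integral_inner:
  fixes h :: "real \<Rightarrow> real"
  assumes "standard_gaussian M" and [measurable]: "h \<in> borel_measurable borel"
  shows "(\<integral>x. h (v \<bullet> x) \<partial>M) = (\<integral>g. h (norm v * g) \<partial>gauss)"
proof -
  note [measurable_cong] = standard_gaussianD(2)[OF assms(1)]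
  have "(\<integral>x. h (v \<bullet> x) \<partial>M) = (\<integral>y. h y \<partial>distr M borel (\<lambda>x. v \<bullet> x))"
    by (subst integral_distr) auto
  also have "\<dots> = (\<integral>g. h (norm v * g) \<partial>gauss)"
    unfolding standard_gaussianD(4)[OF assms(1)] by (subst integral_distr) auto
  finally show ?thesis .
qed

lemma standard_gaussian_integrable_inner:
  fixes h :: "real \<Rightarrow> real"
  assumes "standard_gaussian M" and [measurable]: "h \<in> borel_measurable borel"
  shows "integrable M (\<lambda>x. h (v \<bullet> x)) \<longleftrightarrow> integrable gauss (\<lambda>g. h (norm v * g))"
proof -
  note [measurable_cong] = standard_gaussianD(2)[OF assms(1)]
  have "integrable M (\<lambda>x. h (v \<bullet> x)) \<longleftrightarrow> integrable (distr M borel (\<lambda>x. v \<bullet> x)) h"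
    by (subst integrable_distr_eq) auto
  also have "\<dots> \<longleftrightarrow> integrable gauss (\<lambda>g. h (norm v * g))"
    unfolding standard_gaussianD(4)[OF assms(1)] by (subst integrable_distr_eq) auto
  finally show ?thesis .
qed

lemma standard_gaussian_AE_inner_nonzero:
  assumes M: "standard_gaussian M" and v: "v \<noteq> 0"
  shows "AE x in M. v \<bullet> x \<noteq> 0"
proof -
  note [measurable_cong] = standard_gaussianD(2)[OF M]
  have "AE g in gauss. g \<noteq> 0"
    by (subst AE_density) (auto intro!: AE_I'[of "{0}"])
  then have "AE g in gauss. norm v * g \<noteq> 0" by eventually_elim (use v in simp)
  then have "AE y in distr gauss borel (\<lambda>g. norm v * g). y \<noteq> 0"
    by (subst AE_distr_iff) auto
  then have "AE y in distr M borel (\<lambda>x. v \<bullet> x). y \<noteq> 0"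
    by (simp only: standard_gaussianD(4)[OF M])
  then show ?thesis by (subst (asm) AE_distr_iff) auto
qed

lemma standard_gaussian_integrable_norm:
  fixes M :: "'a::euclidean_space measure"
  assumes M: "standard_gaussian M"
  shows "integrable M norm"
proof -
  note [measurable_cong] = standard_gaussianD(2)[OF M]
  have i: "integrable M (\<lambda>x. \<Sum>b\<in>Basis. \<bar>b \<bullet> x\<bar>)"
  proof (rule Bochner_Integration.integrable_sum)
    fix b :: 'a assume "b \<in> Basis"
    have "integrable gauss (\<lambda>g. \<bar>norm b * g\<bar>)"
      using integrable_std_normal_distribution_moment[of 1]
      by (intro integrable_abs integrable_mult_right) simp
    then show "integrable M (\<lambda>x. \<bar>b \<bullet> x\<bar>)"
      by (subst standard_gaussian_integrable_inner[OF M, of abs]) auto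
  qed
  show ?thesis
    by (rule Bochner_Integration.integrable_bound[OF i])
      (auto intro!: AE_I2 order_trans[OF norm_le_l1] simp: inner_commute sum_nonneg)
qed

text \<open>Near 0 the logarithm is dominated by \<open>2 y powr (- 1 / 2)\<close>, away from 0 by \<open>y\<close>. The case \<open>c = 0\<close> is
covered because \<open>ln 0 = 0\<close>.\<close>

lemma integrable_gauss_ln: "integrable gauss (\<lambda>g. ln \<bar>c * g\<bar>)"
proof -
  define h where "h x = indicator {0<..1} x * x powr (- 1 / 2)" for x :: real
  have [measurable]: "h \<in> borel_measurable borel" unfolding h_def by measurable
  have nn: "0 \<le> h x" for x by (simp add: h_def)
  have "((\<lambda>x. x powr (- 1 / 2)) integrable_on {0<..1::real})"
    by (rule integrable_on_powr_from_0') auto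
  then obtain I where "((\<lambda>x. x powr (- 1 / 2)) has_integral I) {0<..1::real}" by blast
  then have "((\<lambda>x. if x \<in> {0<..1} then x powr (- 1 / 2) else 0) has_integral I) (UNIV::real set)"
    by (simp only: has_integral_restrict_UNIV)
  also have "(\<lambda>x. if x \<in> {0<..1} then x powr (- 1 / 2) else 0) = h" by (auto simp: h_def)
  finally have "integral\<^sup>N lborel h = I"
    by (intro nn_integral_has_integral_lborel nn) auto
  then have h: "integrable lborel h"
    by (intro integrableI_bounded) (auto simp: nn abs_of_nonneg)
  then have h': "integrable lborel (\<lambda>x. h (- x))"
    using lborel_integrable_real_affine[of h "-1" 0] by simp
  have ln0: "integrable gauss (\<lambda>g. ln \<bar>g\<bar>)"
  proof (subst integrable_density)
    have i: "integrable lborel (\<lambda>x. 2 * (h x + h (- x)) + std_normal_density x * \<bar>x\<bar> ^ 1)"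
      by (intro Bochner_Integration.integrable_add integrable_mult_right h h' integrable_std_normal_moment_abs)
    show "integrable lborel (\<lambda>x. std_normal_density x *\<^sub>R ln \<bar>x\<bar>)"
    proof (rule Bochner_Integration.integrable_bound[OF i], measurable, intro AE_I2)
      fix x :: real
      have d1: "std_normal_density x \<le> 1"
      proof -
        have "1 \<le> sqrt (2 * pi)" using pi_gt3 by (simp add: real_le_rsqrt)
        then have "1 / sqrt (2 * pi) * exp (- x\<^sup>2 / 2) \<le> 1 * 1" by (intro mult_mono) auto
        then show ?thesis by (simp add: std_normal_density_def)
      qed
      have d0: "0 \<le> std_normal_density x" by simp
      have key: "\<bar>ln y\<bar> \<le> 2 * y powr (- 1 / 2)" if "0 < y" "y \<le> 1" for y :: real
      proof -
        have "ln (y powr (- 1 / 2)) \<le> y powr (- 1 / 2)" using that by (intro less_imp_le[OF ln_less_self]) auto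
        then have "- ln y \<le> 2 * y powr (- 1 / 2)" using that by (simp add: ln_powr)
        then show ?thesis using that by simp
      qed
      consider "x = 0" | "0 < \<bar>x\<bar>" "\<bar>x\<bar> \<le> 1" | "\<bar>x\<bar> > 1" by linarith
      then have "norm (std_normal_density x *\<^sub>R ln \<bar>x\<bar>)
          \<le> 2 * (h x + h (- x)) + std_normal_density x * \<bar>x\<bar> ^ 1"
      proof cases
        case 2
        have "norm (std_normal_density x *\<^sub>R ln \<bar>x\<bar>) \<le> 1 * (2 * \<bar>x\<bar> powr (- 1 / 2))"
          unfolding real_norm_def real_scaleR_def abs_mult using d0 d1 key[OF 2]
          by (intro mult_mono) auto
        also have "1 * (2 * \<bar>x\<bar> powr (- 1 / 2)) = 2 * (h x + h (- x))"
          using 2 by (cases "0 < x") (auto simp: h_def)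
        finally show ?thesis using d0 by (simp add: add_increasing2)
      next
        case 3
        then have "0 \<le> ln \<bar>x\<bar>" "ln \<bar>x\<bar> < \<bar>x\<bar>" using ln_less_self[of "\<bar>x\<bar>"] by auto
        then have "\<bar>ln \<bar>x\<bar>\<bar> \<le> \<bar>x\<bar>" by linarith
        then have "norm (std_normal_density x *\<^sub>R ln \<bar>x\<bar>) \<le> std_normal_density x * \<bar>x\<bar> ^ 1"
          using d0 by (simp add: abs_mult mult_left_mono)
        then show ?thesis using nn[of x] nn[of "- x"] by simp
      qed (simp add: h_def)
      then show "norm (std_normal_density x *\<^sub>R ln \<bar>x\<bar>)
          \<le> norm (2 * (h x + h (- x)) + std_normal_density x * \<bar>x\<bar> ^ 1)" by simp
    qed
  qed auto
  show ?thesis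
  proof (cases "c = 0")
    case False
    interpret prob_space gauss by (rule prob_space_gauss)
    have AE: "AE g in gauss. g \<noteq> 0"
      by (subst AE_density) (auto intro!: AE_I'[of "{0}"])
    have "integrable gauss (\<lambda>g. ln \<bar>c\<bar> + ln \<bar>g\<bar>)" by (intro Bochner_Integration.integrable_add ln0) auto
    then show ?thesis
    proof (rule integrable_cong_AE_imp)
      show "AE g in gauss. ln \<bar>c\<bar> + ln \<bar>g\<bar> = ln \<bar>c * g\<bar>"
        using AE by eventually_elim (use False in \<open>simp add: abs_mult ln_mult\<close>)
    qed auto
  qed simp
qed

definition log_moment :: real where "log_moment = (\<integral>g. ln \<bar>g\<bar> \<partial>gauss)"

text \<open>This additivity is what later evaluates Gaussian averages of \<open>ln \<bar>z \<bullet> \<theta>\<bar>\<close> in closed form.\<close>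

lemma integral_gauss_ln: "c \<noteq> 0 \<Longrightarrow> (\<integral>g. ln \<bar>c * g\<bar> \<partial>gauss) = ln \<bar>c\<bar> + log_moment"
proof -
  assume c: "c \<noteq> 0"
  interpret prob_space gauss by (rule prob_space_gauss)
  have AE: "AE g in gauss. g \<noteq> 0"
    by (subst AE_density) (auto intro!: AE_I'[of "{0}"])
  have "(\<integral>g. ln \<bar>c * g\<bar> \<partial>gauss) = (\<integral>g. ln \<bar>c\<bar> + ln \<bar>g\<bar> \<partial>gauss)"
  proof (rule integral_cong_AE)
    show "AE g in gauss. ln \<bar>c * g\<bar> = ln \<bar>c\<bar> + ln \<bar>g\<bar>"
      using AE by eventually_elim (use c in \<open>simp add: abs_mult ln_mult\<close>)
  qed auto
  also have "\<dots> = ln \<bar>c\<bar> + log_moment"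
    using integrable_gauss_ln[of 1] by (simp add: log_moment_def prob_space[simplified])
  finally show ?thesis .
qed

lemma standard_gaussian_integrable_ln_inner:
  assumes M: "standard_gaussian M"
  shows "integrable M (\<lambda>\<xi>. ln \<bar>x \<bullet> \<xi>\<bar>)"
  using standard_gaussian_integrable_inner[OF M, of "\<lambda>u. ln \<bar>u\<bar>" x] integrable_gauss_ln[of "norm x"] by simp

text \<open>Multiplying the density of the standard Gaussian measure of \<open>\<real>\<^sup>d\<close> by \<open>exp (- \<bar>x\<bar>\<^sup>2 / 2)\<close> gives the
density proportional to \<open>exp (- \<bar>x\<bar>\<^sup>2)\<close>, which is again Gaussian with the variance halved, and of total
mass \<open>(1 / sqrt 2)\<^sup>d\<close>. The definition expresses this without mentioning densities, so that it passes to
products, and it is the only place where the dimension enters the kernel computation.\<close>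

definition gaussian_dim :: "nat \<Rightarrow> 'a::euclidean_space measure \<Rightarrow> bool" where
  "gaussian_dim d M \<longleftrightarrow> (\<forall>h \<in> borel_measurable borel.
     (\<integral>\<^sup>+x. ennreal (exp (- (norm x)\<^sup>2 / 2)) * h x \<partial>M)
       = ennreal (1 / sqrt 2) ^ d * (\<integral>\<^sup>+x. h (x /\<^sub>R sqrt 2) \<partial>M))"

lemma gaussian_dim_gauss: "gaussian_dim 1 gauss"
  unfolding gaussian_dim_def
proof
  fix h :: "real \<Rightarrow> ennreal" assume [measurable]: "h \<in> borel_measurable borel"
  have s: "std_normal_density (x / sqrt 2) * exp (- (x / sqrt 2)\<^sup>2 / 2) = std_normal_density x" for x
    unfolding std_normal_density_def mult.assoc mult_exp_exp
    by (simp add: power_divide field_simps)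
  have "(\<integral>\<^sup>+x. ennreal (exp (- (norm x)\<^sup>2 / 2)) * h x \<partial>gauss)
      = (\<integral>\<^sup>+x. ennreal (std_normal_density x * exp (- x\<^sup>2 / 2)) * h x \<partial>lborel)"
    by (subst nn_integral_density) (auto simp: ennreal_mult mult.assoc)
  also have "\<dots> = ennreal (1 / sqrt 2) *
      (\<integral>\<^sup>+x. ennreal (std_normal_density (x / sqrt 2) * exp (- (x / sqrt 2)\<^sup>2 / 2)) * h (x / sqrt 2) \<partial>lborel)"
    by (subst nn_integral_real_affine[where c="1 / sqrt 2" and t=0]) auto
  also have "\<dots> = ennreal (1 / sqrt 2) * (\<integral>\<^sup>+x. h (x / sqrt 2) \<partial>gauss)"
    unfolding s by (subst nn_integral_density) auto
  finally show "(\<integral>\<^sup>+x. ennreal (exp (- (norm x)\<^sup>2 / 2)) * h x \<partial>gauss)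
       = ennreal (1 / sqrt 2) ^ 1 * (\<integral>\<^sup>+x. h (x /\<^sub>R sqrt 2) \<partial>gauss)"
    by (simp add: field_simps)
qed

lemma gaussian_dim_pair:
  fixes M :: "'a::euclidean_space measure" and N :: "'b::euclidean_space measure"
  assumes M: "gaussian_dim d M" "prob_space M" and sM[measurable_cong]: "sets M = sets borel"
    and N: "gaussian_dim e N" "prob_space N" and sN[measurable_cong]: "sets N = sets borel"
  shows "gaussian_dim (d + e) (M \<Otimes>\<^sub>M N)"
  unfolding gaussian_dim_def
proof
  fix h :: "'a \<times> 'b \<Rightarrow> ennreal" assume h: "h \<in> borel_measurable borel"
  then have [measurable]: "h \<in> borel_measurable (borel \<Otimes>\<^sub>M borel)" by (simp add: borel_prod)
  interpret M: prob_space M by fact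
  interpret N: prob_space N by fact
  interpret MN: pair_prob_space M N ..
  let ?e = "\<lambda>x. ennreal (exp (- (norm x)\<^sup>2 / 2))"
  have [measurable]: "(\<lambda>z::'a \<times> 'b. norm z) \<in> borel_measurable (borel \<Otimes>\<^sub>M borel)"
    by (simp add: borel_prod)
  have e: "ennreal (exp (- (norm z)\<^sup>2 / 2)) = ?e (fst z) * ?e (snd z)" for z :: "'a \<times> 'b"
    by (simp add: norm_prod_def ennreal_mult[symmetric] mult_exp_exp field_simps)
  have "(\<integral>\<^sup>+z. ennreal (exp (- (norm z)\<^sup>2 / 2)) * h z \<partial>(M \<Otimes>\<^sub>M N))
      = (\<integral>\<^sup>+z. ?e (fst z) * (?e (snd z) * h z) \<partial>(M \<Otimes>\<^sub>M N))"
    unfolding e mult.assoc ..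
  also have "\<dots> = (\<integral>\<^sup>+x. (\<integral>\<^sup>+y. ?e x * (?e y * h (x, y)) \<partial>N) \<partial>M)"
    by (subst N.nn_integral_fst[symmetric]) auto
  also have "\<dots> = (\<integral>\<^sup>+x. ?e x * (\<integral>\<^sup>+y. (?e y * h (x, y)) \<partial>N) \<partial>M)"
    by (intro nn_integral_cong nn_integral_cmult) auto
  also have "\<dots> = (\<integral>\<^sup>+x. ?e x * (ennreal (1 / sqrt 2) ^ e * (\<integral>\<^sup>+y. h (x, y /\<^sub>R sqrt 2) \<partial>N)) \<partial>M)"
    using N(1) by (auto simp: gaussian_dim_def)
  also have "\<dots> = ennreal (1 / sqrt 2) ^ d *
      (\<integral>\<^sup>+x. ennreal (1 / sqrt 2) ^ e * (\<integral>\<^sup>+y. h (x /\<^sub>R sqrt 2, y /\<^sub>R sqrt 2) \<partial>N) \<partial>M)"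
    using M(1) by (auto simp: gaussian_dim_def)
  also have "\<dots> = ennreal (1 / sqrt 2) ^ (d + e) *
      (\<integral>\<^sup>+x. (\<integral>\<^sup>+y. h (x /\<^sub>R sqrt 2, y /\<^sub>R sqrt 2) \<partial>N) \<partial>M)"
    by (subst nn_integral_cmult) (auto simp: power_add mult.assoc)
  also have "\<dots> = ennreal (1 / sqrt 2) ^ (d + e) * (\<integral>\<^sup>+z. h (z /\<^sub>R sqrt 2) \<partial>(M \<Otimes>\<^sub>M N))"
    by (subst N.nn_integral_fst[symmetric]) (auto simp: scaleR_prod_def)
  finally show "(\<integral>\<^sup>+z. ennreal (exp (- (norm z)\<^sup>2 / 2)) * h z \<partial>(M \<Otimes>\<^sub>M N))
    = ennreal (1 / sqrt 2) ^ (d + e) * (\<integral>\<^sup>+z. h (z /\<^sub>R sqrt 2) \<partial>(M \<Otimes>\<^sub>M N))" .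
qed

lemma gaussian_dim_integral:
  fixes h :: "'a::euclidean_space \<Rightarrow> real"
  assumes M: "gaussian_dim d M" and sM[measurable_cong]: "sets M = sets borel"
    and [measurable]: "h \<in> borel_measurable borel"
  shows "(\<integral>x. exp (- (norm x)\<^sup>2 / 2) * h x \<partial>M) = (1 / sqrt 2) ^ d * (\<integral>x. h (x /\<^sub>R sqrt 2) \<partial>M)"
proof -
  have eq: "density M (\<lambda>x. ennreal (exp (- (norm x)\<^sup>2 / 2)))
      = density (distr M borel (\<lambda>x. x /\<^sub>R sqrt 2)) (\<lambda>_. ennreal ((1 / sqrt 2) ^ d))" (is "?L = ?R")
  proof (rule measure_eqI)
    show "sets ?L = sets ?R" by (simp add: sM)
    fix A assume "A \<in> sets ?L"
    then have [measurable]: "A \<in> sets borel" by (simp add: sM)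
    have "emeasure ?L A = (\<integral>\<^sup>+x. ennreal (exp (- (norm x)\<^sup>2 / 2)) * indicator A x \<partial>M)"
      by (subst emeasure_density) (auto simp: sM)
    also have "\<dots> = ennreal (1 / sqrt 2) ^ d * (\<integral>\<^sup>+x. indicator A (x /\<^sub>R sqrt 2) \<partial>M)"
      using M by (auto simp: gaussian_dim_def)
    also have "\<dots> = emeasure ?R A"
      by (subst emeasure_density) (auto simp: nn_integral_distr nn_integral_cmult ennreal_power simp del: nn_integral_indicator)
    finally show "emeasure ?L A = emeasure ?R A" .
  qed
  have "(\<integral>x. exp (- (norm x)\<^sup>2 / 2) * h x \<partial>M) = (\<integral>x. h x \<partial>?L)"
    by (subst integral_density) auto
  also have "\<dots> = (1 / sqrt 2) ^ d * (\<integral>x. h (x /\<^sub>R sqrt 2) \<partial>M)"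
    unfolding eq by (subst integral_density) (auto simp: integral_distr)
  finally show ?thesis .
qed

type_synonym r3 = "real \<times> real \<times> real"

abbreviation (input) gauss3 :: "r3 measure" where
  "gauss3 \<equiv> gauss \<Otimes>\<^sub>M (gauss \<Otimes>\<^sub>M gauss)"

lemma gauss3: "standard_gaussian gauss3" "gaussian_dim 3 gauss3"
proof -
  note g = standard_gaussian_gauss
  show "standard_gaussian gauss3" by (intro standard_gaussian_pair g)
  have "gaussian_dim (1 + (1 + 1)) gauss3"
    by (intro gaussian_dim_pair gaussian_dim_gauss standard_gaussianD[OF g]
        standard_gaussianD[OF standard_gaussian_pair[OF g g]])
  then show "gaussian_dim 3 gauss3" by (simp add: numeral_3_eq_3)
qed

lemmas prob_space_gauss3 = standard_gaussianD(1)[OF gauss3(1)]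

lemmas sets_gauss3 [measurable_cong] = standard_gaussianD(2)[OF gauss3(1)]

section \<open>A positive kernel composed of plane waves\<close>

text \<open>The Ricker wavelet, which is \<open>- G''\<close> for \<open>G u = exp (- u\<^sup>2 / 2)\<close>. Its primitive \<open>u exp (- u\<^sup>2 / 2)\<close> is
nonnegative on the positive half-line and vanishes at infinity.\<close>

definition ricker :: "real \<Rightarrow> real" where
  "ricker u = (1 - u\<^sup>2) * exp (- u\<^sup>2 / 2)"

lemma continuous_on_ricker [continuous_intros]:
  "continuous_on A f \<Longrightarrow> continuous_on A (\<lambda>x. ricker (f x))"
  unfolding ricker_def by (intro continuous_intros) auto

lemma ricker_measurable [measurable]: "ricker \<in> borel_measurable borel"
  by (intro borel_measurable_continuous_onI continuous_intros)

lemma ricker_minus [simp]: "ricker (- u) = ricker u"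
  by (simp add: ricker_def)

lemma abs_ricker_le: "\<bar>ricker u\<bar> \<le> 2"
proof -
  have "\<bar>1 - u\<^sup>2\<bar> \<le> 2 * (1 + u\<^sup>2 / 2)" by (auto simp: abs_le_iff)
  also have "\<dots> \<le> 2 * exp (u\<^sup>2 / 2)" by (intro mult_left_mono exp_ge_add_one_self) auto
  finally have "\<bar>1 - u\<^sup>2\<bar> * exp (- (u\<^sup>2 / 2)) \<le> 2 * exp (u\<^sup>2 / 2) * exp (- (u\<^sup>2 / 2))"
    by (intro mult_right_mono) auto
  then show ?thesis by (simp add: ricker_def abs_mult mult.assoc flip: exp_add)
qed

lemma ricker_lipschitz: "\<bar>ricker u - ricker v\<bar> \<le> 4 * \<bar>u - v\<bar>"
proof -
  have der: "(ricker has_real_derivative (x^3 - 3 * x) * exp (- x\<^sup>2 / 2)) (at x)" for x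
    unfolding ricker_def [abs_def]
    by (auto intro!: derivative_eq_intros simp: algebra_simps power2_eq_square power3_eq_cube)
  have bound: "\<bar>(x^3 - 3 * x) * exp (- x\<^sup>2 / 2)\<bar> \<le> 4" for x :: real
  proof -
    have e: "1 + x\<^sup>2 / 4 \<le> exp (x\<^sup>2 / 4)" by (rule exp_ge_add_one_self)
    have "0 \<le> (\<bar>x\<bar> / 2 - 1)\<^sup>2" by simp
    then have "\<bar>x\<bar> \<le> 1 + x\<^sup>2 / 4" by (simp add: power2_eq_square algebra_simps flip: abs_mult)
    then have x1: "\<bar>x\<bar> \<le> exp (x\<^sup>2 / 4)" using e by linarith
    have x2: "\<bar>x\<^sup>2 - 3\<bar> \<le> 4 * exp (x\<^sup>2 / 4)" using e zero_le_power2[of x] by linarith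
    have "\<bar>x^3 - 3 * x\<bar> = \<bar>x\<bar> * \<bar>x\<^sup>2 - 3\<bar>"
      by (simp add: abs_mult[symmetric] power2_eq_square power3_eq_cube algebra_simps)
    also have "\<dots> \<le> exp (x\<^sup>2 / 4) * (4 * exp (x\<^sup>2 / 4))" by (intro mult_mono x1 x2) auto
    also have "\<dots> = 4 * exp (x\<^sup>2 / 2)" by (simp flip: exp_add)
    finally have "\<bar>x^3 - 3 * x\<bar> * exp (- (x\<^sup>2 / 2)) \<le> 4 * exp (x\<^sup>2 / 2) * exp (- (x\<^sup>2 / 2))"
      by (intro mult_right_mono) auto
    then show ?thesis by (simp add: abs_mult mult.assoc flip: exp_add)
  qed
  have "norm (ricker u - ricker v) \<le> 4 * norm (u - v)"
    by (rule field_differentiable_bound[of UNIV ricker "\<lambda>x. (x^3 - 3 * x) * exp (- x\<^sup>2 / 2)"])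
      (use der bound in auto)
  then show ?thesis by simp
qed

lemma ricker_at_top: "(ricker \<longlongrightarrow> 0) at_top"
  unfolding ricker_def by real_asymp

text \<open>After the substitution \<open>g = t x\<close> with \<open>t\<^sup>2 = 1 / (1 + c\<^sup>2)\<close> the two Gaussian factors merge into one
standard density, and only its moments of order 0 and 2 remain.\<close>

lemma integral_gauss_ricker:
  "(\<integral>g. ricker (c * g) \<partial>gauss) = (1 / sqrt (1 + c\<^sup>2)) ^ 3"
proof -
  define t where "t = 1 / sqrt (1 + c\<^sup>2)"
  have pos: "1 + c\<^sup>2 > 0" by (smt (verit) zero_le_power2)
  then have t: "t > 0" "t\<^sup>2 = 1 / (1 + c\<^sup>2)" by (auto simp: t_def power_divide)
  have ct: "c\<^sup>2 * t\<^sup>2 = 1 - t\<^sup>2" using pos by (simp add: t field_simps)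
  have dens: "std_normal_density (t * x) * ricker (c * (t * x))
      = std_normal_density x - (1 - t\<^sup>2) * (std_normal_density x * x ^ (2 * 1))" for x
  proof -
    have "std_normal_density (t * x) * exp (- (c * (t * x))\<^sup>2 / 2) =
       1 / sqrt (2 * pi) * exp (- ((t\<^sup>2 + c\<^sup>2 * t\<^sup>2) * x\<^sup>2) / 2)"
      unfolding std_normal_density_def mult.assoc mult_exp_exp
      by (simp add: power_mult_distrib field_simps)
    also have "\<dots> = std_normal_density x" by (simp add: ct std_normal_density_def)
    finally have 1: "std_normal_density (t * x) * exp (- (c * (t * x))\<^sup>2 / 2) = std_normal_density x" .
    have "ricker (c * (t * x)) = (1 - (1 - t\<^sup>2) * x\<^sup>2) * exp (- (c * (t * x))\<^sup>2 / 2)"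
      unfolding ricker_def by (simp add: power_mult_distrib ct[symmetric] algebra_simps)
    then have 2: "std_normal_density (t * x) * ricker (c * (t * x)) =
      (1 - (1 - t\<^sup>2) * x\<^sup>2) * (std_normal_density (t * x) * exp (- (c * (t * x))\<^sup>2 / 2))"
      by simp
    show ?thesis unfolding 2 1 by (simp add: algebra_simps power2_eq_square)
  qed
  have "(\<integral>g. ricker (c * g) \<partial>gauss) = (\<integral>x. std_normal_density x * ricker (c * x) \<partial>lborel)"
    by (subst integral_density) auto
  also have "\<dots> = t * (\<integral>x. std_normal_density (t * x) * ricker (c * (t * x)) \<partial>lborel)"
    using t by (subst lborel_integral_real_affine[where c=t and t=0]) auto
  also have "\<dots> = t * (\<integral>x. std_normal_density x - (1 - t\<^sup>2) * (std_normal_density x * x ^ (2 * 1)) \<partial>lborel)"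
    by (simp only: dens)
  also have "\<dots> = t * (1 - (1 - t\<^sup>2) * 1)"
    using integrable_std_normal_moment[of "2*1"] integral_std_normal_moment_even[of 1]
      integrable_std_normal_moment[of 0] integral_std_normal_moment_even[of 0]
    by (subst Bochner_Integration.integral_diff) auto
  finally show ?thesis by (simp add: t_def power3_eq_cube power2_eq_square)
qed

text \<open>The weight vanishes at the origin to second order. Without it the superposition of plane waves would
decay only like \<open>\<bar>z\<bar>\<^sup>-\<^sup>3\<close>, which is not integrable in dimension three.\<close>

definition gap_weight :: "'a::real_normed_vector \<Rightarrow> real" where
  "gap_weight x = 1 - exp (- (norm x)\<^sup>2 / 2)"

lemma gap_weight_bounds: "0 \<le> gap_weight x" "gap_weight x \<le> 1"
  by (auto simp: gap_weight_def)

lemma gap_weight_measurable [measurable]: "gap_weight \<in> borel_measurable borel"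
  unfolding gap_weight_def by measurable

definition plane_wave_kernel :: "'a::real_normed_vector \<Rightarrow> real" where
  "plane_wave_kernel z = (1 / sqrt (1 + (norm z)\<^sup>2)) ^ 3 - (1 / sqrt (2 + (norm z)\<^sup>2)) ^ 3"

text \<open>The constant 1 in the weight contributes the first term of the kernel, and the Gaussian in the weight,
after rescaling by \<open>1 / sqrt 2\<close>, contributes the second one. The factor \<open>(1 / sqrt 2)\<^sup>3\<close> from
dimension three turns \<open>1 + \<bar>z\<bar>\<^sup>2 / 2\<close> into \<open>2 + \<bar>z\<bar>\<^sup>2\<close>.\<close>

lemma plane_wave_kernel:
  assumes G: "standard_gaussian M" "gaussian_dim 3 M"
  shows "(\<integral>\<xi>. gap_weight \<xi> * ricker (z \<bullet> \<xi>) \<partial>M) = plane_wave_kernel z"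
proof -
  note [measurable_cong] = standard_gaussianD(2)[OF G(1)]
  interpret prob_space M by (rule standard_gaussianD(1)[OF G(1)])
  have i1: "integrable M (\<lambda>\<xi>. ricker (z \<bullet> \<xi>))"
    by (rule integrable_const_bound[where B=2]) (auto simp: abs_ricker_le)
  have "\<bar>exp (- (norm \<xi>)\<^sup>2 / 2) * ricker (z \<bullet> \<xi>)\<bar> \<le> 1 * 2" for \<xi>
    unfolding abs_mult by (intro mult_mono abs_ricker_le) auto
  then have i2: "integrable M (\<lambda>\<xi>. exp (- (norm \<xi>)\<^sup>2 / 2) * ricker (z \<bullet> \<xi>))"
    by (intro integrable_const_bound[where B=2]) auto
  have *: "1 / sqrt 2 * (1 / sqrt (1 + (norm z / sqrt 2)\<^sup>2)) = 1 / sqrt (2 + (norm z)\<^sup>2)"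
    by (simp add: power_divide real_sqrt_mult[symmetric] distrib_left)
  have "(\<integral>\<xi>. exp (- (norm \<xi>)\<^sup>2 / 2) * ricker (z \<bullet> \<xi>) \<partial>M)
     = (1 / sqrt 2) ^ 3 * (\<integral>\<xi>. ricker (z \<bullet> (\<xi> /\<^sub>R sqrt 2)) \<partial>M)"
    by (rule gaussian_dim_integral[OF G(2)]) (auto simp: standard_gaussianD[OF G(1)])
  also have "(\<integral>\<xi>. ricker (z \<bullet> (\<xi> /\<^sub>R sqrt 2)) \<partial>M) = (\<integral>g. ricker (norm z / sqrt 2 * g) \<partial>gauss)"
    using standard_gaussian_integral_inner[OF G(1), of ricker "z /\<^sub>R sqrt 2"]
    by (simp add: divide_inverse mult.commute)
  also have "(1 / sqrt 2) ^ 3 * \<dots> = (1 / sqrt (2 + (norm z)\<^sup>2)) ^ 3"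
    unfolding integral_gauss_ricker power_mult_distrib[symmetric] * ..
  finally have "(\<integral>\<xi>. exp (- (norm \<xi>)\<^sup>2 / 2) * ricker (z \<bullet> \<xi>) \<partial>M) = (1 / sqrt (2 + (norm z)\<^sup>2)) ^ 3" .
  moreover have "(\<integral>\<xi>. ricker (z \<bullet> \<xi>) \<partial>M) = (1 / sqrt (1 + (norm z)\<^sup>2)) ^ 3"
    using standard_gaussian_integral_inner[OF G(1), of ricker z] by (simp add: integral_gauss_ricker)
  ultimately show ?thesis
    unfolding gap_weight_def plane_wave_kernel_def left_diff_distrib
    by (subst Bochner_Integration.integral_diff) (use i1 i2 in auto)
qed

lemma plane_wave_kernel_continuous [continuous_intros]:
  "continuous_on A f \<Longrightarrow> continuous_on A (\<lambda>x. plane_wave_kernel (f x))"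
proof -
  have "1 + (norm (f x))\<^sup>2 \<noteq> 0" "2 + (norm (f x))\<^sup>2 \<noteq> 0" for x
    by (smt (verit) zero_le_power2)+
  then show "continuous_on A f \<Longrightarrow> continuous_on A (\<lambda>x. plane_wave_kernel (f x))"
  unfolding plane_wave_kernel_def by (intro continuous_intros) auto
qed

lemma plane_wave_kernel_measurable [measurable]:
  "(plane_wave_kernel :: 'a::euclidean_space \<Rightarrow> real) \<in> borel_measurable borel"
  by (intro borel_measurable_continuous_onI continuous_intros)

lemma plane_wave_kernel_pos: "0 < plane_wave_kernel z"
  unfolding plane_wave_kernel_def
proof -
  have "0 < 1 + (norm z)\<^sup>2" by (smt (verit) zero_le_power2)
  then have "1 / sqrt (2 + (norm z)\<^sup>2) < 1 / sqrt (1 + (norm z)\<^sup>2)"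
    by (intro divide_strict_left_mono) (auto intro: mult_pos_pos)
  then have "(1 / sqrt (2 + (norm z)\<^sup>2)) ^ 3 < (1 / sqrt (1 + (norm z)\<^sup>2)) ^ 3"
    by (intro power_strict_mono) auto
  then show "0 < (1 / sqrt (1 + (norm z)\<^sup>2)) ^ 3 - (1 / sqrt (2 + (norm z)\<^sup>2)) ^ 3" by simp
qed

text \<open>With \<open>A = sqrt (1 + \<bar>z\<bar>\<^sup>2)\<close> and \<open>B = sqrt (2 + \<bar>z\<bar>\<^sup>2)\<close>, the relation \<open>B\<^sup>2 - A\<^sup>2 = 1\<close> gives \<open>B - A \<le> 1 / (2 A)\<close>. The
difference of the cubes of \<open>1 / A\<close> and \<open>1 / B\<close> is therefore of order \<open>A\<^sup>-\<^sup>5\<close>, two orders better than each of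
them, and one order is left for the factor \<open>1 + norm z\<close>.\<close>

lemma plane_wave_kernel_decay: "(1 + norm z) * plane_wave_kernel z \<le> 3 / (1 + (norm z)\<^sup>2)\<^sup>2"
proof -
  define A where "A = sqrt (1 + (norm z)\<^sup>2)"
  define B where "B = sqrt (2 + (norm z)\<^sup>2)"
  have p: "0 < 1 + (norm z)\<^sup>2" by (smt (verit) zero_le_power2)
  have A1: "1 \<le> A" by (simp add: A_def)
  have AB: "A \<le> B" by (simp add: A_def B_def)
  have nA: "norm z \<le> A" unfolding A_def by (intro real_le_rsqrt) simp
  have sq: "A\<^sup>2 = 1 + (norm z)\<^sup>2" "B\<^sup>2 = 2 + (norm z)\<^sup>2" using p by (auto simp: A_def B_def)
  have cube: "a ^ 3 - b ^ 3 \<le> 3 * a\<^sup>2 * (a - b)" if "0 \<le> b" "b \<le> a" for a b :: real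
  proof -
    have "a ^ 3 - b ^ 3 = (a - b) * (a\<^sup>2 + a * b + b\<^sup>2)" by (simp add: power3_eq_cube power2_eq_square algebra_simps)
    also have "\<dots> \<le> (a - b) * (a\<^sup>2 + a * a + a\<^sup>2)"
      using that by (intro mult_left_mono add_mono power_mono mult_left_mono) auto
    finally show ?thesis by (simp add: power2_eq_square algebra_simps)
  qed
  have "(B - A) * (2 * A) \<le> (B - A) * (A + B)" using A1 AB by (intro mult_left_mono) auto
  also have "\<dots> = 1" using sq by (simp add: power2_eq_square algebra_simps)
  finally have BA: "(B - A) * (2 * A) \<le> 1" .
  have "plane_wave_kernel z \<le> 3 * (1 / A)\<^sup>2 * (1 / A - 1 / B)"
    unfolding plane_wave_kernel_def A_def[symmetric] B_def[symmetric]
    using A1 AB by (intro cube) (auto intro: divide_left_mono)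
  also have "1 / A - 1 / B = (B - A) / (A * B)" using A1 AB by (simp add: field_simps)
  also have "\<dots> \<le> (B - A) / (A * A)" using A1 AB by (intro divide_left_mono mult_left_mono) auto
  finally have 1: "plane_wave_kernel z \<le> 3 * (1 / A)\<^sup>2 * ((B - A) / (A * A))"
    using A1 by (auto simp: mult_left_mono)
  have "(1 + norm z) * plane_wave_kernel z \<le> (2 * A) * (3 * (1 / A)\<^sup>2 * ((B - A) / (A * A)))"
    using A1 nA by (intro mult_mono 1) (auto intro: less_imp_le[OF plane_wave_kernel_pos])
  also have "\<dots> = 3 * ((B - A) * (2 * A)) / (A\<^sup>2)\<^sup>2" using A1 by (simp add: field_simps power2_eq_square)
  also have "\<dots> \<le> 3 * 1 / (A\<^sup>2)\<^sup>2" by (intro divide_right_mono mult_left_mono BA) auto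
  finally show ?thesis by (simp add: sq)
qed

lemma integrable_one_plus_square_powr: "integrable lborel (\<lambda>x::real. (1 + x\<^sup>2) powr (- 2 / 3))"
proof -
  define h where "h x = indicator {0..} x * (2 * (1 + x) powr (- 4 / 3))" for x :: real
  have [measurable]: "h \<in> borel_measurable borel" unfolding h_def by measurable
  have "(\<integral>\<^sup>+x. ennreal (2 * (1 + x) powr (- 4 / 3)) * indicator {0..} x \<partial>lborel)
     = ennreal (0 - (- 6) * (1 + 0) powr (- 1 / 3))"
  proof (rule nn_integral_FTC_atLeast)
    show "((\<lambda>x::real. - 6 * (1 + x) powr (- 1 / 3)) \<longlongrightarrow> 0) at_top" by real_asymp
  qed (auto intro!: derivative_eq_intros)
  also have "\<dots> < \<infinity>" by simp
  finally have "(\<integral>\<^sup>+x. ennreal (norm (h x)) \<partial>lborel) < \<infinity>"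
    by (rule le_less_trans[rotated]) (auto intro!: nn_integral_mono simp: h_def split: split_indicator)
  then have h: "integrable lborel h" by (intro integrableI_bounded) auto
  then have h': "integrable lborel (\<lambda>x. h (- x))"
    using lborel_integrable_real_affine[of h "-1" 0] by simp
  have bound: "(1 + x\<^sup>2) powr (- 2 / 3) \<le> 2 * (1 + \<bar>x\<bar>) powr (- 4 / 3)" for x :: real
  proof -
    have "0 \<le> (1 - \<bar>x\<bar>)\<^sup>2" by simp
    then have "(1 + \<bar>x\<bar>)\<^sup>2 / 2 \<le> 1 + x\<^sup>2" by (simp add: power2_eq_square algebra_simps)
    then have "(1 + x\<^sup>2) powr (- 2 / 3) \<le> ((1 + \<bar>x\<bar>)\<^sup>2 / 2) powr (- 2 / 3)"
      by (intro powr_mono2') auto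
    also have "\<dots> = (1 + \<bar>x\<bar>) powr (- 4 / 3) * 2 powr (2 / 3)"
      by (simp add: powr_divide powr_powr powr_minus_divide flip: powr_numeral)
    also have "\<dots> \<le> (1 + \<bar>x\<bar>) powr (- 4 / 3) * 2 powr 1"
      by (intro mult_left_mono powr_mono) auto
    finally show ?thesis by (simp add: mult.commute)
  qed
  show ?thesis
  proof (rule Bochner_Integration.integrable_bound[OF Bochner_Integration.integrable_add[OF h h']])
    show "AE x in lborel. norm ((1 + x\<^sup>2) powr (- 2 / 3)) \<le> norm (h x + h (- x))"
    proof (intro AE_I2)
      fix x :: real
      show "norm ((1 + x\<^sup>2) powr (- 2 / 3)) \<le> norm (h x + h (- x))"
        using bound[of x] by (cases "x = 0"; cases "x > 0") (auto simp: h_def)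
    qed
  qed measurable
qed

lemma lborel_integrable_times:
  fixes f :: "'a::euclidean_space \<Rightarrow> real" and g :: "'b::euclidean_space \<Rightarrow> real"
  assumes f: "integrable lborel f" and g: "integrable lborel g"
  shows "integrable lborel (\<lambda>z. f (fst z) * g (snd z))"
proof -
  have [measurable]: "f \<in> borel_measurable borel" "g \<in> borel_measurable borel"
    using f g by auto
  have "integrable (lborel \<Otimes>\<^sub>M lborel) (\<lambda>z. f (fst z) * g (snd z))"
  proof (rule lborel_pair.Fubini_integrable)
    show "(\<lambda>z. f (fst z) * g (snd z)) \<in> borel_measurable (lborel \<Otimes>\<^sub>M lborel)" by measurable
    show "integrable lborel (\<lambda>x. \<integral>y. norm (f (fst (x, y)) * g (snd (x, y))) \<partial>lborel)"
      using f by (simp add: abs_mult)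
    show "AE x in lborel. integrable lborel (\<lambda>y. f (fst (x, y)) * g (snd (x, y)))"
      using g by simp
  qed
  then show ?thesis by (simp add: lborel_prod)
qed

text \<open>Each of the factors \<open>1 + z\<^sub>i\<^sup>2\<close> is at most \<open>1 + \<bar>z\<bar>\<^sup>2\<close>. Spreading the exponent 2 over three coordinates
leaves the exponent \<open>2 / 3 > 1 / 2\<close> for each, which is integrable on the line.\<close>

lemma integrable_inverse_square_one_plus_norm:
  "integrable lborel (\<lambda>z::r3. 1 / (1 + (norm z)\<^sup>2)\<^sup>2)"
proof (rule Bochner_Integration.integrable_bound)
  let ?g = "\<lambda>x::real. (1 + x\<^sup>2) powr (- 2 / 3)"
  show "integrable lborel (\<lambda>z. ?g (fst z) * (?g (fst (snd z)) * ?g (snd (snd z))))"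
    by (intro lborel_integrable_times integrable_one_plus_square_powr
        lborel_integrable_times[of ?g "\<lambda>z. ?g (fst z) * ?g (snd z)", simplified])
  show "AE z in lborel. norm (1 / (1 + (norm z)\<^sup>2)\<^sup>2)
      \<le> norm (?g (fst z) * (?g (fst (snd z)) * ?g (snd (snd z))))"
  proof (intro AE_I2)
    fix z :: "r3"
    obtain a b c where z: "z = (a, b, c)" by (cases z) auto
    define q where "q = 1 + (norm z)\<^sup>2"
    have n: "(norm z)\<^sup>2 = a\<^sup>2 + (b\<^sup>2 + c\<^sup>2)" by (simp add: z norm_Pair)
    have pos: "0 < 1 + x\<^sup>2" for x :: real by (smt (verit) zero_le_power2)
    have q: "0 < q" using pos unfolding q_def by blast
    have le: "q powr (- 2 / 3) \<le> ?g x" if "x\<^sup>2 \<le> (norm z)\<^sup>2" for x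
      using that pos[of x] by (intro powr_mono2') (auto simp: q_def)
    have "1 / q\<^sup>2 = q powr (- 2)" using q by (simp add: powr_minus_divide)
    also have "\<dots> = q powr (- 2 / 3) * (q powr (- 2 / 3) * q powr (- 2 / 3))"
      by (simp flip: powr_add)
    also have "\<dots> \<le> ?g a * (?g b * ?g c)"
      by (intro mult_mono le) (auto simp: n)
    finally show "norm (1 / (1 + (norm z)\<^sup>2)\<^sup>2)
      \<le> norm (?g (fst z) * (?g (fst (snd z)) * ?g (snd (snd z))))"
      by (simp add: z q_def)
  qed
  show "(\<lambda>z::r3. 1 / (1 + (norm z)\<^sup>2)\<^sup>2) \<in> borel_measurable lborel"
    by measurable
qed

lemma integrable_plane_wave_kernel:
  "integrable lborel (plane_wave_kernel :: r3 \<Rightarrow> real)" (is ?A)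
  "integrable lborel (\<lambda>z::r3. norm z * plane_wave_kernel z)" (is ?B)
proof -
  have i: "integrable lborel (\<lambda>z::r3. 3 / (1 + (norm z)\<^sup>2)\<^sup>2)"
    using integrable_mult_right[OF integrable_inverse_square_one_plus_norm, of 3] by simp
  have b: "plane_wave_kernel z \<le> 3 / (1 + (norm z)\<^sup>2)\<^sup>2"
     "norm z * plane_wave_kernel z \<le> 3 / (1 + (norm z)\<^sup>2)\<^sup>2" for z :: "r3"
  proof -
    have "0 \<le> plane_wave_kernel z" "0 \<le> norm z * plane_wave_kernel z"
      using plane_wave_kernel_pos[of z] by auto
    moreover have "plane_wave_kernel z + norm z * plane_wave_kernel z \<le> 3 / (1 + (norm z)\<^sup>2)\<^sup>2"
      using plane_wave_kernel_decay[of z] by (simp add: distrib_right)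
    ultimately show "plane_wave_kernel z \<le> 3 / (1 + (norm z)\<^sup>2)\<^sup>2"
      "norm z * plane_wave_kernel z \<le> 3 / (1 + (norm z)\<^sup>2)\<^sup>2"
      by linarith+
  qed
  show ?A by (rule Bochner_Integration.integrable_bound[OF i])
      (auto simp del: split_paired_All intro!: AE_I2 b simp: abs_mult abs_of_pos[OF plane_wave_kernel_pos])
  show ?B by (rule Bochner_Integration.integrable_bound[OF i])
      (auto simp del: split_paired_All intro!: AE_I2 b simp: abs_mult abs_of_pos[OF plane_wave_kernel_pos])
qed

definition kernel_mass :: real where
  "kernel_mass = (\<integral>w. plane_wave_kernel w \<partial>(lborel :: r3 measure))"

text \<open>The first moment of the kernel controls, by Markov's inequality, how far the smoothing can be felt.\<close>

definition kernel_moment :: real where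
  "kernel_moment = (\<integral>w. norm w * plane_wave_kernel w \<partial>(lborel :: r3 measure))"

lemma kernel_mass_pos: "0 < kernel_mass"
  unfolding kernel_mass_def
proof (rule ccontr)
  let ?k = "plane_wave_kernel :: r3 \<Rightarrow> real"
  have nn: "AE w in lborel. 0 \<le> ?k w" by (intro AE_I2 less_imp_le plane_wave_kernel_pos)
  assume "\<not> 0 < integral\<^sup>L lborel ?k"
  then have "integral\<^sup>L lborel ?k = 0" using integral_nonneg_AE[OF nn] by linarith
  then have "AE w in lborel. ?k w = 0"
    using integral_nonneg_eq_0_iff_AE[OF integrable_plane_wave_kernel(1) nn] by blast
  then have "AE w in (lborel :: r3 measure). False"
    by eventually_elim (use plane_wave_kernel_pos less_irrefl in metis)
  then show False by (simp add: eventually_False ae_filter_eq_bot_iff)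
qed

lemma kernel_moment_nonneg: "0 \<le> kernel_moment"
  unfolding kernel_moment_def
  by (intro Bochner_Integration.integral_nonneg mult_nonneg_nonneg less_imp_le[OF plane_wave_kernel_pos]) auto

section \<open>Nonnegativity of the section integrals\<close>

definition sym_convex_compact :: "'a::euclidean_space set \<Rightarrow> bool" where
  "sym_convex_compact P \<longleftrightarrow> compact P \<and> convex P \<and> (\<forall>x\<in>P. - x \<in> P)"

lemma integrable_indicator_times_bounded:
  fixes h :: "'a::euclidean_space \<Rightarrow> real"
  assumes "compact P" and [measurable]: "h \<in> borel_measurable borel" and B: "\<And>x. \<bar>h x\<bar> \<le> B"
  shows "integrable lborel (\<lambda>x. indicator P x * h x)"
proof -
  have [measurable]: "P \<in> sets borel" using assms(1) by (simp add: borel_compact)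
  have "integrable lborel (\<lambda>x. B * indicator P x)"
    using assms(1) by (intro integrable_mult_right integrable_real_indicator)
      (auto intro: emeasure_bounded_finite[unfolded infinity_ennreal_def] compact_imp_bounded)
  then show ?thesis
    by (rule Bochner_Integration.integrable_bound) (auto intro!: AE_I2 order_trans[OF B abs_ge_self] simp: indicator_def)
qed

text \<open>Fubini with the first coordinate inside sees only the lengths of the slices of \<open>P\<close> parallel to the
first axis. Each slice is a compact interval of some length \<open>l\<close>, and sliding it to \<open>[0, l]\<close> changes
nothing. The resulting set \<open>S\<close> consists of the pairs \<open>(c, z)\<close> for which the slice over \<open>z\<close> has length at
least \<open>c\<close>. For fixed \<open>c\<close> these \<open>z\<close> form a compact convex symmetric set, because two chords of length
at least \<open>c\<close> in a convex set and parallel to each other have such chords at all intermediate places. Integrating over \<open>z\<close>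
first reduces the claim to one dimension less. Applied repeatedly, this plays the role of Brunn's theorem.\<close>

lemma slab_rearrangement:
  fixes P :: "(real \<times> 'c::euclidean_space) set" and h :: "'c \<Rightarrow> real"
  assumes P: "sym_convex_compact P" and h: "h \<in> borel_measurable borel" "\<And>x. \<bar>h x\<bar> \<le> B"
    and pos: "\<And>Q. sym_convex_compact Q \<Longrightarrow> 0 \<le> (\<integral>z. indicator Q z * h z \<partial>lborel)"
  shows "0 \<le> (\<integral>p. indicator P p * h (snd p) \<partial>lborel)"
proof -
  have cP: "compact P" and vP: "convex P" and sP: "\<And>x. x \<in> P \<Longrightarrow> - x \<in> P"
    using P by (auto simp: sym_convex_compact_def)
  define S where "S = {(c, z). 0 \<le> c \<and> (\<exists>v. (v, z) \<in> P \<and> (v + c, z) \<in> P)}"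
  have Simg: "S = (\<lambda>(p, q). (fst q - fst p, snd p)) ` ((P \<times> P) \<inter> {(p, q). snd p = snd q \<and> fst p \<le> fst q})"
    unfolding S_def by (force simp: image_iff)
  have "closed {(p::real \<times> 'c, q::real \<times> 'c). snd p = snd q \<and> fst p \<le> fst q}"
    unfolding case_prod_unfold
    by (intro closed_Collect_conj closed_Collect_eq closed_Collect_le continuous_intros)
  then have cS: "compact S"
    unfolding Simg case_prod_unfold
    by (intro compact_continuous_image compact_Int_closed compact_Times cP continuous_intros)
  have hs: "(\<lambda>p. h (snd p)) \<in> borel_measurable (borel :: (real \<times> 'c) measure)"
    by (rule measurable_compose[OF _ h(1)]) (intro borel_measurable_continuous_onI continuous_intros)
  have int: "integrable (lborel \<Otimes>\<^sub>M lborel) (\<lambda>(v, z). indicator Q (v, z) * h z)" if "compact Q" for Q :: "(real \<times> 'c) set"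
  proof -
    have eq: "(\<lambda>(v, z). indicator Q (v, z) * h z) = (\<lambda>p. indicator Q p * h (snd p))" by auto
    show ?thesis
      unfolding lborel_prod eq by (intro integrable_indicator_times_bounded[where B=B, OF that hs] h(2))
  qed
  \<comment> \<open>\<open>P\<close> and \<open>S\<close> have slices of the same length over every \<open>z\<close>.\<close>
  have slices: "(\<integral>v. indicator P (v, z) * h z \<partial>lborel) = (\<integral>c. indicator S (c, z) * h z \<partial>lborel)" for z
  proof -
    let ?I = "{v. (v, z) \<in> P}"
    have "?I = fst ` (P \<inter> (UNIV \<times> {z}))" by force
    moreover have "compact (fst ` (P \<inter> (UNIV \<times> {z})))"
      by (intro compact_continuous_image compact_Int_closed cP closed_Times continuous_intros)
    ultimately have "compact ?I" by simp
    moreover have "convex ?I"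
      unfolding convex_alt
    proof safe
      fix x y u :: real assume *: "(x, z) \<in> P" "(y, z) \<in> P" "0 \<le> u" "u \<le> 1"
      have "(1 - u) *\<^sub>R (x, z) + u *\<^sub>R (y, z) \<in> P" using * by (intro convexD_alt[OF vP]) auto
      then show "((1 - u) *\<^sub>R x + u *\<^sub>R y, z) \<in> P" by (simp add: scaleR_left_diff_distrib)
    qed
    ultimately obtain a b where ab: "?I = {a..b}"
      using convex_connected connected_compact_interval_1 by metis
    have inP: "(v, z) \<in> P \<longleftrightarrow> a \<le> v \<and> v \<le> b" for v using ab by auto
    have 1: "indicator P (v, z) = (indicator {a..b} v :: real)" for v using inP by (simp add: indicator_def)
    have 2: "indicator S (c, z) = (indicator (if a \<le> b then {0..b - a} else {}) c :: real)" for c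
    proof -
      have "(c, z) \<in> S \<longleftrightarrow> a \<le> b \<and> 0 \<le> c \<and> c \<le> b - a"
        unfolding S_def by (auto simp: inP intro!: exI[of _ a])
      then show ?thesis by (simp add: indicator_def)
    qed
    show ?thesis unfolding 1 2 by simp
  qed
  have "(\<integral>p. indicator P p * h (snd p) \<partial>lborel) = (\<integral>p. (\<lambda>(v, z). indicator P (v, z) * h z) p \<partial>(lborel \<Otimes>\<^sub>M lborel))"
    unfolding lborel_prod by (intro Bochner_Integration.integral_cong) auto
  also have "\<dots> = (\<integral>z. (\<integral>v. indicator P (v, z) * h z \<partial>lborel) \<partial>lborel)"
    by (rule lborel_pair.integral_snd[symmetric, OF int[OF cP]])
  also have "\<dots> = (\<integral>z. (\<integral>c. indicator S (c, z) * h z \<partial>lborel) \<partial>lborel)"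
    by (simp only: slices)
  also have "\<dots> = (\<integral>c. (\<integral>z. indicator S (c, z) * h z \<partial>lborel) \<partial>lborel)"
    by (rule lborel_pair.Fubini_integral[OF int[OF cS]])
  also have "\<dots> \<ge> 0"
  proof (rule Bochner_Integration.integral_nonneg)
    fix c :: real
    let ?Q = "{z. (c, z) \<in> S}"
    show "0 \<le> (\<integral>z. indicator S (c, z) * h z \<partial>lborel)"
    proof (cases "0 \<le> c")
      case True
      have Q: "?Q = {z. \<exists>v. (v, z) \<in> P \<and> (v + c, z) \<in> P}" using True by (simp add: S_def)
      have "?Q = snd ` (S \<inter> ({c} \<times> UNIV))" by force
      moreover have "compact (snd ` (S \<inter> ({c} \<times> UNIV)))"
        by (intro compact_continuous_image compact_Int_closed cS closed_Times continuous_intros)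
      moreover have "convex ?Q"
        unfolding Q convex_alt
      proof safe
        fix x y :: 'c and u v w :: real
        assume *: "(v, x) \<in> P" "(v + c, x) \<in> P" "(w, y) \<in> P" "(w + c, y) \<in> P" "0 \<le> u" "u \<le> 1"
        have "(1 - u) *\<^sub>R (v, x) + u *\<^sub>R (w, y) \<in> P" "(1 - u) *\<^sub>R (v + c, x) + u *\<^sub>R (w + c, y) \<in> P"
          by (rule convexD_alt[OF vP *(1) *(3) *(5,6)], rule convexD_alt[OF vP *(2) *(4) *(5,6)])
        then show "\<exists>t. (t, (1 - u) *\<^sub>R x + u *\<^sub>R y) \<in> P \<and> (t + c, (1 - u) *\<^sub>R x + u *\<^sub>R y) \<in> P"
          by (intro exI[of _ "(1 - u) * v + u * w"]) (auto simp: algebra_simps)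
      qed
      moreover have "- z \<in> ?Q" if "z \<in> ?Q" for z
      proof -
        obtain v where "(v, z) \<in> P" "(v + c, z) \<in> P" using \<open>z \<in> ?Q\<close> unfolding Q by auto
        then have "(- v - c, - z) \<in> P" "(- v - c + c, - z) \<in> P" using sP by (force)+
        then show ?thesis unfolding Q by blast
      qed
      ultimately have "sym_convex_compact ?Q" by (auto simp: sym_convex_compact_def)
      from pos[OF this] show ?thesis by (simp add: indicator_def)
    next
      case False
      then have "indicator S (c, z) = (0::real)" for z by (simp add: S_def)
      then show ?thesis by simp
    qed
  qed
  finally show ?thesis .
qed

text \<open>A symmetric interval \<open>[- b, b]\<close> contributes \<open>2 b exp (- b\<^sup>2 / 2)\<close>.\<close>

lemma ricker_interval_nonneg:
  assumes "sym_convex_compact (Q :: real set)"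
  shows "0 \<le> (\<integral>z. indicator Q z * ricker z \<partial>lborel)"
proof -
  have "compact Q" "connected Q" and s: "\<And>x. x \<in> Q \<Longrightarrow> - x \<in> Q"
    using assms convex_connected by (auto simp: sym_convex_compact_def)
  then obtain a b where Q: "Q = {a..b}" using connected_compact_interval_1 by metis
  show ?thesis
  proof (cases "a \<le> b")
    case True
    then have "b \<in> Q" "a \<in> Q" by (simp_all add: Q)
    then have "- b \<in> Q" "- a \<in> Q" by (simp_all add: s)
    then have a: "a = - b" and b: "0 \<le> b" using True unfolding Q by auto
    have der: "((\<lambda>x. x * exp (- x\<^sup>2 / 2)) has_real_derivative ricker x) (at x)" for x
      unfolding ricker_def
      by (auto intro!: derivative_eq_intros simp: algebra_simps power2_eq_square)
    have cont: "isCont ricker x" for x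
      using continuous_on_ricker[OF continuous_on_id, of UNIV] by (simp add: continuous_on_eq_continuous_at)
    have "(\<integral>z. ricker z * indicator {a..b} z \<partial>lborel) = b * exp (- b\<^sup>2 / 2) - a * exp (- a\<^sup>2 / 2)"
      by (rule integral_FTC_Icc_real[OF True der cont])
    also have "\<dots> = 2 * (b * exp (- b\<^sup>2 / 2))" by (simp add: a)
    also have "\<dots> \<ge> 0" using b by simp
    finally show ?thesis unfolding Q by (simp only: mult.commute)
  qed (simp add: Q)
qed

lemma triple_integral_bounded:
  fixes h :: "r3 \<Rightarrow> real"
  assumes K: "compact K" and [measurable]: "h \<in> borel_measurable borel" and B: "\<And>x. \<bar>h x\<bar> \<le> B"
  shows "(\<integral>p. indicator K p * h p \<partial>lborel)
    = (\<integral>x. \<integral>y. \<integral>z. indicator K (x, y, z) * h (x, y, z) \<partial>lborel \<partial>lborel \<partial>lborel)"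
proof -
  have int: "integrable (lborel \<Otimes>\<^sub>M lborel) (\<lambda>p. indicator K p * h p)"
    unfolding lborel_prod by (rule integrable_indicator_times_bounded[OF K _ B]) measurable
  have "(\<integral>p. indicator K p * h p \<partial>lborel)
     = (\<integral>x. (\<integral>q. indicator K (x, q) * h (x, q) \<partial>lborel) \<partial>lborel)"
    using lborel_pair.integral_fst'[OF int] unfolding lborel_prod by (rule sym)
  also have "\<dots> = (\<integral>x. \<integral>y. \<integral>z. indicator K (x, y, z) * h (x, y, z) \<partial>lborel \<partial>lborel \<partial>lborel)"
  proof (intro Bochner_Integration.integral_cong refl)
    fix x
    let ?K = "{q. (x, q) \<in> K}"
    have "?K = snd ` (K \<inter> ({x} \<times> UNIV))" by force
    moreover have "compact (snd ` (K \<inter> ({x} \<times> UNIV)))"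
      by (intro compact_continuous_image compact_Int_closed K closed_Times continuous_intros)
    ultimately have cK: "compact ?K" by simp
    have i: "indicator K (x, q) = (indicator ?K q :: real)" for q by (simp add: indicator_def)
    have [measurable]: "(\<lambda>q. h (x, q)) \<in> borel_measurable borel"
      by (rule measurable_compose[OF _ assms(2)]) (intro borel_measurable_continuous_onI continuous_intros)
    have int: "integrable (lborel \<Otimes>\<^sub>M lborel) (\<lambda>q. indicator K (x, q) * h (x, q))"
      unfolding i lborel_prod by (rule integrable_indicator_times_bounded[OF cK _ B]) measurable
    show "(\<integral>q. indicator K (x, q) * h (x, q) \<partial>lborel)
      = (\<integral>y. \<integral>z. indicator K (x, y, z) * h (x, y, z) \<partial>lborel \<partial>lborel)"
      using lborel_pair.integral_fst'[OF int] unfolding lborel_prod by (rule sym)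
  qed
  finally show ?thesis .
qed

text \<open>If the last coordinate of \<open>\<xi> = (a, b, c)\<close> is nonzero, the shear that replaces the last coordinate of \<open>y\<close>
by \<open>y \<bullet> \<xi>\<close> preserves compactness, convexity and symmetry and changes volumes by a constant factor. The
integrand then depends on the last coordinate only, and the other two can be removed one after the other.\<close>

lemma ricker_section_nonneg_generic:
  fixes K :: "r3 set"
  assumes K: "sym_convex_compact K" and c: "c \<noteq> 0"
  shows "0 \<le> (\<integral>y. indicator K y * ricker (y \<bullet> (a, b, c)) \<partial>lborel)"
proof -
  define f where "f = (\<lambda>(x, y, w). (x, y, (w - a * x - b * y) / c))"
  define K' where "K' = (\<lambda>(x, y, z). (x, y, a * x + b * y + c * z)) ` K"
  have K'iff: "p \<in> K' \<longleftrightarrow> f p \<in> K" for p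
    using c by (cases p) (force simp: K'_def f_def image_iff field_simps)
  have lin: "linear (\<lambda>(x, y, z). (x, y, a * x + b * y + c * z))"
    by (intro linearI) (auto simp: algebra_simps split: prod.splits)
  have "continuous_on UNIV (\<lambda>(x, y, z). (x, y, a * x + b * y + c * z))"
    using lin by (simp add: linear_continuous_on linear_conv_bounded_linear)
  then have K': "sym_convex_compact K'"
    using K lin unfolding sym_convex_compact_def K'_def
    by (auto intro!: compact_continuous_image convex_linear_image intro: continuous_on_subset)
      (force simp: image_iff)
  have cK: "compact K" "compact K'" using K K' by (auto simp: sym_convex_compact_def)
  have inner: "(\<integral>z. indicator K (x, y, z) * ricker ((x, y, z) \<bullet> (a, b, c)) \<partial>lborel)
    = \<bar>1 / c\<bar> * (\<integral>w. indicator K' (x, y, w) * ricker w \<partial>lborel)" for x y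
  proof -
    have "(\<integral>z. indicator K (x, y, z) * ricker ((x, y, z) \<bullet> (a, b, c)) \<partial>lborel)
      = \<bar>1 / c\<bar> * (\<integral>w. (\<lambda>z. indicator K (x, y, z) * ricker ((x, y, z) \<bullet> (a, b, c)))
            ((- a * x - b * y) / c + 1 / c * w) \<partial>lborel)"
      using c by (subst lborel_integral_real_affine[where c="1 / c" and t="(- a * x - b * y) / c"]) auto
    also have "(\<lambda>w. (\<lambda>z. indicator K (x, y, z) * ricker ((x, y, z) \<bullet> (a, b, c)))
            ((- a * x - b * y) / c + 1 / c * w)) = (\<lambda>w. indicator K' (x, y, w) * ricker w)"
    proof
      fix w
      have "((x, y, (- a * x - b * y) / c + 1 / c * w) \<in> K) = ((x, y, w) \<in> K')"
        unfolding K'iff f_def by (simp add: add_divide_distrib[symmetric] algebra_simps)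
      moreover have "(x, y, (- a * x - b * y) / c + 1 / c * w) \<bullet> (a, b, c) = w"
        using c by (simp add: field_simps)
      ultimately show "(\<lambda>z. indicator K (x, y, z) * ricker ((x, y, z) \<bullet> (a, b, c)))
            ((- a * x - b * y) / c + 1 / c * w) = indicator K' (x, y, w) * ricker w"
        by (simp add: indicator_def)
    qed
    finally show ?thesis .
  qed
  have m: "(\<lambda>p::r3. ricker (snd (snd p))) \<in> borel_measurable borel"
     "(\<lambda>p::real \<times> real. ricker (snd p)) \<in> borel_measurable borel"
    "(\<lambda>y. ricker (y \<bullet> (a, b, c))) \<in> borel_measurable borel"
    by (intro borel_measurable_continuous_onI continuous_intros)+
  have "(\<integral>y. indicator K y * ricker (y \<bullet> (a, b, c)) \<partial>lborel)
    = (\<integral>x. \<integral>y. \<bar>1 / c\<bar> * (\<integral>w. indicator K' (x, y, w) * ricker w \<partial>lborel) \<partial>lborel \<partial>lborel)"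
    by (subst triple_integral_bounded[OF cK(1) m(3) abs_ricker_le]) (simp only: inner)
  also have "\<dots> = \<bar>1 / c\<bar> * (\<integral>x. \<integral>y. \<integral>w. indicator K' (x, y, w) * ricker w \<partial>lborel \<partial>lborel \<partial>lborel)"
    by (simp only: integral_mult_right_zero)
  also have "\<dots> = \<bar>1 / c\<bar> * (\<integral>p. indicator K' p * ricker (snd (snd p)) \<partial>lborel)"
    by (subst triple_integral_bounded[OF cK(2) m(1) abs_ricker_le]) simp
  also have "\<dots> \<ge> 0"
    by (intro mult_nonneg_nonneg slab_rearrangement[OF K' m(2) abs_ricker_le]
         slab_rearrangement[OF _ ricker_measurable abs_ricker_le] ricker_interval_nonneg) auto
  finally show ?thesis .
qed

text \<open>The remaining directions are limits of those with nonzero last coordinate.\<close>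

lemma ricker_section_nonneg:
  fixes K :: "r3 set"
  assumes K: "sym_convex_compact K"
  shows "0 \<le> (\<integral>y. indicator K y * ricker (y \<bullet> \<xi>) \<partial>lborel)"
proof -
  obtain a b c where \<xi>: "\<xi> = (a, b, c)" by (cases \<xi>) auto
  show ?thesis
  proof (cases "c = 0")
    case False
    then show ?thesis using ricker_section_nonneg_generic[OF K] \<xi> by blast
  next
    case True
    have cK: "compact K" using K by (simp add: sym_convex_compact_def)
    then have [measurable]: "K \<in> sets borel" by (simp add: borel_compact)
    have lim: "(\<lambda>n. inverse (real (Suc n))) \<longlonglongrightarrow> 0" by (rule LIMSEQ_inverse_real_of_nat)
    have ric: "continuous_on UNIV ricker" by (intro continuous_intros)
    have "(\<lambda>n. \<integral>y. indicator K y * ricker (y \<bullet> (a, b, inverse (real (Suc n)))) \<partial>lborel)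
      \<longlonglongrightarrow> (\<integral>y. indicator K y * ricker (y \<bullet> \<xi>) \<partial>lborel)"
    proof (rule integral_dominated_convergence[where w="\<lambda>y. indicator K y * 2"])
      show "integrable lborel (\<lambda>y. indicator K y * 2 :: real)"
        by (rule integrable_indicator_times_bounded[OF cK, of _ 2]) auto
      show "AE y in lborel. (\<lambda>n. indicator K y * ricker (y \<bullet> (a, b, inverse (real (Suc n)))))
          \<longlonglongrightarrow> indicator K y * ricker (y \<bullet> \<xi>)"
        unfolding \<xi> True
        by (intro AE_I2 tendsto_mult tendsto_const continuous_on_tendsto_compose[OF ric]
             tendsto_inner tendsto_Pair lim) auto
      show "AE y in lborel. norm (indicator K y * ricker (y \<bullet> (a, b, inverse (real (Suc n)))))
          \<le> indicator K y * 2" for n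
        by (intro AE_I2) (auto simp: abs_mult abs_ricker_le indicator_def)
    qed measurable
    then show ?thesis
      by (rule LIMSEQ_le_const) (use ricker_section_nonneg_generic[OF K] in auto)
  qed
qed

section \<open>Smoothed indicator functions\<close>

lemma lborel_integral_reflect:
  fixes f :: "'a::euclidean_space \<Rightarrow> real"
  assumes [measurable]: "f \<in> borel_measurable borel"
  shows "(\<integral>x. f (t - x) \<partial>lborel) = (\<integral>x. f x \<partial>lborel)"
proof -
  have "(\<integral>x. f x \<partial>lborel) = (\<integral>x. f x \<partial>density (distr lborel borel (\<lambda>x. t + (-1) *\<^sub>R x)) (\<lambda>_. ennreal (\<bar>-1\<bar> ^ DIM('a))))"
    by (rule arg_cong[where f="\<lambda>M. integral\<^sup>L M f"], rule lborel_affine) simp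
  also have "\<dots> = (\<integral>x. f (t - x) \<partial>lborel)"
    by (subst integral_density) (auto simp: integral_distr)
  finally show ?thesis by simp
qed

lemma integrable_lborel_prob_bounded:
  fixes F :: "'a::euclidean_space \<times> 'b \<Rightarrow> real"
  assumes N: "prob_space N" and A: "A \<in> sets borel" "emeasure lborel A < \<infinity>"
    and F: "F \<in> borel_measurable (lborel \<Otimes>\<^sub>M N)" and bound: "\<And>x y. \<bar>F (x, y)\<bar> \<le> indicator A x * C"
  shows "integrable (lborel \<Otimes>\<^sub>M N) F"
proof (rule Bochner_Integration.integrable_bound[OF _ F])
  interpret prob_space N by (rule N)
  have "emeasure (lborel \<Otimes>\<^sub>M N) (A \<times> space N) = emeasure lborel A"
    using A by (subst emeasure_pair_measure_Times) (auto simp: emeasure_space_1)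
  then show "integrable ((lborel :: 'a measure) \<Otimes>\<^sub>M N) (\<lambda>p. indicator (A \<times> space N) p * C)"
    using A by (intro integrable_mult_left integrable_real_indicator pair_measureI) auto
  show "AE p in (lborel :: 'a measure) \<Otimes>\<^sub>M N. norm (F p) \<le> norm (indicator (A \<times> space N) p * C)"
  proof (rule AE_I2)
    fix p assume "p \<in> space ((lborel :: 'a measure) \<Otimes>\<^sub>M N)"
    then show "norm (F p) \<le> norm (indicator (A \<times> space N) p * C)"
      using bound[of "fst p" "snd p"] by (cases p) (auto simp: space_pair_measure indicator_def split: if_splits)
  qed
qed

text \<open>With \<open>A(s)\<close> the area of the section of \<open>K\<close> by the plane \<open>y \<bullet> \<xi> = s\<close>, for unit \<open>\<xi>\<close>, this is the
convolution of \<open>A\<close> with the wavelet \<open>ricker\<close>, that is, minus the second derivative of \<open>A\<close> smoothed by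
a Gaussian.\<close>

definition ricker_section :: "'a::euclidean_space set \<Rightarrow> 'a \<Rightarrow> real \<Rightarrow> real" where
  "ricker_section K \<xi> v = (\<integral>y. indicator K y * ricker (v - y \<bullet> \<xi>) \<partial>lborel)"

definition smoothed :: "'a::euclidean_space set \<Rightarrow> 'a \<Rightarrow> real" where
  "smoothed K z = (\<integral>y. indicator K y * plane_wave_kernel (z - y) \<partial>lborel)"

context
  fixes K :: "'a::euclidean_space set"
  assumes K: "compact K"
begin

lemma compact_set_borel [measurable]: "K \<in> sets borel"
  using K by (simp add: borel_compact)

lemma integrable_indicator_K: "integrable lborel (\<lambda>y. indicator K y * c :: real)"
  by (rule integrable_indicator_times_bounded[OF K, of _ "\<bar>c\<bar>"]) auto

lemma integral_indicator_K: "(\<integral>y. indicator K y * c \<partial>lborel) = c * measure lborel K"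
  by (simp add: mult.commute)

lemma integrable_ricker_section: "integrable lborel (\<lambda>y. indicator K y * ricker (v - y \<bullet> \<xi>))"
  by (rule integrable_indicator_times_bounded[OF K _ abs_ricker_le]) measurable

lemma ricker_section_bound: "\<bar>ricker_section K \<xi> v\<bar> \<le> 2 * measure lborel K"
proof -
  have "norm (ricker_section K \<xi> v) \<le> (\<integral>y. indicator K y * 2 \<partial>lborel)"
    unfolding ricker_section_def
    by (rule Bochner_Integration.integral_norm_bound_integral[OF integrable_ricker_section integrable_indicator_K])
      (auto simp: abs_mult abs_ricker_le indicator_def)
  then show ?thesis by (simp only: integral_indicator_K real_norm_def)
qed

lemma ricker_section_lipschitz:
  "\<bar>ricker_section K \<xi> v - ricker_section K \<xi> v'\<bar> \<le> 4 * \<bar>v - v'\<bar> * measure lborel K"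
proof -
  have "ricker_section K \<xi> v - ricker_section K \<xi> v'
    = (\<integral>y. indicator K y * ricker (v - y \<bullet> \<xi>) - indicator K y * ricker (v' - y \<bullet> \<xi>) \<partial>lborel)"
    unfolding ricker_section_def by (simp add: integrable_ricker_section)
  also have "norm \<dots> \<le> (\<integral>y. indicator K y * (4 * \<bar>v - v'\<bar>) \<partial>lborel)"
  proof (rule Bochner_Integration.integral_norm_bound_integral)
    fix y
    show "norm (indicator K y * ricker (v - y \<bullet> \<xi>) - indicator K y * ricker (v' - y \<bullet> \<xi>))
       \<le> indicator K y * (4 * \<bar>v - v'\<bar>)"
      using ricker_lipschitz[of "v - y \<bullet> \<xi>" "v' - y \<bullet> \<xi>"] by (simp add: indicator_def)
  qed (intro Bochner_Integration.integrable_diff integrable_ricker_section integrable_indicator_K)+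
  finally show ?thesis by (simp only: integral_indicator_K real_norm_def)
qed

lemma continuous_on_ricker_section [continuous_intros]:
  "continuous_on A f \<Longrightarrow> continuous_on A (\<lambda>x. ricker_section K \<xi> (f x))"
proof -
  assume f: "continuous_on A f"
  have "(4 * measure lborel K)-lipschitz_on UNIV (ricker_section K \<xi>)"
    by (rule lipschitz_onI) (use ricker_section_lipschitz in \<open>auto simp: dist_real_def mult_ac\<close>)
  then have "continuous_on UNIV (ricker_section K \<xi>)" by (rule lipschitz_on_continuous_on)
  then show ?thesis by (rule continuous_on_compose2[OF _ f]) auto
qed

lemma ricker_section_at_top: "(ricker_section K \<xi> \<longlongrightarrow> 0) at_top"
proof -
  have "((\<lambda>v. \<integral>y. indicator K y * ricker (v - y \<bullet> \<xi>) \<partial>lborel) \<longlongrightarrow> (\<integral>y. 0 \<partial>(lborel::'a measure))) at_top"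
  proof (rule integral_dominated_convergence_at_top[where w="\<lambda>y. indicator K y * 2"])
    show "AE y in lborel. ((\<lambda>v. indicator K y * ricker (v - y \<bullet> \<xi>)) \<longlongrightarrow> 0) at_top"
    proof (intro AE_I2 tendsto_mult_right_zero filterlim_compose[OF ricker_at_top])
      fix y :: 'a
      show "filterlim (\<lambda>v. v - y \<bullet> \<xi>) at_top at_top"
        using filterlim_tendsto_add_at_top[OF tendsto_const[of "- (y \<bullet> \<xi>)"] filterlim_ident]
        by (simp add: algebra_simps)
    qed
    show "\<forall>\<^sub>F v in at_top. AE y in lborel. norm (indicator K y * ricker (v - y \<bullet> \<xi>)) \<le> indicator K y * 2"
      by (intro always_eventually allI AE_I2) (auto simp: abs_mult abs_ricker_le indicator_def)
  qed (use integrable_indicator_K in \<open>auto\<close>)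
  then show ?thesis by (simp add: ricker_section_def[abs_def])
qed

lemma ricker_section_measurable [measurable]:
  "(\<lambda>p. ricker_section K (fst p) (snd p)) \<in> borel_measurable (borel \<Otimes>\<^sub>M borel)"
  unfolding ricker_section_def by measurable

text \<open>The two-argument form that the measurability prover can apply to composed arguments.\<close>

lemma ricker_section_measurable' [measurable (raw)]:
  assumes [measurable]: "f \<in> borel_measurable M" "g \<in> borel_measurable M"
  shows "(\<lambda>x. ricker_section K (f x) (g x)) \<in> borel_measurable M"
proof -
  have "(\<lambda>x. (f x, g x)) \<in> M \<rightarrow>\<^sub>M borel \<Otimes>\<^sub>M borel" by measurable
  from measurable_compose[OF this ricker_section_measurable] show ?thesis by simp
qed

lemma ricker_section_even:
  assumes "\<And>x. x \<in> K \<Longrightarrow> - x \<in> K"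
  shows "ricker_section K \<xi> \<bar>v\<bar> = ricker_section K \<xi> v"
proof -
  have sym: "- x \<in> K \<longleftrightarrow> x \<in> K" for x using assms[of x] assms[of "- x"] by auto
  have "ricker_section K \<xi> (- v) = ricker_section K \<xi> v"
  proof -
    have "ricker_section K \<xi> v = (\<integral>y. indicator K (0 - y) * ricker (v - (0 - y) \<bullet> \<xi>) \<partial>lborel)"
      unfolding ricker_section_def by (rule lborel_integral_reflect[symmetric]) measurable
    also have "\<dots> = ricker_section K \<xi> (- v)"
      unfolding ricker_section_def
    proof (rule Bochner_Integration.integral_cong[OF refl])
      fix y
      have "ricker (- v - y \<bullet> \<xi>) = ricker (v - (0 - y) \<bullet> \<xi>)"
        using ricker_minus[of "v - (0 - y) \<bullet> \<xi>"] by simp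
      then show "indicator K (0 - y) * ricker (v - (0 - y) \<bullet> \<xi>) = indicator K y * ricker (- v - y \<bullet> \<xi>)"
        by (simp add: indicator_def sym)
    qed
    finally show ?thesis ..
  qed
  then show ?thesis by (simp add: abs_if)
qed

end

lemma gap_weight_ricker_section_bound:
  assumes "compact K"
  shows "\<bar>gap_weight \<xi> * ricker_section K \<xi> v\<bar> \<le> 2 * measure lborel K"
proof -
  have "\<bar>gap_weight \<xi>\<bar> * \<bar>ricker_section K \<xi> v\<bar> \<le> 1 * (2 * measure lborel K)"
    using gap_weight_bounds[of \<xi>] by (intro mult_mono ricker_section_bound[OF assms]) auto
  then show ?thesis by (simp add: abs_mult)
qed

lemma integrable_gap_weight_ricker_section:
  fixes K :: "r3 set"
  assumes K: "compact K"
  shows "integrable gauss3 (\<lambda>\<xi>. gap_weight \<xi> * ricker_section K \<xi> (z \<bullet> \<xi>))"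
proof -
  interpret prob_space gauss3 by (rule prob_space_gauss3)
  note [measurable] = ricker_section_measurable'[OF K]
  have "AE \<xi> in gauss3. norm (gap_weight \<xi> * ricker_section K \<xi> (z \<bullet> \<xi>)) \<le> 2 * measure lborel K"
    unfolding real_norm_def by (intro AE_I2 gap_weight_ricker_section_bound K)
  then show ?thesis by (rule integrable_const_bound) measurable
qed

text \<open>Fubini exchanges the integral over \<open>K\<close> with the decomposition of the kernel into plane waves.\<close>

lemma smoothed_eq_plane_waves:
  fixes K :: "r3 set"
  assumes K: "compact K"
  shows "smoothed K z = (\<integral>\<xi>. gap_weight \<xi> * ricker_section K \<xi> (z \<bullet> \<xi>) \<partial>gauss3)"
proof -
  note [measurable] = compact_set_borel[OF K]
  interpret g: prob_space gauss3 by (rule prob_space_gauss3)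
  interpret P: pair_sigma_finite "lborel :: r3 measure" gauss3 ..
  have fin: "emeasure lborel K < \<infinity>" by (intro emeasure_bounded_finite compact_imp_bounded K)
  have int: "integrable (lborel \<Otimes>\<^sub>M gauss3)
     (\<lambda>(y, \<xi>). indicator K y * (gap_weight \<xi> * ricker ((z - y) \<bullet> \<xi>)))"
  proof (rule integrable_lborel_prob_bounded[OF prob_space_gauss3, of K _ 2])
    fix y \<xi> :: "r3"
    have "\<bar>gap_weight \<xi>\<bar> * \<bar>ricker ((z - y) \<bullet> \<xi>)\<bar> \<le> 1 * 2"
      using gap_weight_bounds[of \<xi>] by (intro mult_mono abs_ricker_le) auto
    then show "\<bar>case (y, \<xi>) of (y, \<xi>) \<Rightarrow> indicator K y * (gap_weight \<xi> * ricker ((z - y) \<bullet> \<xi>))\<bar> \<le> indicator K y * 2"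
      by (simp add: indicator_def abs_mult)
  qed (use fin in measurable)
  have "smoothed K z = (\<integral>y. (\<integral>\<xi>. indicator K y * (gap_weight \<xi> * ricker ((z - y) \<bullet> \<xi>)) \<partial>gauss3) \<partial>lborel)"
    unfolding smoothed_def by (simp add: plane_wave_kernel[OF gauss3])
  also have "\<dots> = (\<integral>\<xi>. (\<integral>y. indicator K y * (gap_weight \<xi> * ricker ((z - y) \<bullet> \<xi>)) \<partial>lborel) \<partial>gauss3)"
    by (rule P.Fubini_integral[OF int, symmetric])
  also have "\<dots> = (\<integral>\<xi>. gap_weight \<xi> * ricker_section K \<xi> (z \<bullet> \<xi>) \<partial>gauss3)"
    unfolding ricker_section_def
    by (simp only: mult.left_commute[of "indicator K _"] integral_mult_right_zero inner_diff_left)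
  finally show ?thesis .
qed

text \<open>Each plane wave is Lipschitz with a constant proportional to the volume of \<open>K\<close>, and the mean of
\<open>\<bar>(x - y) \<bullet> \<xi>\<bar>\<close> is \<open>norm (x - y)\<close> times the first absolute moment of a Gaussian variable. The estimate is
poor for large \<open>K\<close>; it is only used at points that are exponentially close to the origin.\<close>

lemma smoothed_lipschitz:
  fixes K :: "r3 set"
  assumes cK: "compact K"
  shows "\<bar>smoothed K x - smoothed K y\<bar> \<le> 4 * measure lborel K * (norm (x - y) * (\<integral>g. \<bar>g\<bar> \<partial>gauss))"
proof -
  note [measurable] = compact_set_borel[OF cK] ricker_section_measurable'[OF cK]
  note i = integrable_gap_weight_ricker_section[OF cK]
  have ig: "integrable gauss (\<lambda>g. norm (x - y) * \<bar>g\<bar>)"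
    using integrable_std_normal_distribution_moment[of 1] by (intro integrable_mult_right integrable_abs) auto
  then have j: "integrable gauss3 (\<lambda>\<xi>. \<bar>(x - y) \<bullet> \<xi>\<bar>)"
    by (subst standard_gaussian_integrable_inner[OF gauss3(1), of abs]) (auto simp: abs_mult)
  let ?D = "\<lambda>\<xi>. gap_weight \<xi> * ricker_section K \<xi> (x \<bullet> \<xi>) - gap_weight \<xi> * ricker_section K \<xi> (y \<bullet> \<xi>)"
  have eq: "smoothed K x - smoothed K y
    = (\<integral>\<xi>. gap_weight \<xi> * ricker_section K \<xi> (x \<bullet> \<xi>) - gap_weight \<xi> * ricker_section K \<xi> (y \<bullet> \<xi>) \<partial>gauss3)"
    unfolding smoothed_eq_plane_waves[OF cK] by (rule Bochner_Integration.integral_diff[OF i i, symmetric])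
  have le: "norm (\<integral>\<xi>. ?D \<xi> \<partial>gauss3) \<le> (\<integral>\<xi>. 4 * measure lborel K * \<bar>(x - y) \<bullet> \<xi>\<bar> \<partial>gauss3)"
  proof (rule Bochner_Integration.integral_norm_bound_integral)
    fix \<xi>
    have "\<bar>gap_weight \<xi>\<bar> * \<bar>ricker_section K \<xi> (x \<bullet> \<xi>) - ricker_section K \<xi> (y \<bullet> \<xi>)\<bar>
       \<le> 1 * (4 * \<bar>x \<bullet> \<xi> - y \<bullet> \<xi>\<bar> * measure lborel K)"
      using gap_weight_bounds[of \<xi>] by (intro mult_mono ricker_section_lipschitz[OF cK]) auto
    then show "norm (gap_weight \<xi> * ricker_section K \<xi> (x \<bullet> \<xi>) - gap_weight \<xi> * ricker_section K \<xi> (y \<bullet> \<xi>))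
       \<le> 4 * measure lborel K * \<bar>(x - y) \<bullet> \<xi>\<bar>"
      by (simp only: mult_1 right_diff_distrib[symmetric] abs_mult real_norm_def inner_diff_left mult_ac)
  qed (intro Bochner_Integration.integrable_diff i j integrable_mult_right)+
  have "(\<integral>\<xi>. \<bar>(x - y) \<bullet> \<xi>\<bar> \<partial>gauss3) = (\<integral>g. \<bar>norm (x - y) * g\<bar> \<partial>gauss)"
    by (rule standard_gaussian_integral_inner[OF gauss3(1), of abs]) measurable
  then have abs: "(\<integral>\<xi>. \<bar>(x - y) \<bullet> \<xi>\<bar> \<partial>gauss3) = norm (x - y) * (\<integral>g. \<bar>g\<bar> \<partial>gauss)"
    by (simp only: abs_mult abs_norm_cancel integral_mult_right_zero)
  show ?thesis
    using le unfolding eq[symmetric] integral_mult_right_zero abs real_norm_def .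
qed

lemma smoothed_eq_convolution:
  fixes K :: "r3 set"
  assumes "compact K"
  shows "smoothed K z = (\<integral>w. indicator K (z - w) * plane_wave_kernel w \<partial>lborel)"
proof -
  note [measurable] = compact_set_borel[OF assms]
  have "smoothed K z = (\<integral>w. indicator K (z - w) * plane_wave_kernel (z - (z - w)) \<partial>lborel)"
    unfolding smoothed_def by (rule lborel_integral_reflect[symmetric]) measurable
  then show ?thesis by simp
qed

text \<open>The displacements \<open>w\<close> with \<open>z - w \<in> K\<close> contribute to \<open>smoothed K z\<close>, and the others are missing from the
full mass. If one of these two groups stays at distance \<open>d\<close> from the origin, then \<open>1 \<le> norm w / d\<close> on
it, which bounds its share by the first moment of the kernel.\<close>

lemma
  fixes K :: "r3 set"
  assumes K: "compact K"
  shows smoothed_nonneg: "0 \<le> smoothed K z"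
    and smoothed_le_mass: "smoothed K z \<le> kernel_mass"
    and smoothed_le: "\<lbrakk>0 < d; \<And>w. z - w \<in> K \<Longrightarrow> d \<le> norm w\<rbrakk> \<Longrightarrow> smoothed K z \<le> kernel_moment / d"
    and smoothed_ge: "\<lbrakk>0 < d; \<And>w. z - w \<notin> K \<Longrightarrow> d \<le> norm w\<rbrakk> \<Longrightarrow> kernel_mass - kernel_moment / d \<le> smoothed K z"
proof -
  note [measurable] = compact_set_borel[OF K]
  let ?k = "plane_wave_kernel :: r3 \<Rightarrow> real"
  have k0: "0 \<le> ?k w" for w by (rule less_imp_le[OF plane_wave_kernel_pos])
  have int: "integrable lborel (\<lambda>w. indicator K (z - w) * ?k w)"
    by (rule Bochner_Integration.integrable_bound[OF integrable_plane_wave_kernel(1)])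
      (auto simp: indicator_def intro!: AE_I2 simp del: split_paired_All)
  have d: "integrable lborel (\<lambda>w. (norm w * ?k w) / d)" for d
    by (intro integrable_divide integrable_plane_wave_kernel)
  note [simp] = smoothed_eq_convolution[OF K]
  show "0 \<le> smoothed K z" by (simp add: k0 Bochner_Integration.integral_nonneg)
  show "smoothed K z \<le> kernel_mass"
    unfolding smoothed_eq_convolution[OF K] kernel_mass_def
    by (rule Bochner_Integration.integral_mono[OF int integrable_plane_wave_kernel(1)])
      (simp add: indicator_def k0 del: split_paired_All)
  show "smoothed K z \<le> kernel_moment / d" if "0 < d" "\<And>w. z - w \<in> K \<Longrightarrow> d \<le> norm w"
  proof -
    have "smoothed K z \<le> (\<integral>w. (norm w * ?k w) / d \<partial>lborel)"
      unfolding smoothed_eq_convolution[OF K]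
    proof (rule Bochner_Integration.integral_mono[OF int d])
      fix w
      have "?k w \<le> (norm w * ?k w) / d" if "d \<le> norm w"
        using mult_right_mono[OF that k0[of w]] \<open>0 < d\<close> by (simp add: field_simps)
      then show "indicator K (z - w) * ?k w \<le> (norm w * ?k w) / d"
        using that(2)[of w] k0[of w] \<open>0 < d\<close> by (simp add: indicator_def)
    qed
    then show ?thesis by (simp add: kernel_moment_def)
  qed
  show "kernel_mass - kernel_moment / d \<le> smoothed K z" if "0 < d" "\<And>w. z - w \<notin> K \<Longrightarrow> d \<le> norm w"
  proof -
    have "(\<integral>w. ?k w - (norm w * ?k w) / d \<partial>lborel) \<le> smoothed K z"
      unfolding smoothed_eq_convolution[OF K]
    proof (rule Bochner_Integration.integral_mono[OF Bochner_Integration.integrable_diff[OF integrable_plane_wave_kernel(1) d] int])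
      fix w
      have "?k w \<le> (norm w * ?k w) / d" if "d \<le> norm w"
        using mult_right_mono[OF that k0[of w]] \<open>0 < d\<close> by (simp add: field_simps)
      then show "?k w - (norm w * ?k w) / d \<le> indicator K (z - w) * ?k w"
        using that(2)[of w] k0[of w] \<open>0 < d\<close> by (simp add: indicator_def)
    qed
    then show ?thesis
      using Bochner_Integration.integral_diff[OF integrable_plane_wave_kernel(1) d[of d]]
      by (simp add: kernel_moment_def kernel_mass_def)
  qed
qed

section \<open>Frullani integrals in logarithmic coordinates\<close>

text \<open>The function \<open>A s - l s\<close> has a derivative that tends to 0, so its increments over steps of fixed
length tend to 0.\<close>

lemma increments_tendsto:
  fixes A G :: "real \<Rightarrow> real"
  assumes der: "\<And>s. (A has_real_derivative G s) (at s)" and lim: "(G \<longlongrightarrow> l) at_top"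
  shows "((\<lambda>x. A (x + \<alpha>) - A (x + \<beta>)) \<longlongrightarrow> l * (\<alpha> - \<beta>)) at_top"
proof (rule tendstoI)
  fix e :: real assume e: "e > 0"
  define d where "d = e / (1 + \<bar>\<alpha> - \<beta>\<bar>)"
  have d: "d > 0" using e by (simp add: d_def)
  have "eventually (\<lambda>s. dist (G s) l < d) at_top" using lim d by (rule tendstoD)
  then obtain X where X: "\<And>s. s \<ge> X \<Longrightarrow> dist (G s) l < d" by (auto simp: eventually_at_top_linorder)
  show "\<forall>\<^sub>F x in at_top. dist (A (x + \<alpha>) - A (x + \<beta>)) (l * (\<alpha> - \<beta>)) < e"
    unfolding eventually_at_top_linorder
  proof (intro exI allI impI)
    fix x assume x: "X + \<bar>\<alpha>\<bar> + \<bar>\<beta>\<bar> \<le> x"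
    have "norm ((A (x + \<alpha>) - l * (x + \<alpha>)) - (A (x + \<beta>) - l * (x + \<beta>))) \<le> d * norm ((x + \<alpha>) - (x + \<beta>))"
    proof (rule field_differentiable_bound[of "{X..}" "\<lambda>s. A s - l * s" "\<lambda>s. G s - l"])
      fix s assume "s \<in> {X..}"
      then show "norm (G s - l) \<le> d" using X[of s] by (simp add: dist_real_def)
      show "((\<lambda>s. A s - l * s) has_real_derivative G s - l) (at s within {X..})"
        by (rule DERIV_subset[of _ _ _ UNIV]) (auto intro!: derivative_eq_intros der)
    qed (use x in auto)
    also have "\<dots> = d * \<bar>\<alpha> - \<beta>\<bar>" by simp
    also have "\<dots> < d * (1 + \<bar>\<alpha> - \<beta>\<bar>)" using d by (simp add: algebra_simps)
    also have "\<dots> = e" by (simp add: d_def)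
    finally show "dist (A (x + \<alpha>) - A (x + \<beta>)) (l * (\<alpha> - \<beta>)) < e"
      by (simp add: dist_real_def algebra_simps)
  qed
qed

text \<open>Frullani's integral after the substitution \<open>r = exp s\<close>, where the dilations by \<open>exp \<alpha>\<close> and \<open>exp \<beta>\<close> become
translations. With a primitive \<open>A\<close> of \<open>G\<close>, the integral over \<open>[- n, n]\<close> is the difference of an increment of \<open>A\<close>
near \<open>n\<close> and one near \<open>- n\<close>. The uniform bound serves as dominating function when the
formula is integrated over a family of functions \<open>G\<close>.\<close>

lemma frullani:
  fixes G :: "real \<Rightarrow> real"
  assumes cont: "continuous_on UNIV G" and bound: "\<And>s. \<bar>G s\<bar> \<le> C"
    and bot: "(G \<longlongrightarrow> l) at_bot" and top: "(G \<longlongrightarrow> 0) at_top"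
  shows "(\<lambda>n. \<integral>s. indicator {- real n..real n} s * (G (s + \<alpha>) - G (s + \<beta>)) \<partial>lborel) \<longlonglongrightarrow> l * (\<beta> - \<alpha>)" (is ?lim)
    and "\<bar>\<integral>s. indicator {- real n..real n} s * (G (s + \<alpha>) - G (s + \<beta>)) \<partial>lborel\<bar> \<le> 2 * C * \<bar>\<alpha> - \<beta>\<bar>" (is ?bound)
proof -
  have cont': "isCont G s" for s using cont by (simp add: continuous_on_eq_continuous_at)
  obtain A where A: "\<And>s. (A has_real_derivative G s) (at s)"
    using einterval_antiderivative[of "-\<infinity>" \<infinity> G] cont' by (auto simp: has_real_derivative_iff_has_vector_derivative)
  \<comment> \<open>Reflection turns the behaviour at \<open>- \<infinity>\<close> into one at \<open>\<infinity>\<close>.\<close>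
  define R where "R = (\<lambda>x. - A (- x))"
  have R: "(R has_real_derivative G (- s)) (at s)" for s
    unfolding R_def by (auto intro!: derivative_eq_intros DERIV_chain2[OF A])
  have "((\<lambda>s. G (- s)) \<longlongrightarrow> l) at_top"
    using bot by (simp add: filterlim_at_bot_mirror)
  note limR = increments_tendsto[OF R this, of "- \<beta>" "- \<alpha>"]
  note limA = increments_tendsto[OF A top, of \<alpha> \<beta>]
  have int: "(\<integral>s. indicator {- real n..real n} s * (G (s + \<alpha>) - G (s + \<beta>)) \<partial>lborel)
      = (A (real n + \<alpha>) - A (real n + \<beta>)) - (R (real n - \<beta>) - R (real n - \<alpha>))" for n
  proof -
    have "(\<integral>s. (G (s + \<alpha>) - G (s + \<beta>)) * indicator {- real n..real n} s \<partial>lborel)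
      = (A (real n + \<alpha>) - A (real n + \<beta>)) - (A (- real n + \<alpha>) - A (- real n + \<beta>))"
    proof (rule integral_FTC_Icc_real)
      fix s
      show "((\<lambda>s. A (s + \<alpha>) - A (s + \<beta>)) has_real_derivative G (s + \<alpha>) - G (s + \<beta>)) (at s)"
        by (auto intro!: derivative_eq_intros DERIV_chain2[OF A])
      show "isCont (\<lambda>s. G (s + \<alpha>) - G (s + \<beta>)) s"
        by (intro continuous_intros isCont_o2[OF _ cont'])
    qed simp
    then show ?thesis by (simp add: R_def mult.commute add.commute)
  qed
  have lim: "(\<lambda>n. (A (real n + \<alpha>) - A (real n + \<beta>)) - (R (real n + - \<beta>) - R (real n + - \<alpha>)))
     \<longlonglongrightarrow> 0 * (\<alpha> - \<beta>) - l * (- \<beta> - - \<alpha>)"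
    by (intro tendsto_diff filterlim_compose[OF limA filterlim_real_sequentially]
        filterlim_compose[OF limR filterlim_real_sequentially])
  have "0 * (\<alpha> - \<beta>) - l * (- \<beta> - - \<alpha>) = l * (\<beta> - \<alpha>)" by (simp add: algebra_simps)
  with lim show ?lim unfolding int by (simp only: diff_conv_add_uminus)
  have bA: "norm (A u - A v) \<le> C * norm (u - v)" for u v
    by (rule field_differentiable_bound[of UNIV A G]) (use A bound in auto)
  have bR: "norm (R u - R v) \<le> C * norm (u - v)" for u v
    by (rule field_differentiable_bound[of UNIV R "\<lambda>s. G (- s)"]) (use R bound in auto)
  show ?bound unfolding int using bA[of "real n + \<alpha>" "real n + \<beta>"] bR[of "real n - \<beta>" "real n - \<alpha>"]
    by (simp add: algebra_simps)
qed

text \<open>For almost every \<open>\<xi>\<close> both \<open>x \<bullet> \<xi>\<close> and \<open>y \<bullet> \<xi>\<close> are nonzero, and Frullani's formula applies to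
\<open>s \<mapsto> ricker_section K \<xi> (exp s)\<close>: since sections are even, the factors \<open>x \<bullet> \<xi>\<close> and \<open>y \<bullet> \<xi>\<close> act as translations
by \<open>ln \<bar>x \<bullet> \<xi>\<bar>\<close> and \<open>ln \<bar>y \<bullet> \<xi>\<bar>\<close>. Over \<open>[- n, n]\<close> Fubini is unproblematic, and the bound in Frullani's
formula is integrable in \<open>\<xi>\<close>, so that dominated convergence applies.\<close>

lemma frullani_smoothed:
  fixes K :: "r3 set"
  assumes K: "sym_convex_compact K" and x: "x \<noteq> 0" and y: "y \<noteq> 0"
  shows "(\<lambda>n. \<integral>s. indicator {- real n..real n} s * (smoothed K (exp s *\<^sub>R x) - smoothed K (exp s *\<^sub>R y)) \<partial>lborel)
    \<longlonglongrightarrow> (\<integral>\<xi>. gap_weight \<xi> * ricker_section K \<xi> 0 * (ln \<bar>y \<bullet> \<xi>\<bar> - ln \<bar>x \<bullet> \<xi>\<bar>) \<partial>gauss3)"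
proof -
  have cK: "compact K" and sK: "\<And>x. x \<in> K \<Longrightarrow> - x \<in> K" using K by (auto simp: sym_convex_compact_def)
  note [measurable] = compact_set_borel[OF cK] ricker_section_measurable'[OF cK]
  interpret g: prob_space gauss3 by (rule prob_space_gauss3)
  interpret P: pair_sigma_finite "lborel :: real measure" gauss3 ..
  define V where "V = measure lborel K"
  have bound: "\<bar>ricker_section K \<xi> v\<bar> \<le> 2 * V" for \<xi> v unfolding V_def by (rule ricker_section_bound[OF cK])
  define J where "J n \<xi> = (\<integral>s. indicator {- real n..real n} s *
     (ricker_section K \<xi> (exp s * (x \<bullet> \<xi>)) - ricker_section K \<xi> (exp s * (y \<bullet> \<xi>))) \<partial>lborel)" for n \<xi>
  have lhs: "(\<integral>s. indicator {- real n..real n} s * (smoothed K (exp s *\<^sub>R x) - smoothed K (exp s *\<^sub>R y)) \<partial>lborel)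
     = (\<integral>\<xi>. gap_weight \<xi> * J n \<xi> \<partial>gauss3)" for n
  proof -
    let ?F = "\<lambda>s \<xi>. indicator {- real n..real n} s * (gap_weight \<xi> *
       (ricker_section K \<xi> (exp s * (x \<bullet> \<xi>)) - ricker_section K \<xi> (exp s * (y \<bullet> \<xi>))))"
    have int: "integrable (lborel \<Otimes>\<^sub>M gauss3) (\<lambda>(s, \<xi>). ?F s \<xi>)"
    proof (rule integrable_lborel_prob_bounded[OF prob_space_gauss3, of "{- real n..real n}" _ "4 * V"])
      fix s \<xi>
      let ?d = "gap_weight \<xi> * (ricker_section K \<xi> (exp s * (x \<bullet> \<xi>)) - ricker_section K \<xi> (exp s * (y \<bullet> \<xi>)))"
      have "\<bar>?d\<bar> \<le> 4 * V"
        using gap_weight_ricker_section_bound[OF cK, of \<xi> "exp s * (x \<bullet> \<xi>)"]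
          gap_weight_ricker_section_bound[OF cK, of \<xi> "exp s * (y \<bullet> \<xi>)"]
        unfolding right_diff_distrib V_def by linarith
      then show "\<bar>case (s, \<xi>) of (s, \<xi>) \<Rightarrow> ?F s \<xi>\<bar> \<le> indicator {- real n..real n} s * (4 * V)"
        by (simp add: indicator_def)
    qed measurable
    note i = integrable_gap_weight_ricker_section[OF cK]
    have diff: "smoothed K u - smoothed K v = (\<integral>\<xi>. gap_weight \<xi> *
        (ricker_section K \<xi> (u \<bullet> \<xi>) - ricker_section K \<xi> (v \<bullet> \<xi>)) \<partial>gauss3)" for u v
      unfolding smoothed_eq_plane_waves[OF cK] right_diff_distrib
      by (rule Bochner_Integration.integral_diff[OF i i, symmetric])
    have "(\<integral>s. indicator {- real n..real n} s * (smoothed K (exp s *\<^sub>R x) - smoothed K (exp s *\<^sub>R y)) \<partial>lborel)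
      = (\<integral>s. (\<integral>\<xi>. ?F s \<xi> \<partial>gauss3) \<partial>lborel)"
      by (simp only: diff integral_mult_right_zero inner_scaleR_left)
    also have "\<dots> = (\<integral>\<xi>. (\<integral>s. ?F s \<xi> \<partial>lborel) \<partial>gauss3)"
      by (rule P.Fubini_integral[OF int, symmetric])
    also have "\<dots> = (\<integral>\<xi>. gap_weight \<xi> * J n \<xi> \<partial>gauss3)"
      unfolding J_def mult.left_commute[of "indicator _ _" "gap_weight _"] by (simp only: integral_mult_right_zero)
    finally show ?thesis .
  qed
  have conv: "(\<lambda>n. J n \<xi>) \<longlonglongrightarrow> ricker_section K \<xi> 0 * (ln \<bar>y \<bullet> \<xi>\<bar> - ln \<bar>x \<bullet> \<xi>\<bar>)" (is ?c)
    and Jb: "\<bar>J n \<xi>\<bar> \<le> 2 * (2 * V) * \<bar>ln \<bar>x \<bullet> \<xi>\<bar> - ln \<bar>y \<bullet> \<xi>\<bar>\<bar>" (is ?b)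
    if nz: "x \<bullet> \<xi> \<noteq> 0" "y \<bullet> \<xi> \<noteq> 0" for \<xi> n
  proof -
    define G where "G s = ricker_section K \<xi> (exp s)" for s
    have G: "ricker_section K \<xi> (exp s * u) = G (s + ln \<bar>u\<bar>)" if "u \<noteq> 0" for s u
      using that ricker_section_even[OF cK sK, of \<xi> "exp s * u"]
      by (simp add: G_def exp_add abs_mult)
    have cont: "continuous_on UNIV G"
      unfolding G_def by (intro continuous_intros continuous_on_ricker_section[OF cK])
    have "isCont (ricker_section K \<xi>) 0"
      using continuous_on_ricker_section[OF cK continuous_on_id, of UNIV \<xi>]
      by (simp add: continuous_on_eq_continuous_at)
    then have bot: "(G \<longlongrightarrow> ricker_section K \<xi> 0) at_bot"
      unfolding G_def using exp_at_bot by (rule isCont_tendsto_compose)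
    have top: "(G \<longlongrightarrow> 0) at_top"
      unfolding G_def by (rule filterlim_compose[OF ricker_section_at_top[OF cK] exp_at_top])
    have GV: "\<bar>G s\<bar> \<le> 2 * V" for s unfolding G_def by (rule bound)
    show ?c ?b
      unfolding J_def G[OF nz(1)] G[OF nz(2)]
      by (rule frullani(1)[OF cont GV bot top], rule frullani(2)[OF cont GV bot top])
  qed
  have AE: "AE \<xi> in gauss3. x \<bullet> \<xi> \<noteq> 0 \<and> y \<bullet> \<xi> \<noteq> 0"
    using standard_gaussian_AE_inner_nonzero[OF gauss3(1) x] standard_gaussian_AE_inner_nonzero[OF gauss3(1) y]
    by eventually_elim simp
  have [measurable]: "J n \<in> borel_measurable gauss3" for n
    unfolding J_def by measurable
  have "(\<lambda>n. \<integral>\<xi>. gap_weight \<xi> * J n \<xi> \<partial>gauss3)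
    \<longlonglongrightarrow> (\<integral>\<xi>. gap_weight \<xi> * ricker_section K \<xi> 0 * (ln \<bar>y \<bullet> \<xi>\<bar> - ln \<bar>x \<bullet> \<xi>\<bar>) \<partial>gauss3)"
  proof (rule integral_dominated_convergence[where w="\<lambda>\<xi>. 2 * (2 * V) * \<bar>ln \<bar>x \<bullet> \<xi>\<bar> - ln \<bar>y \<bullet> \<xi>\<bar>\<bar>"])
    show "integrable gauss3 (\<lambda>\<xi>. 2 * (2 * V) * \<bar>ln \<bar>x \<bullet> \<xi>\<bar> - ln \<bar>y \<bullet> \<xi>\<bar>\<bar>)"
      by (intro integrable_mult_right integrable_abs Bochner_Integration.integrable_diff
          standard_gaussian_integrable_ln_inner gauss3)
    show "AE \<xi> in gauss3. (\<lambda>n. gap_weight \<xi> * J n \<xi>)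
        \<longlonglongrightarrow> gap_weight \<xi> * ricker_section K \<xi> 0 * (ln \<bar>y \<bullet> \<xi>\<bar> - ln \<bar>x \<bullet> \<xi>\<bar>)"
      using AE by eventually_elim (unfold mult.assoc, intro tendsto_mult tendsto_const conv, auto)
    show "AE \<xi> in gauss3. norm (gap_weight \<xi> * J n \<xi>) \<le> 2 * (2 * V) * \<bar>ln \<bar>x \<bullet> \<xi>\<bar> - ln \<bar>y \<bullet> \<xi>\<bar>\<bar>" for n
      using AE
    proof eventually_elim
      case (elim \<xi>)
      have "\<bar>gap_weight \<xi>\<bar> * \<bar>J n \<xi>\<bar> \<le> 1 * (2 * (2 * V) * \<bar>ln \<bar>x \<bullet> \<xi>\<bar> - ln \<bar>y \<bullet> \<xi>\<bar>\<bar>)"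
        using gap_weight_bounds[of \<xi>] Jb[of \<xi> n] elim by (intro mult_mono) auto
      then show ?case by (simp add: abs_mult)
    qed
  qed measurable
  then show ?thesis unfolding lhs .
qed

section \<open>Norms and their large balls\<close>

text \<open>The two-sided comparison with the Euclidean norm is kept explicit because the error estimates need the
constants to be independent of the radius of the ball. It also makes \<open>p\<close> continuous and definite.\<close>

locale equivalent_norm =
  fixes p :: "'a::euclidean_space \<Rightarrow> real" and a b :: real
  assumes triangle: "p (x + y) \<le> p x + p y" and homogeneous: "p (c *\<^sub>R x) = \<bar>c\<bar> * p x"
    and a_pos: "0 < a" and b_pos: "0 < b" and lower: "a * p x \<le> norm x" and upper: "norm x \<le> b * p x"
begin

lemma p_zero [simp]: "p 0 = 0"
  using homogeneous[of 0 0] by simp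

lemma p_minus [simp]: "p (- x) = p x"
  using homogeneous[of "-1" x] by simp

lemma p_pos: "x \<noteq> 0 \<Longrightarrow> 0 < p x"
  using upper[of x] b_pos zero_less_mult_pos[of b "p x"] less_le_trans[of 0 "norm x" "b * p x"] by simp

lemma p_nonneg: "0 \<le> p x"
  using p_pos[of x] by (cases "x = 0") auto

lemma p_diff: "p (x - y) \<ge> p x - p y" "p (x - y) \<ge> p y - p x"
  using triangle[of "x - y" y] triangle[of "y - x" x] p_minus[of "x - y"] by auto

lemma p_lipschitz: "\<bar>p x - p y\<bar> \<le> (1 / a) * norm (x - y)"
proof -
  have "\<bar>p x - p y\<bar> \<le> p (x - y)" using p_diff(1)[of x y] p_diff(2)[of y x] by linarith
  also have "\<dots> \<le> (1 / a) * norm (x - y)" using lower[of "x - y"] a_pos by (simp add: field_simps)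
  finally show ?thesis .
qed

lemma p_continuous [continuous_intros]: "continuous_on A f \<Longrightarrow> continuous_on A (\<lambda>x. p (f x))"
proof -
  assume f: "continuous_on A f"
  have "(1 / a)-lipschitz_on UNIV p"
    by (rule lipschitz_onI) (use p_lipschitz a_pos in \<open>auto simp: dist_real_def dist_norm\<close>)
  then have "continuous_on UNIV p" by (rule lipschitz_on_continuous_on)
  then show ?thesis by (rule continuous_on_compose2[OF _ f]) auto
qed

lemma p_measurable [measurable]: "p \<in> borel_measurable borel"
  by (intro borel_measurable_continuous_onI continuous_intros)

definition pball :: "real \<Rightarrow> 'a set" where "pball r = {x. p x \<le> r}"

lemma pball_sym_convex_compact: "sym_convex_compact (pball r)"
  unfolding sym_convex_compact_def
proof (intro conjI ballI)
  have "closed (pball r)" unfolding pball_def by (intro closed_Collect_le continuous_intros)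
  moreover have "bounded (pball r)"
  proof (rule boundedI)
    fix x assume "x \<in> pball r"
    then show "norm x \<le> b * r" using order_trans[OF upper[of x] mult_left_mono[of "p x" r b]] b_pos
      by (auto simp: pball_def)
  qed
  ultimately show "compact (pball r)" by (simp add: compact_eq_bounded_closed)
  show "convex (pball r)"
  proof (rule convexI)
    fix x y and u v :: real assume *: "x \<in> pball r" "y \<in> pball r" "0 \<le> u" "0 \<le> v" "u + v = 1"
    have "p (u *\<^sub>R x + v *\<^sub>R y) \<le> u * p x + v * p y"
      using triangle[of "u *\<^sub>R x" "v *\<^sub>R y"] * by (simp add: homogeneous)
    also have "\<dots> \<le> u * r + v * r" using * by (intro add_mono mult_left_mono) (auto simp: pball_def)
    finally show "u *\<^sub>R x + v *\<^sub>R y \<in> pball r" using * by (simp add: pball_def flip: distrib_right)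
  qed
qed (simp add: pball_def)

lemma compact_pball: "compact (pball r)"
  using pball_sym_convex_compact by (simp add: sym_convex_compact_def)

lemma measure_pball: "0 \<le> r \<Longrightarrow> measure lborel (pball r) \<le> measure lborel (cball (0::'a) b) * r ^ DIM('a)"
proof -
  assume r: "0 \<le> r"
  have "pball r \<subseteq> cball 0 (b * r)"
  proof
    fix x assume "x \<in> pball r"
    then show "x \<in> cball 0 (b * r)" using order_trans[OF upper[of x] mult_left_mono[of "p x" r b]] b_pos
      by (auto simp: pball_def)
  qed
  then have "measure lborel (pball r) \<le> measure lborel (cball (0::'a) (b * r))"
    by (intro measure_mono_fmeasurable fmeasurable_compact) (auto simp: borel_compact[OF compact_pball])
  also have "\<dots> = measure lborel (cball (0::'a) b) * r ^ DIM('a)"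
    using r b_pos by (simp add: content_cball power_mult_distrib)
  finally show ?thesis .
qed

end

text \<open>These are the two tails of the function that dominates the ray integrals in \<open>log_discrepancy_bound\<close>.\<close>

lemma
  shows has_integral_exp_minus_half_line: "has_bochner_integral lborel (\<lambda>s::real. indicator {0..} s * exp (- s)) 1"
    and has_integral_exp_half_line: "has_bochner_integral lborel (\<lambda>s::real. indicator {..- L} s * exp s) (exp (- L))"
proof -
  have "(\<integral>\<^sup>+x. ennreal (indicator {0..} x * exp (- x)) \<partial>lborel) = ennreal 1"
  proof -
    have "(\<integral>\<^sup>+x. ennreal (indicator {0..} x * exp (- x)) \<partial>lborel)
      = (\<integral>\<^sup>+x. ennreal (x ^ 0 * exp (- x)) * indicator {0..} x \<partial>lborel)"
      by (intro nn_integral_cong) (simp split: split_indicator)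
    then show ?thesis unfolding nn_intergal_power_times_exp_Ici by simp
  qed
  then show 1: "has_bochner_integral lborel (\<lambda>s::real. indicator {0..} s * exp (- s)) 1"
    by (intro has_bochner_integral_nn_integral) auto
  have "has_bochner_integral lborel (\<lambda>s::real. indicator {0..} (- L + (-1) * s) * exp (- (- L + (-1) * s))) 1"
    using lborel_has_bochner_integral_real_affine_iff[of "-1" "\<lambda>s::real. indicator {0..} s * exp (- s)" 1 "- L"] 1
    by simp
  then have "has_bochner_integral lborel (\<lambda>s::real. exp (- L) * (indicator {0..} (- L + (-1) * s) * exp (- (- L + (-1) * s)))) (exp (- L) * 1)"
    by (rule has_bochner_integral_mult_right)
  moreover have "exp (- L) * (indicator {0..} (- L + (-1) * s) * exp (- (- L + (-1) * s))) = indicator {..- L} s * exp s" for s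
    by (auto simp: indicator_def mult_exp_exp)
  ultimately show "has_bochner_integral lborel (\<lambda>s::real. indicator {..- L} s * exp s) (exp (- L))"
    by simp
qed

text \<open>A norm on three-dimensional space. Instead of dilating the unit ball, its balls of radius \<open>r\<close> are used,
with \<open>r\<close> tending to infinity, so that the smoothing kernel stays fixed.\<close>

locale equivalent_norm3 = equivalent_norm p a b for p :: "r3 \<Rightarrow> real" and a b
begin

text \<open>The smoothed indicator is within \<open>kernel_moment / (a \<bar>r - p x\<bar>)\<close> of the true one, and the true one takes
the same value at \<open>x\<close> and at \<open>y\<close> because \<open>p x = p y\<close>.\<close>

lemma smoothed_pball_near:
  assumes "p x = p y" "p x \<noteq> r"
  shows "\<bar>smoothed (pball r) x - smoothed (pball r) y\<bar> \<le> kernel_moment / (a * \<bar>r - p x\<bar>)"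
proof -
  note K = compact_pball[of r]
  have d: "0 < a * \<bar>r - p x\<bar>" using assms a_pos by simp
  show ?thesis
  proof (cases "p x < r")
    case True
    have "a * \<bar>r - p x\<bar> \<le> norm w" if "z - w \<notin> pball r" "p z = p x" for z w
    proof -
      have "r < p (z - w)" using that by (simp add: pball_def)
      also have "\<dots> \<le> p z + p w" using triangle[of z "- w"] by simp
      finally have "a * \<bar>r - p x\<bar> \<le> a * p w" using that True a_pos by (intro mult_left_mono) auto
      then show ?thesis using lower[of w] by linarith
    qed
    then have "kernel_mass - kernel_moment / (a * \<bar>r - p x\<bar>) \<le> smoothed (pball r) z" if "p z = p x" for z
      using that by (intro smoothed_ge[OF K d]) auto
    from this[of x] this[of y] assms(1) smoothed_le_mass[OF K, of x] smoothed_le_mass[OF K, of y]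
    show ?thesis by (simp add: abs_le_iff)
  next
    case False
    have "a * \<bar>r - p x\<bar> \<le> norm w" if "z - w \<in> pball r" "p z = p x" for z w
    proof -
      have "p z - p w \<le> p (z - w)" by (rule p_diff)
      also have "\<dots> \<le> r" using that by (simp add: pball_def)
      finally have "a * \<bar>r - p x\<bar> \<le> a * p w" using that False a_pos by (intro mult_left_mono) auto
      then show ?thesis using lower[of w] by linarith
    qed
    then have "smoothed (pball r) z \<le> kernel_moment / (a * \<bar>r - p x\<bar>)" if "p z = p x" for z
      using that by (intro smoothed_le[OF K d]) auto
    from this[of x] this[of y] assms(1) smoothed_nonneg[OF K, of x] smoothed_nonneg[OF K, of y]
    show ?thesis by (simp add: abs_le_iff)
  qed
qed

text \<open>For nonzero \<open>x\<close> and \<open>y\<close> this is, by \<open>frullani_smoothed\<close>, the limit of the ray integrals of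
\<open>smoothed (pball r) (exp s *\<^sub>R x) - smoothed (pball r) (exp s *\<^sub>R y)\<close>. For the unsmoothed indicator and for
\<open>p x = p y\<close> these integrals vanish, so the quantity measures the effect of smoothing.\<close>

definition log_discrepancy :: "real \<Rightarrow> r3 \<Rightarrow> r3 \<Rightarrow> real" where
  "log_discrepancy r x y = (\<integral>\<xi>. gap_weight \<xi> * ricker_section (pball r) \<xi> 0
      * (ln \<bar>y \<bullet> \<xi>\<bar> - ln \<bar>x \<bullet> \<xi>\<bar>) \<partial>gauss3)"

text \<open>The line is cut into four pieces. On \<open>s \<le> - L\<close> both points are close to the origin and the Lipschitz
bound is integrable; the power \<open>r\<^sup>4\<close> is the volume of the ball times the length of \<open>x - y\<close>. On
\<open>[- L, - \<tau>]\<close> and on \<open>s \<ge> \<tau>\<close> the points stay away from the boundary of the ball, so the indicator is reproduced up to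
an error of order \<open>1 / r\<close>. On \<open>[- \<tau>, \<tau>]\<close>, where \<open>exp s *\<^sub>R x\<close> may be close to the boundary, the trivial bound
\<open>kernel_mass\<close> is paid on a short interval.\<close>

lemma log_discrepancy_bound:
  assumes r: "0 < r" and p: "p x = r" "p y = r" and L: "0 \<le> L" and \<tau>: "0 < \<tau>"
  defines "C \<equiv> 8 * measure lborel (cball (0::r3) b) * b * (\<integral>g. \<bar>g\<bar> \<partial>gauss)"
  defines "\<kappa> \<equiv> kernel_moment / (a * r * (1 - exp (- \<tau>)))"
  shows "\<bar>log_discrepancy r x y\<bar> \<le> C * r ^ 4 * exp (- L) + \<kappa> * L + 2 * \<tau> * kernel_mass + \<kappa>"
proof -
  note K = compact_pball[of r]
  have xy: "x \<noteq> 0" "y \<noteq> 0" using p r by auto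
  let ?h = "\<lambda>s. smoothed (pball r) (exp s *\<^sub>R x) - smoothed (pball r) (exp s *\<^sub>R y)"
  define g where "g s = C * r ^ 4 * (indicator {..- L} s * exp s) + \<kappa> * indicator {- L..0} s
      + kernel_mass * indicator {- \<tau>..\<tau>} s + \<kappa> * (indicator {0..} s * exp (- s))" for s :: real
  have ind: "has_bochner_integral lborel (indicator {u..v} :: real \<Rightarrow> real) (v - u)" if "u \<le> v" for u v
    using has_bochner_integral_real_indicator[of "{u..v}" lborel] that by simp
  have g: "has_bochner_integral lborel g (C * r ^ 4 * exp (- L) + \<kappa> * (0 - (- L)) + kernel_mass * (\<tau> - (- \<tau>)) + \<kappa> * 1)"
    unfolding g_def using L \<tau>
    by (intro has_bochner_integral_add has_bochner_integral_mult_right has_integral_exp_half_line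
       has_integral_exp_minus_half_line ind) auto
  have \<tau>1: "0 < 1 - exp (- \<tau>)" using \<tau> by simp
  have \<kappa>0: "0 \<le> \<kappa>" unfolding \<kappa>_def using kernel_moment_nonneg a_pos r \<tau>1 by simp
  have C0: "0 \<le> C" unfolding C_def using b_pos by (intro mult_nonneg_nonneg Bochner_Integration.integral_nonneg) auto
  have gnn: "0 \<le> C * r ^ 4 * (indicator {..- L} s * exp s)" "0 \<le> \<kappa> * indicator {- L..0} s"
    "0 \<le> kernel_mass * indicator {- \<tau>..\<tau>} s" "0 \<le> \<kappa> * (indicator {0..} s * exp (- s))" for s
    using C0 \<kappa>0 r kernel_mass_pos by auto
  have pe: "p (exp s *\<^sub>R x) = exp s * r" "p (exp s *\<^sub>R y) = exp s * r" for s by (simp_all add: homogeneous p)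
  have near: "\<bar>?h s\<bar> \<le> kernel_moment / (a * r * e)" if "0 < e" "e \<le> \<bar>1 - exp s\<bar>" for s e
  proof -
    have "exp s \<noteq> 1" using that by auto
    then have "\<bar>?h s\<bar> \<le> kernel_moment / (a * \<bar>r - exp s * r\<bar>)"
      using smoothed_pball_near[of "exp s *\<^sub>R x" "exp s *\<^sub>R y" r] r by (simp add: pe)
    also have "a * \<bar>r - exp s * r\<bar> = a * r * \<bar>1 - exp s\<bar>"
    proof -
      have "r - exp s * r = r * (1 - exp s)" by (simp add: algebra_simps)
      then show ?thesis using r by (simp add: abs_mult)
    qed
    also have "kernel_moment / (a * r * \<bar>1 - exp s\<bar>) \<le> kernel_moment / (a * r * e)"
    proof (intro divide_left_mono mult_left_mono kernel_moment_nonneg)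
      have "0 < \<bar>1 - exp s\<bar>" using that by linarith
      then show "0 < a * r * \<bar>1 - exp s\<bar> * (a * r * e)" using that a_pos r by (intro mult_pos_pos)
    qed (use that a_pos r in auto)
    finally show ?thesis .
  qed
  have hg: "\<bar>?h s\<bar> \<le> g s" for s
  proof -
    consider "s \<le> - L" | "- L \<le> s" "s \<le> - \<tau>" | "- \<tau> \<le> s" "s \<le> \<tau>" | "\<tau> \<le> s" by linarith
    then show ?thesis
    proof cases
      case 1
      have "norm (x - y) \<le> 2 * b * r"
        using norm_triangle_ineq4[of x y] upper[of x] upper[of y] p by simp
      then have n: "norm (exp s *\<^sub>R x - exp s *\<^sub>R y) \<le> exp s * (2 * b * r)"
        by (simp add: scaleR_diff_right[symmetric])
      have "\<bar>?h s\<bar> \<le> 4 * measure lborel (pball r) * (norm (exp s *\<^sub>R x - exp s *\<^sub>R y) * (\<integral>g. \<bar>g\<bar> \<partial>gauss))"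
        by (rule smoothed_lipschitz[OF K])
      also have "\<dots> \<le> 4 * (measure lborel (cball (0::r3) b) * r ^ 3) * (exp s * (2 * b * r) * (\<integral>g. \<bar>g\<bar> \<partial>gauss))"
        using measure_pball[of r] r
        by (intro mult_mono mult_left_mono n mult_nonneg_nonneg Bochner_Integration.integral_nonneg)
          (auto simp: numeral_3_eq_3 b_pos less_imp_le)
      also have "\<dots> = C * r ^ 4 * (indicator {..- L} s * exp s)"
        using 1 by (simp add: C_def power_numeral_reduce mult_ac)
      also have "\<dots> \<le> g s" unfolding g_def using gnn[of s] by linarith
      finally show ?thesis .
    next
      case 2
      then have "exp s \<le> exp (- \<tau>)" by simp
      then have "1 - exp (- \<tau>) \<le> \<bar>1 - exp s\<bar>" by linarith
      from near[OF \<tau>1 this] have "\<bar>?h s\<bar> \<le> \<kappa> * indicator {- L..0} s" using 2 \<tau> by (simp add: \<kappa>_def)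
      also have "\<dots> \<le> g s" unfolding g_def using gnn[of s] by linarith
      finally show ?thesis .
    next
      case 3
      have "\<bar>?h s\<bar> \<le> kernel_mass"
        using smoothed_nonneg[OF K, of "exp s *\<^sub>R x"] smoothed_le_mass[OF K, of "exp s *\<^sub>R x"]
          smoothed_nonneg[OF K, of "exp s *\<^sub>R y"] smoothed_le_mass[OF K, of "exp s *\<^sub>R y"] by linarith
      also have "\<dots> = kernel_mass * indicator {- \<tau>..\<tau>} s" using 3 by simp
      also have "\<dots> \<le> g s" unfolding g_def using gnn[of s] by linarith
      finally show ?thesis .
    next
      case 4
      have "exp s * exp (- s) \<le> exp s * exp (- \<tau>)" using 4 by (intro mult_left_mono) auto
      then have "(1 - exp (- \<tau>)) * exp s \<le> exp s - 1"
        by (simp add: algebra_simps flip: exp_add)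
      then have "(1 - exp (- \<tau>)) * exp s \<le> \<bar>1 - exp s\<bar>" by linarith
      with \<tau>1 have "\<bar>?h s\<bar> \<le> kernel_moment / (a * r * ((1 - exp (- \<tau>)) * exp s))"
        by (intro near) auto
      also have "\<dots> = \<kappa> * (indicator {0..} s * exp (- s))" using 4 \<tau> by (simp add: \<kappa>_def exp_minus field_simps)
      also have "\<dots> \<le> g s" unfolding g_def using gnn[of s] by linarith
      finally show ?thesis .
    qed
  qed
  have "(\<lambda>n. \<integral>s. indicator {- real n..real n} s * ?h s \<partial>lborel) \<longlonglongrightarrow> log_discrepancy r x y"
    unfolding log_discrepancy_def by (rule frullani_smoothed[OF pball_sym_convex_compact xy])
  then have "(\<lambda>n. \<bar>\<integral>s. indicator {- real n..real n} s * ?h s \<partial>lborel\<bar>) \<longlonglongrightarrow> \<bar>log_discrepancy r x y\<bar>"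
    by (rule tendsto_rabs)
  moreover have "\<bar>\<integral>s. indicator {- real n..real n} s * ?h s \<partial>lborel\<bar> \<le> integral\<^sup>L lborel g" for n
  proof -
    have "\<bar>\<integral>s. indicator {- real n..real n} s * ?h s \<partial>lborel\<bar> \<le> (\<integral>s. \<bar>indicator {- real n..real n} s * ?h s\<bar> \<partial>lborel)"
      by (rule integral_abs_bound)
    also have "\<dots> \<le> integral\<^sup>L lborel g"
    proof (rule integral_mono_AE')
      show "integrable lborel g" using g by (simp add: has_bochner_integral_iff)
      show "AE s in lborel. \<bar>indicator {- real n..real n} s * ?h s\<bar> \<le> g s"
      proof (rule AE_I2)
        fix s show "\<bar>indicator {- real n..real n} s * ?h s\<bar> \<le> g s"
          using hg[of s] abs_ge_zero[of "?h s"] by (cases "s \<in> {- real n..real n}") auto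
      qed
    qed (auto intro!: AE_I2 order_trans[OF abs_ge_zero hg])
    finally show ?thesis .
  qed
  ultimately have "\<bar>log_discrepancy r x y\<bar> \<le> integral\<^sup>L lborel g"
    by (intro LIMSEQ_le_const2) auto
  also have "\<dots> = C * r ^ 4 * exp (- L) + \<kappa> * L + 2 * \<tau> * kernel_mass + \<kappa>"
    using g by (simp add: has_bochner_integral_iff algebra_simps)
  finally show ?thesis .
qed

text \<open>The value at the centre is also the total mass of the density \<open>w(\<xi>) B(\<xi>, 0)\<close>.\<close>

definition total_weight :: "real \<Rightarrow> real" where "total_weight r = smoothed (pball r) 0"

lemma total_weight_ge: "0 < r \<Longrightarrow> kernel_mass - kernel_moment / (a * r) \<le> total_weight r"
  unfolding total_weight_def
proof (rule smoothed_ge[OF compact_pball])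
  fix w assume "0 < r" "0 - w \<notin> pball r"
  then have "r \<le> p w" by (simp add: pball_def)
  then have "a * r \<le> a * p w" using a_pos by (intro mult_left_mono) auto
  then show "a * r \<le> norm w" using lower[of w] by linarith
qed (use a_pos in simp)

text \<open>The choices \<open>L = sqrt r\<close> and \<open>\<tau> = r powr (- 1 / 4)\<close> make all four contributions vanish as \<open>r\<close> grows: \<open>exp (- L)\<close> beats
\<open>r\<^sup>4\<close>, and \<open>L / (r \<tau>)\<close> is of order \<open>r powr (- 1 / 4)\<close>. Meanwhile the total weight stays above half of the mass of
the kernel.\<close>

lemma log_discrepancy_uniform:
  obtains e :: "nat \<Rightarrow> real" where "e \<longlonglongrightarrow> 0" "\<forall>\<^sub>F n in sequentially. 0 < total_weight (real n) \<and>
    (\<forall>x y. p x = real n \<longrightarrow> p y = real n \<longrightarrow> \<bar>log_discrepancy (real n) x y\<bar> \<le> e n * total_weight (real n))"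
proof
  define C where "C = 8 * measure lborel (cball (0::r3) b) * b * (\<integral>g. \<bar>g\<bar> \<partial>gauss)"
  define M where "M = kernel_moment"
  define E where "E r = C * r ^ 4 * exp (- sqrt r) + M / (a * r * (1 - exp (- (r powr (-1/4))))) * sqrt r
     + 2 * (r powr (-1/4)) * kernel_mass + M / (a * r * (1 - exp (- (r powr (-1/4)))))" for r
  define e where "e n = 2 / kernel_mass * E (real n)" for n
  have "((\<lambda>r. E r) \<longlongrightarrow> 0) at_top"
    unfolding E_def using a_pos by real_asymp
  then have "((\<lambda>r. 2 / kernel_mass * E r) \<longlongrightarrow> 0) at_top" by (rule tendsto_mult_right_zero)
  then show "e \<longlonglongrightarrow> 0" unfolding e_def by (rule filterlim_compose) (rule filterlim_real_sequentially)
  have "((\<lambda>r. kernel_moment / (a * r)) \<longlongrightarrow> 0) at_top" using a_pos by real_asymp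
  then have "(\<lambda>n. kernel_moment / (a * real n)) \<longlonglongrightarrow> 0" by (rule filterlim_compose) (rule filterlim_real_sequentially)
  then have "\<forall>\<^sub>F n in sequentially. kernel_moment / (a * real n) < kernel_mass / 2"
    using kernel_mass_pos by (intro order_tendstoD(2)) auto
  then show "\<forall>\<^sub>F n in sequentially. 0 < total_weight (real n) \<and>
    (\<forall>x y. p x = real n \<longrightarrow> p y = real n \<longrightarrow> \<bar>log_discrepancy (real n) x y\<bar> \<le> e n * total_weight (real n))"
    using eventually_gt_at_top[of "0::nat"]
  proof eventually_elim
    case (elim n)
    have Z: "kernel_mass / 2 \<le> total_weight (real n)" using total_weight_ge[of "real n"] elim by simp
    show ?case
    proof (intro conjI allI impI)
      show "0 < total_weight (real n)" using Z kernel_mass_pos by linarith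
      fix x y assume p: "p x = real n" "p y = real n"
      have le: "\<bar>log_discrepancy (real n) x y\<bar> \<le> E (real n)"
        unfolding E_def C_def M_def using elim p by (intro log_discrepancy_bound) auto
      then have "0 \<le> E (real n)" by linarith
      then have "e n * (kernel_mass / 2) \<le> e n * total_weight (real n)"
        using kernel_mass_pos Z by (intro mult_left_mono) (auto simp: e_def)
      moreover have "e n * (kernel_mass / 2) = E (real n)" using kernel_mass_pos by (simp add: e_def)
      ultimately show "\<bar>log_discrepancy (real n) x y\<bar> \<le> e n * total_weight (real n)" using le by linarith
    qed
  qed
qed

end

section \<open>Angular measures\<close>

context equivalent_norm3
begin

definition angular_weight :: "real \<Rightarrow> r3 \<Rightarrow> real" where
  "angular_weight r \<xi> = gap_weight \<xi> * ricker_section (pball r) \<xi> 0"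

text \<open>The vector \<open>\<xi> /\<^sub>R norm \<xi>\<close> is 0 for \<open>\<xi> = 0\<close>, so the measure lives on the whole space and is concentrated on
the unit sphere only up to a null set.\<close>

definition angular_measure :: "real \<Rightarrow> r3 measure" where
  "angular_measure r = distr (density gauss3 (\<lambda>\<xi>. ennreal (angular_weight r \<xi> / total_weight r))) borel
     (\<lambda>\<xi>. \<xi> /\<^sub>R norm \<xi>)"

lemma angular_weight_measurable [measurable]: "angular_weight r \<in> borel_measurable borel"
  unfolding angular_weight_def by (intro borel_measurable_times ricker_section_measurable'[OF compact_pball]) measurable

lemma angular_weight_nonneg: "0 \<le> angular_weight r \<xi>"
  using ricker_section_nonneg[OF pball_sym_convex_compact, of r \<xi>] gap_weight_bounds[of \<xi>]
  by (simp add: angular_weight_def ricker_section_def)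

lemma angular_weight_le: "angular_weight r \<xi> \<le> 2 * measure lborel (pball r)"
  using gap_weight_ricker_section_bound[OF compact_pball, of \<xi> r 0] unfolding angular_weight_def by linarith

lemma integrable_angular_weight_mult:
  assumes "integrable gauss3 h"
  shows "integrable gauss3 (\<lambda>\<xi>. angular_weight r \<xi> * h \<xi>)"
proof (rule Bochner_Integration.integrable_bound)
  have [measurable]: "h \<in> borel_measurable borel"
    using assms borel_measurable_integrable[of gauss3 h] measurable_cong_sets[OF sets_gauss3 refl] by blast
  show "integrable gauss3 (\<lambda>\<xi>. 2 * measure lborel (pball r) * \<bar>h \<xi>\<bar>)"
    using assms by (intro integrable_mult_right integrable_abs)
  show "AE \<xi> in gauss3. norm (angular_weight r \<xi> * h \<xi>) \<le> norm (2 * measure lborel (pball r) * \<bar>h \<xi>\<bar>)"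
  proof (rule AE_I2)
    fix \<xi>
    show "norm (angular_weight r \<xi> * h \<xi>) \<le> norm (2 * measure lborel (pball r) * \<bar>h \<xi>\<bar>)"
      using angular_weight_le[of r \<xi>] angular_weight_nonneg[of r \<xi>]
      by (simp add: abs_mult mult_right_mono)
  qed
  show "(\<lambda>\<xi>. angular_weight r \<xi> * h \<xi>) \<in> borel_measurable gauss3" by measurable
qed

lemma integral_angular_weight: "(\<integral>\<xi>. angular_weight r \<xi> \<partial>gauss3) = total_weight r"
  unfolding total_weight_def angular_weight_def smoothed_eq_plane_waves[OF compact_pball] inner_zero_left ..

lemma gauss3_nonzero: "AE \<xi> in gauss3. \<xi> \<noteq> (0 :: r3)"
proof -
  have "(1, 0) \<noteq> (0 :: r3)" by (simp add: zero_prod_def)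
  from standard_gaussian_AE_inner_nonzero[OF gauss3(1) this] show ?thesis
    by eventually_elim auto
qed

lemma sets_angular_measure: "sets (angular_measure r) = sets borel"
  by (simp add: angular_measure_def)

lemma AE_angular_measure:
  assumes "AE \<xi> in gauss3. Q (\<xi> /\<^sub>R norm \<xi>)" and [measurable]: "Measurable.pred borel Q"
  shows "AE \<theta> in angular_measure r. Q \<theta>"
  unfolding angular_measure_def
proof (subst AE_distr_iff)
  show "AE \<xi> in density gauss3 (\<lambda>\<xi>. ennreal (angular_weight r \<xi> / total_weight r)). Q (\<xi> /\<^sub>R norm \<xi>)"
    by (subst AE_density) (use assms(1) in \<open>auto elim!: eventually_mono\<close>)
qed (auto simp: pred_def)

lemma prob_space_angular_measure:
  assumes "0 < total_weight r"
  shows "prob_space (angular_measure r)"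
proof -
  interpret g: prob_space gauss3 by (rule prob_space_gauss3)
  have i: "integrable gauss3 (\<lambda>\<xi>. angular_weight r \<xi> / total_weight r)"
    using integrable_angular_weight_mult[of "\<lambda>_. 1 / total_weight r" r] by simp
  have "prob_space (density gauss3 (\<lambda>\<xi>. ennreal (angular_weight r \<xi> / total_weight r)))"
  proof (rule prob_spaceI)
    have "(\<integral>\<^sup>+\<xi>. ennreal (angular_weight r \<xi> / total_weight r) \<partial>gauss3)
       = ennreal (\<integral>\<xi>. angular_weight r \<xi> / total_weight r \<partial>gauss3)"
      using assms by (intro nn_integral_eq_integral i AE_I2 divide_nonneg_nonneg angular_weight_nonneg) auto
    also have "\<dots> = 1"
      using assms by (simp add: integral_angular_weight)
    finally have 1: "(\<integral>\<^sup>+\<xi>. ennreal (angular_weight r \<xi> / total_weight r) \<partial>gauss3) = 1" .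
    have U: "UNIV \<in> sets gauss3"
      using sets.top[of gauss3] unfolding standard_gaussianD(3)[OF gauss3(1)] .
    have sp: "space (density gauss3 (\<lambda>\<xi>. ennreal (angular_weight r \<xi> / total_weight r))) = UNIV"
      unfolding space_density by (rule standard_gaussianD(3)[OF gauss3(1)])
    show "emeasure (density gauss3 (\<lambda>\<xi>. ennreal (angular_weight r \<xi> / total_weight r)))
       (space (density gauss3 (\<lambda>\<xi>. ennreal (angular_weight r \<xi> / total_weight r)))) = 1"
      unfolding sp by (subst emeasure_density[OF _ U], measurable) (simp add: 1)
  qed
  then show ?thesis unfolding angular_measure_def
    by (rule prob_space.prob_space_distr) measurable
qed

lemma integrable_gauss3_ln_norm: "integrable gauss3 (\<lambda>\<xi>. ln (norm \<xi>))"
proof (rule Bochner_Integration.integrable_bound)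
  let ?e = "(1, 0) :: r3"
  show "integrable gauss3 (\<lambda>\<xi>. norm \<xi> + \<bar>ln \<bar>?e \<bullet> \<xi>\<bar>\<bar>)"
    by (intro Bochner_Integration.integrable_add integrable_abs standard_gaussian_integrable_ln_inner
        standard_gaussian_integrable_norm gauss3)
  have "?e \<noteq> 0" by (simp add: zero_prod_def)
  from standard_gaussian_AE_inner_nonzero[OF gauss3(1) this]
  show "AE \<xi> in gauss3. norm (ln (norm \<xi>)) \<le> norm (norm \<xi> + \<bar>ln \<bar>?e \<bullet> \<xi>\<bar>\<bar>)"
  proof eventually_elim
    case (elim \<xi>)
    have "\<bar>?e \<bullet> \<xi>\<bar> \<le> norm \<xi>" using Cauchy_Schwarz_ineq2[of ?e \<xi>] by (simp add: norm_Pair)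
    moreover have "0 < \<bar>?e \<bullet> \<xi>\<bar>" using elim by simp
    ultimately have "ln \<bar>?e \<bullet> \<xi>\<bar> \<le> ln (norm \<xi>)" "ln (norm \<xi>) < norm \<xi>"
      by (auto intro!: ln_mono ln_less_self)
    then show ?case using norm_ge_zero[of \<xi>] unfolding real_norm_def by linarith
  qed
qed measurable

text \<open>Projecting to the sphere replaces \<open>ln \<bar>x \<bullet> \<xi>\<bar>\<close> by \<open>ln \<bar>x \<bullet> \<xi>\<bar> - ln (norm \<xi>)\<close>. The correction
does not depend on \<open>x\<close> and cancels in differences.\<close>

lemma
  assumes Z: "0 < total_weight r" and x: "x \<noteq> 0"
  shows angular_measure_null: "AE \<theta> in angular_measure r. x \<bullet> \<theta> \<noteq> 0"
    and angular_measure_integrable: "integrable (angular_measure r) (\<lambda>\<theta>. ln \<bar>x \<bullet> \<theta>\<bar>)"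
    and angular_measure_integral: "(\<integral>\<theta>. ln \<bar>x \<bullet> \<theta>\<bar> \<partial>angular_measure r) =
      (\<integral>\<xi>. angular_weight r \<xi> * (ln \<bar>x \<bullet> \<xi>\<bar> - ln (norm \<xi>)) \<partial>gauss3) / total_weight r"
proof -
  have ne: "AE \<xi> in gauss3. x \<bullet> \<xi> \<noteq> 0" by (rule standard_gaussian_AE_inner_nonzero[OF gauss3(1) x])
  show "AE \<theta> in angular_measure r. x \<bullet> \<theta> \<noteq> 0"
    by (rule AE_angular_measure) (use ne in \<open>auto elim!: eventually_mono\<close>)
  have eq: "AE \<xi> in gauss3. angular_weight r \<xi> / total_weight r * ln \<bar>x \<bullet> (\<xi> /\<^sub>R norm \<xi>)\<bar>
      = angular_weight r \<xi> * (ln \<bar>x \<bullet> \<xi>\<bar> - ln (norm \<xi>)) / total_weight r"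
    using ne
  proof eventually_elim
    case (elim \<xi>)
    then have "\<xi> \<noteq> 0" by auto
    have "\<bar>x \<bullet> (\<xi> /\<^sub>R norm \<xi>)\<bar> = \<bar>x \<bullet> \<xi>\<bar> / norm \<xi>" by (simp add: abs_mult divide_inverse mult.commute)
    then have "ln \<bar>x \<bullet> (\<xi> /\<^sub>R norm \<xi>)\<bar> = ln \<bar>x \<bullet> \<xi>\<bar> - ln (norm \<xi>)"
      using elim \<open>\<xi> \<noteq> 0\<close> by (simp only: ln_divide_pos zero_less_abs_iff zero_less_norm_iff not_False_eq_True)
    then show ?case by simp
  qed
  have i: "integrable gauss3 (\<lambda>\<xi>. angular_weight r \<xi> * (ln \<bar>x \<bullet> \<xi>\<bar> - ln (norm \<xi>)) / total_weight r)"
    by (intro integrable_divide integrable_angular_weight_mult Bochner_Integration.integrable_diff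
        standard_gaussian_integrable_ln_inner integrable_gauss3_ln_norm gauss3)
  have nn: "0 \<le> angular_weight r \<xi> / total_weight r" for \<xi> using Z angular_weight_nonneg by simp
  have m: "(\<lambda>\<xi>. angular_weight r \<xi> / total_weight r * ln \<bar>x \<bullet> (\<xi> /\<^sub>R norm \<xi>)\<bar>) \<in> borel_measurable gauss3"
    by measurable
  have i': "integrable gauss3 (\<lambda>\<xi>. angular_weight r \<xi> / total_weight r * ln \<bar>x \<bullet> (\<xi> /\<^sub>R norm \<xi>)\<bar>)"
      proof (rule integrable_cong_AE_imp[OF i m])
    show "AE \<xi> in gauss3. angular_weight r \<xi> * (ln \<bar>x \<bullet> \<xi>\<bar> - ln (norm \<xi>)) / total_weight r
      = angular_weight r \<xi> / total_weight r * ln \<bar>x \<bullet> (\<xi> /\<^sub>R norm \<xi>)\<bar>"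
      using eq by eventually_elim (rule sym)
  qed
  show "integrable (angular_measure r) (\<lambda>\<theta>. ln \<bar>x \<bullet> \<theta>\<bar>)"
    unfolding angular_measure_def
    by (subst integrable_distr_eq, measurable, subst integrable_density) (use i' nn in auto)
  have "(\<integral>\<theta>. ln \<bar>x \<bullet> \<theta>\<bar> \<partial>angular_measure r)
      = (\<integral>\<xi>. angular_weight r \<xi> / total_weight r * ln \<bar>x \<bullet> (\<xi> /\<^sub>R norm \<xi>)\<bar> \<partial>gauss3)"
    unfolding angular_measure_def
    by (subst integral_distr, measurable, subst integral_density) (use nn in auto)
  also have "\<dots> = (\<integral>\<xi>. angular_weight r \<xi> * (ln \<bar>x \<bullet> \<xi>\<bar> - ln (norm \<xi>)) / total_weight r \<partial>gauss3)"
    using eq by (intro integral_cong_AE m) measurable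
  finally show "(\<integral>\<theta>. ln \<bar>x \<bullet> \<theta>\<bar> \<partial>angular_measure r) =
      (\<integral>\<xi>. angular_weight r \<xi> * (ln \<bar>x \<bullet> \<xi>\<bar> - ln (norm \<xi>)) \<partial>gauss3) / total_weight r"
    by (simp only: integral_divide_zero)
qed

text \<open>Scaling both points by \<open>r\<close> leaves the difference of the logarithms unchanged and moves the unit sphere
of the norm to the boundary of \<open>pball r\<close>.\<close>

lemma angular_measure_discrepancy:
  assumes r: "0 < r" and Z: "0 < total_weight r" and x: "x \<noteq> 0" and y: "y \<noteq> 0"
  shows "(\<integral>\<theta>. ln \<bar>x \<bullet> \<theta>\<bar> \<partial>angular_measure r) - (\<integral>\<theta>. ln \<bar>y \<bullet> \<theta>\<bar> \<partial>angular_measure r)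
    = log_discrepancy r (r *\<^sub>R y) (r *\<^sub>R x) / total_weight r"
proof -
  have i: "integrable gauss3 (\<lambda>\<xi>. angular_weight r \<xi> * (ln \<bar>z \<bullet> \<xi>\<bar> - ln (norm \<xi>)))" for z
    by (intro integrable_angular_weight_mult Bochner_Integration.integrable_diff
        standard_gaussian_integrable_ln_inner integrable_gauss3_ln_norm gauss3)
  have "(\<integral>\<xi>. angular_weight r \<xi> * (ln \<bar>x \<bullet> \<xi>\<bar> - ln (norm \<xi>)) \<partial>gauss3)
      - (\<integral>\<xi>. angular_weight r \<xi> * (ln \<bar>y \<bullet> \<xi>\<bar> - ln (norm \<xi>)) \<partial>gauss3)
    = (\<integral>\<xi>. angular_weight r \<xi> * (ln \<bar>x \<bullet> \<xi>\<bar> - ln (norm \<xi>)) - angular_weight r \<xi> * (ln \<bar>y \<bullet> \<xi>\<bar> - ln (norm \<xi>)) \<partial>gauss3)"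
    by (rule Bochner_Integration.integral_diff[OF i i, symmetric])
  also have "\<dots> = log_discrepancy r (r *\<^sub>R y) (r *\<^sub>R x)"
    unfolding log_discrepancy_def angular_weight_def[symmetric]
  proof (rule integral_cong_AE)
    show "AE \<xi> in gauss3. angular_weight r \<xi> * (ln \<bar>x \<bullet> \<xi>\<bar> - ln (norm \<xi>)) - angular_weight r \<xi> * (ln \<bar>y \<bullet> \<xi>\<bar> - ln (norm \<xi>))
        = angular_weight r \<xi> * (ln \<bar>(r *\<^sub>R x) \<bullet> \<xi>\<bar> - ln \<bar>(r *\<^sub>R y) \<bullet> \<xi>\<bar>)"
      using standard_gaussian_AE_inner_nonzero[OF gauss3(1) x] standard_gaussian_AE_inner_nonzero[OF gauss3(1) y]
    proof eventually_elim
      case (elim \<xi>)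
      have "ln \<bar>(r *\<^sub>R z) \<bullet> \<xi>\<bar> = ln r + ln \<bar>z \<bullet> \<xi>\<bar>" if "z \<bullet> \<xi> \<noteq> 0" for z
        using r that by (simp add: abs_mult ln_mult)
      then show ?case using elim by (simp add: algebra_simps)
    qed
  qed measurable
  finally show ?thesis
    unfolding angular_measure_integral[OF Z x] angular_measure_integral[OF Z y] diff_divide_distrib[symmetric] by simp
qed

end

section \<open>Weak compactness of probability measures on a compact set\<close>

text \<open>For a countable base \<open>U\<close> this sends \<open>x\<close> to the point of the Cantor set whose ternary digits record
which of the sets \<open>U n\<close> contain \<open>x\<close>. The digits 0 and 2, rather than binary digits, make close codes share their
initial digits.\<close>

definition ternary_code :: "(nat \<Rightarrow> 'a set) \<Rightarrow> 'a \<Rightarrow> real" where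
  "ternary_code U x = (\<Sum>n. 2 / 3 ^ Suc n * indicator (U n) x)"

lemma ternary_digits_sums: "(\<lambda>n. 2 / 3 ^ Suc (n + k)) sums (1 / 3 ^ k :: real)"
proof -
  have "(\<lambda>n. 2 / 3 / 3 ^ k * (1 / 3) ^ n) sums (2 / 3 / 3 ^ k * (1 / (1 - 1 / 3)) :: real)"
    by (intro sums_mult geometric_sums) auto
  then show ?thesis by (simp add: power_add power_divide field_simps)
qed

lemma summable_ternary_digits:
  assumes "\<And>n. \<bar>c n\<bar> \<le> (1::real)"
  shows "summable (\<lambda>n. 2 / 3 ^ Suc n * c n)"
proof (rule summable_comparison_test'[where g="\<lambda>n. 2 / 3 ^ Suc n" and N=0])
  show "summable (\<lambda>n. 2 / 3 ^ Suc n :: real)" using ternary_digits_sums[of 0] by (simp add: sums_iff)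
  show "norm (2 / 3 ^ Suc n * c n) \<le> 2 / 3 ^ Suc n" for n
    using mult_left_mono[OF assms[of n], of "2 / 3 ^ Suc n"] by (simp add: abs_mult)
qed

lemma ternary_code_bounds: "0 \<le> ternary_code U x" "ternary_code U x \<le> 1"
proof -
  have s: "summable (\<lambda>n. 2 / 3 ^ Suc n * indicator (U n) x :: real)"
    by (intro summable_ternary_digits) (simp add: indicator_def)
  show "0 \<le> ternary_code U x" unfolding ternary_code_def by (intro suminf_nonneg s) auto
  have "ternary_code U x \<le> (\<Sum>n. 2 / 3 ^ Suc n)"
    unfolding ternary_code_def using ternary_digits_sums[of 0]
    by (intro suminf_le s) (auto simp: indicator_def sums_iff)
  then show "ternary_code U x \<le> 1" using ternary_digits_sums[of 0] by (simp add: sums_iff)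
qed

lemma ternary_code_measurable [measurable]:
  assumes [measurable]: "\<And>n. U n \<in> sets M"
  shows "ternary_code U \<in> borel_measurable M"
  unfolding ternary_code_def by measurable

text \<open>At the first position \<open>m\<close> where the digits differ the codes differ by \<open>2 / 3\<^sup>m\<^sup>+\<^sup>1\<close>, and all later digits
together can compensate only half of that.\<close>

lemma ternary_code_separates:
  assumes "\<bar>ternary_code U x - ternary_code U y\<bar> < 1 / 3 ^ Suc N" "n \<le> N"
  shows "x \<in> U n \<longleftrightarrow> y \<in> U n"
proof (rule ccontr)
  assume neq: "(x \<in> U n) \<noteq> (y \<in> U n)"
  let ?D = "\<lambda>n. (x \<in> U n) \<noteq> (y \<in> U n)"
  define m where "m = (LEAST n. ?D n)"
  have m: "(x \<in> U m) \<noteq> (y \<in> U m)" using LeastI[of ?D n, OF neq] unfolding m_def .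
  have lt: "(x \<in> U k) = (y \<in> U k)" if "k < m" for k using not_less_Least[of k ?D] that unfolding m_def by blast
  have mN: "m \<le> N" using Least_le[of ?D n, OF neq] assms(2) unfolding m_def by (rule order_trans)
  define c where "c k = indicator (U k) x - (indicator (U k) y :: real)" for k
  have c1: "\<bar>c k\<bar> \<le> 1" for k by (simp add: c_def indicator_def)
  have s: "summable (\<lambda>n. 2 / 3 ^ Suc n * indicator (U n) z :: real)" for z
    by (intro summable_ternary_digits) (simp add: indicator_def)
  have sc: "summable (\<lambda>n. 2 / 3 ^ Suc n * c n)" by (intro summable_ternary_digits c1)
  let ?T = "\<Sum>k. 2 / 3 ^ Suc (k + Suc m) * c (k + Suc m)"
  have "ternary_code U x - ternary_code U y = (\<Sum>k. 2 / 3 ^ Suc k * c k)"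
    unfolding ternary_code_def suminf_diff[OF s s] c_def right_diff_distrib ..
  also have "\<dots> = ?T + (\<Sum>k<Suc m. 2 / 3 ^ Suc k * c k)"
    by (rule suminf_split_initial_segment[OF sc])
  also have "(\<Sum>k<Suc m. 2 / 3 ^ Suc k * c k) = 2 / 3 ^ Suc m * c m"
    using lt by (simp add: c_def indicator_def)
  finally have eq: "ternary_code U x - ternary_code U y = ?T + 2 / 3 ^ Suc m * c m" .
  have "\<bar>?T\<bar> \<le> (\<Sum>k. \<bar>2 / 3 ^ Suc (k + Suc m) * c (k + Suc m)\<bar>)"
    using summable_ternary_digits[of "\<lambda>k. \<bar>c k\<bar>"] c1
    by (intro summable_rabs summable_ignore_initial_segment[of "\<lambda>k. \<bar>2 / 3 ^ Suc k * c k\<bar>"]) (simp add: abs_mult)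
  also have "\<dots> \<le> (\<Sum>k. 2 / 3 ^ Suc (k + Suc m))"
  proof (rule suminf_le)
    show "summable (\<lambda>k. \<bar>2 / 3 ^ Suc (k + Suc m) * c (k + Suc m)\<bar>)"
      using summable_ternary_digits[of "\<lambda>k. \<bar>c k\<bar>"] c1
      by (intro summable_ignore_initial_segment[of "\<lambda>k. \<bar>2 / 3 ^ Suc k * c k\<bar>"]) (simp add: abs_mult)
    show "summable (\<lambda>k. 2 / 3 ^ Suc (k + Suc m) :: real)" using ternary_digits_sums[of "Suc m"] by (simp add: sums_iff)
    show "\<bar>2 / 3 ^ Suc (k + Suc m) * c (k + Suc m)\<bar> \<le> 2 / 3 ^ Suc (k + Suc m)" for k
      using mult_left_mono[OF c1[of "k + Suc m"], of "2 / 3 ^ Suc (k + Suc m)"] by (simp add: abs_mult)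
  qed
  also have "\<dots> = 1 / 3 ^ Suc m" using ternary_digits_sums[of "Suc m"] by (simp add: sums_iff)
  finally have T: "\<bar>?T\<bar> \<le> 1 / 3 ^ Suc m" .
  have "\<bar>2 / 3 ^ Suc m * c m\<bar> = 2 * (1 / 3 ^ Suc m)" using m by (auto simp: c_def indicator_def abs_mult)
  with eq T have "1 / 3 ^ Suc m \<le> \<bar>ternary_code U x - ternary_code U y\<bar>" by linarith
  moreover have "1 / 3 ^ Suc N \<le> (1 / 3 ^ Suc m :: real)" using mN by (intro divide_left_mono power_increasing) auto
  ultimately show False using assms(1) by linarith
qed

text \<open>Finitely many small base sets cover the compact set \<open>S\<close>. If two codes agree on the corresponding digits,
the points lie in a common small set, so the inverse of the coding is uniformly continuous on
\<open>s ` S\<close>. It extends to the closure, and by Tietze's theorem to the whole line.\<close>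

lemma compact_subset_borel_coding:
  fixes S :: "'a::euclidean_space set"
  assumes "compact S" "S \<noteq> {}"
  obtains s :: "'a \<Rightarrow> real" and G :: "real \<Rightarrow> 'a"
  where "s \<in> borel_measurable borel" "range s \<subseteq> {0..1}" "continuous_on UNIV G"
    "\<And>x. x \<in> S \<Longrightarrow> G (s x) = x" "G ` closure (s ` S) \<subseteq> S"
proof -
  obtain B :: "'a set set" where B: "countable B" "topological_basis B" using ex_countable_basis by blast
  define U where "U = from_nat_into B"
  have Bne: "B \<noteq> {}" using B(2) topological_basisE[OF B(2) open_UNIV UNIV_I] by blast
  have oU: "open (U n)" for n
    using topological_basis_open[OF B(2)] from_nat_into[OF Bne] unfolding U_def by blast
  define s where "s = ternary_code U"
  have [measurable]: "U n \<in> sets borel" for n using oU by simp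
  have sm: "s \<in> borel_measurable borel" unfolding s_def by measurable
  have sep: "\<exists>d>0. \<forall>x\<in>S. \<forall>y\<in>S. \<bar>s x - s y\<bar> < d \<longrightarrow> dist x y < e" if e: "e > 0" for e
  proof -
    have ex: "\<exists>n. x \<in> U n \<and> U n \<subseteq> ball x (e / 2)" for x
    proof -
      obtain V where "V \<in> B" "x \<in> V" "V \<subseteq> ball x (e / 2)"
        using topological_basisE[OF B(2) open_ball, of x x "e / 2"] e by auto
      then show ?thesis using from_nat_into_surj[OF B(1)] unfolding U_def by metis
    qed
    then obtain n where n: "\<And>x. x \<in> U (n x)" "\<And>x. U (n x) \<subseteq> ball x (e / 2)" by metis
    have "S \<subseteq> (\<Union>x\<in>S. U (n x))" using n(1) by blast
    then obtain F where F: "F \<subseteq> S" "finite F" "S \<subseteq> (\<Union>x\<in>F. U (n x))"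
      using compactE_image[OF assms(1), of S "\<lambda>x. U (n x)"] oU by metis
    define N where "N = Max (insert 0 (n ` F))"
    show ?thesis
    proof (intro exI[of _ "1 / 3 ^ Suc N"] conjI ballI impI)
      fix x y assume *: "x \<in> S" "y \<in> S" "\<bar>s x - s y\<bar> < 1 / 3 ^ Suc N"
      obtain z where z: "z \<in> F" "x \<in> U (n z)" using F * by blast
      have "n z \<le> N" unfolding N_def using F z by (intro Max_ge) auto
      then have "y \<in> U (n z)" using ternary_code_separates[of U x y N "n z"] * z unfolding s_def by blast
      then have "dist z x < e / 2" "dist z y < e / 2" using z n(2)[of z] by (auto simp: subset_eq)
      then show "dist x y < e" using dist_triangle_half_r by blast
    qed simp
  qed
  have inj: "inj_on s S"
  proof (rule inj_onI)
    fix x y assume *: "x \<in> S" "y \<in> S" "s x = s y"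
    have "dist x y < e" if "e > 0" for e using sep[OF that] * by force
    then have "dist x y \<le> 0" by (meson not_le less_irrefl)
    then show "x = y" by simp
  qed
  define g where "g = inv_into S s"
  have g: "g (s x) = x" if "x \<in> S" for x unfolding g_def using inv_into_f_f[OF inj that] .
  have "uniformly_continuous_on (s ` S) g"
    unfolding uniformly_continuous_on_def
  proof (intro allI impI)
    fix e :: real assume "0 < e"
    from sep[OF this] obtain d where "d > 0" "\<forall>x\<in>S. \<forall>y\<in>S. \<bar>s x - s y\<bar> < d \<longrightarrow> dist x y < e" by blast
    then show "\<exists>d>0. \<forall>x\<in>s ` S. \<forall>x'\<in>s ` S. dist x' x < d \<longrightarrow> dist (g x') (g x) < e"
      by (intro exI[of _ d]) (auto simp: g dist_real_def)
  qed
  then obtain h where h: "uniformly_continuous_on (closure (s ` S)) h" "\<And>u. u \<in> s ` S \<Longrightarrow> g u = h u"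
    using uniformly_continuous_on_extension_on_closure by metis
  have hc: "continuous_on (closure (s ` S)) h" using h(1) by (rule uniformly_continuous_imp_continuous)
  then obtain G where G: "continuous_on UNIV G" "\<And>u. u \<in> closure (s ` S) \<Longrightarrow> G u = h u"
    using Tietze_unbounded[of "closure (s ` S)" h UNIV] by auto
  show thesis
  proof (rule that[OF sm _ G(1)])
    show "range s \<subseteq> {0..1}" using ternary_code_bounds unfolding s_def by auto
    show Gs: "G (s x) = x" if "x \<in> S" for x
      using G(2)[of "s x"] h(2)[of "s x"] g[OF that] that closure_subset[of "s ` S"] by auto
    show "G ` closure (s ` S) \<subseteq> S"
    proof (rule image_closure_subset)
      show "continuous_on (closure (s ` S)) G" using G(1) continuous_on_subset by blast
      show "closed S" using assms(1) by (rule compact_imp_closed)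
      show "G ` (s ` S) \<subseteq> S" using Gs by auto
    qed
  qed
qed

text \<open>The Borel coding transports the measures to the unit interval, where Helly's selection theorem
applies, and the continuous left inverse \<open>G\<close> of the coding transports the weak limit back. Integrals of a
continuous \<open>f\<close> become integrals of \<open>f \<circ> G\<close>, clipped at a bound of \<open>\<bar>f\<bar>\<close> on \<open>S\<close>.\<close>

theorem prob_measures_on_compact_weakly_compact:
  fixes P :: "nat \<Rightarrow> 'a::euclidean_space measure"
  assumes S: "compact S" "S \<noteq> {}"
    and P: "\<And>n. prob_space (P n)" "\<And>n. sets (P n) = sets borel" "\<And>n. AE x in P n. x \<in> S"
  obtains r Q where "strict_mono (r :: nat \<Rightarrow> nat)" "prob_space Q" "sets Q = sets borel" "AE x in Q. x \<in> S"
    "\<And>f :: 'a \<Rightarrow> real. continuous_on UNIV f \<Longrightarrow> (\<lambda>n. \<integral>x. f x \<partial>P (r n)) \<longlonglongrightarrow> (\<integral>x. f x \<partial>Q)"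
proof -
  obtain s :: "'a \<Rightarrow> real" and G where s[measurable]: "s \<in> borel_measurable borel" and s01: "range s \<subseteq> {0..1}"
    and G: "continuous_on UNIV G" "\<And>x. x \<in> S \<Longrightarrow> G (s x) = x" "G ` closure (s ` S) \<subseteq> S"
    using compact_subset_borel_coding[OF S] by metis
  have [measurable]: "G \<in> borel_measurable borel" using G(1) by (rule borel_measurable_continuous_onI)
  note [measurable_cong] = P(2)
  define A where "A = closure (s ` S)"
  define \<nu> where "\<nu> n = distr (P n) borel s" for n
  have rd: "real_distribution (\<nu> n)" for n
    unfolding \<nu>_def by (intro real_distribution.intro prob_space.prob_space_distr P real_distribution_axioms.intro)
      (auto simp: measurable_cong_sets[OF P(2) refl])
  have tight: "tight \<nu>"
    unfolding tight_def
  proof (intro conjI allI impI rd)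
    fix e :: real assume e: "0 < e"
    have "measure (\<nu> n) {-1<..1} = 1" for n
    proof -
      interpret prob_space "P n" by (rule P)
      have "s x \<in> {-1<..1}" for x using subsetD[OF s01 rangeI[of s x]] by auto
      then have "s -` {-1<..1} \<inter> space (P n) = space (P n)" by blast
      then show ?thesis unfolding \<nu>_def by (subst measure_distr) (auto simp: prob_space)
    qed
    then show "\<exists>a b. a < b \<and> (\<forall>n. 1 - e < measure (\<nu> n) {a<..b})"
      using e by (intro exI[of _ "-1"] exI[of _ 1]) auto
  qed
  obtain r M where r: "strict_mono (r :: nat \<Rightarrow> nat)" and M: "real_distribution M"
    and w: "weak_conv_m (\<nu> \<circ> id \<circ> r) M"
    using tight_imp_convergent_subsubsequence[OF tight strict_mono_id] by blast
  interpret M: real_distribution M by (rule M)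
  have lim: "(\<lambda>n. \<integral>u. F u \<partial>\<nu> (r n)) \<longlonglongrightarrow> (\<integral>u. F u \<partial>M)"
    if "continuous_on UNIV F" "\<And>u. \<bar>F u\<bar> \<le> C" for F :: "real \<Rightarrow> real" and C
    using weak_conv_imp_integral_bdd_continuous_conv[OF _ M w, of F C] rd that
    by (auto simp: continuous_on_eq_continuous_at)
  have sA: "s x \<in> A" if "x \<in> S" for x unfolding A_def by (rule subsetD[OF closure_subset imageI[OF that]])
  have AEA: "AE u in M. u \<in> A"
  proof -
    let ?F = "\<lambda>u. min 1 (infdist u A)"
    have Fc: "continuous_on UNIV ?F" by (intro continuous_intros)
    have [measurable]: "?F \<in> borel_measurable borel" using Fc by (rule borel_measurable_continuous_onI)
    have "(\<integral>u. ?F u \<partial>\<nu> n) = 0" for n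
    proof -
      have "(\<integral>u. ?F u \<partial>\<nu> n) = (\<integral>x. ?F (s x) \<partial>P n)" unfolding \<nu>_def by (subst integral_distr) auto
      also have "\<dots> = (\<integral>x. 0 \<partial>P n)"
      proof (rule integral_cong_AE)
        show "AE x in P n. ?F (s x) = 0" using P(3)[of n] by eventually_elim (simp add: sA)
      qed auto
      finally show ?thesis by simp
    qed
    then have "(\<lambda>n. 0) \<longlonglongrightarrow> (\<integral>u. ?F u \<partial>M)" using lim[OF Fc, of 1] by (simp add: infdist_nonneg)
    then have z: "(\<integral>u. ?F u \<partial>M) = 0" by (simp add: LIMSEQ_const_iff)
    have "integrable M ?F" by (rule M.integrable_const_bound[where B=1]) (auto simp: infdist_nonneg)
    then have "AE u in M. ?F u = 0"
      using z by (subst (asm) integral_nonneg_eq_0_iff_AE) (auto simp: infdist_nonneg)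
    then show ?thesis
    proof eventually_elim
      case (elim u)
      have "A \<noteq> {}" "closed A" unfolding A_def using S(2) by auto
      moreover have "infdist u A = 0" using elim by (simp add: min_def split: if_splits)
      ultimately show ?case by (simp add: in_closed_iff_infdist_zero)
    qed
  qed
  define Q where "Q = distr M borel G"
  show thesis
  proof (rule that[OF r])
    show "prob_space Q" unfolding Q_def by (rule M.prob_space_distr) measurable
    show "sets Q = sets borel" by (simp add: Q_def)
    have [measurable]: "S \<in> sets borel" using S(1) by (simp add: borel_compact)
    show "AE x in Q. x \<in> S"
      unfolding Q_def using AEA
      by (subst AE_distr_iff) (auto elim!: eventually_mono simp: A_def intro: subsetD[OF G(3)])
    fix f :: "'a \<Rightarrow> real" assume f: "continuous_on UNIV f"
    then have [measurable]: "f \<in> borel_measurable borel" by (rule borel_measurable_continuous_onI)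
    have "bounded (f ` S)" using S(1) f by (intro compact_imp_bounded compact_continuous_image continuous_on_subset[OF f]) auto
    then obtain C where C: "\<And>x. x \<in> S \<Longrightarrow> \<bar>f x\<bar> \<le> C" by (auto simp: bounded_iff)
    have C0: "0 \<le> C" using S(2) C abs_ge_zero order_trans by blast
    define F where "F u = max (- C) (min C (f (G u)))" for u
    have Fc: "continuous_on UNIV F" unfolding F_def
      by (intro continuous_intros continuous_on_compose2[OF f G(1)]) auto
    have [measurable]: "F \<in> borel_measurable borel" using Fc by (rule borel_measurable_continuous_onI)
    have FS: "F u = f (G u)" if "G u \<in> S" for u using C[OF that] by (auto simp: F_def)
    have "(\<integral>u. F u \<partial>\<nu> n) = (\<integral>x. f x \<partial>P n)" for n
    proof -
      have "(\<integral>u. F u \<partial>\<nu> n) = (\<integral>x. F (s x) \<partial>P n)" unfolding \<nu>_def by (subst integral_distr) auto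
      also have "\<dots> = (\<integral>x. f x \<partial>P n)"
      proof (rule integral_cong_AE)
        show "AE x in P n. F (s x) = f x" using P(3)[of n] by eventually_elim (simp add: FS G(2))
      qed auto
      finally show ?thesis .
    qed
    moreover have "(\<integral>u. F u \<partial>M) = (\<integral>x. f x \<partial>Q)"
    proof -
      have "(\<integral>x. f x \<partial>Q) = (\<integral>u. f (G u) \<partial>M)" unfolding Q_def by (subst integral_distr) auto
      also have "\<dots> = (\<integral>u. F u \<partial>M)"
      proof (rule integral_cong_AE)
        show "AE u in M. f (G u) = F u" using AEA
        proof eventually_elim
          case (elim u)
          then have "G u \<in> S" using G(3) by (auto simp: A_def)
          then show ?case by (simp add: FS)
        qed
      qed auto
      finally show ?thesis by simp
    qed
    ultimately show "(\<lambda>n. \<integral>x. f x \<partial>P (r n)) \<longlonglongrightarrow> (\<integral>x. f x \<partial>Q)"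
      using lim[OF Fc, of C] C0 by (simp add: F_def abs_le_iff min_def max_def)
  qed
qed

section \<open>Passage to the limit\<close>

lemma ln_power2_abs: "u \<noteq> 0 \<Longrightarrow> ln (u\<^sup>2) = 2 * ln \<bar>u\<bar>" for u :: real
  using ln_realpow[of "\<bar>u\<bar>" 2] by simp

context equivalent_norm
begin

text \<open>For \<open>w = (g, \<zeta>)\<close> Gaussian, \<open>(g x + \<epsilon> \<zeta>) \<bullet> \<theta>\<close> is a centred Gaussian variable of variance
\<open>(x \<bullet> \<theta>)\<^sup>2 + \<epsilon>\<^sup>2\<close> when \<open>\<theta>\<close> is a unit vector, so averaging \<open>ln \<bar>z \<bullet> \<theta>\<bar>\<close> over \<open>z = g x + \<epsilon> \<zeta>\<close> regularizes the
logarithm. Averaging the potential \<open>y \<mapsto> \<integral> ln \<bar>y \<bullet> \<theta>\<bar>\<close> in the same way and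
comparing it with \<open>ln (p y)\<close>, from which it differs by a constant up to the error \<open>e\<close>, gives the first claim.
The last claim holds because the regularized logarithm dominates \<open>ln \<bar>x \<bullet> \<theta>\<bar>\<close>.\<close>

lemma integral_regularized_log:
  fixes M P :: "'a measure"
  assumes M: "standard_gaussian M"
    and P: "prob_space P" "sets P = sets borel" "AE \<theta> in P. norm \<theta> = 1"
    and null: "\<And>x. x \<noteq> 0 \<Longrightarrow> AE \<theta> in P. x \<bullet> \<theta> \<noteq> 0"
    and int: "\<And>x. x \<noteq> 0 \<Longrightarrow> integrable P (\<lambda>\<theta>. ln \<bar>x \<bullet> \<theta>\<bar>)"
    and osc: "\<And>x y. p x = 1 \<Longrightarrow> p y = 1 \<Longrightarrow> \<bar>(\<integral>\<theta>. ln \<bar>x \<bullet> \<theta>\<bar> \<partial>P) - (\<integral>\<theta>. ln \<bar>y \<bullet> \<theta>\<bar> \<partial>P)\<bar> \<le> e"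
    and x0: "p x0 = 1" and x: "x \<noteq> 0" and \<epsilon>: "\<epsilon> > 0"
  shows "\<bar>(\<integral>\<theta>. ln ((x \<bullet> \<theta>)\<^sup>2 + \<epsilon>\<^sup>2) / 2 \<partial>P) + log_moment - (\<integral>\<theta>. ln \<bar>x0 \<bullet> \<theta>\<bar> \<partial>P)
      - (\<integral>w. ln (p (fst w *\<^sub>R x + \<epsilon> *\<^sub>R snd w)) \<partial>(gauss \<Otimes>\<^sub>M M))\<bar> \<le> e" (is ?A)
    and "integrable (gauss \<Otimes>\<^sub>M M) (\<lambda>w. ln (p (fst w *\<^sub>R x + \<epsilon> *\<^sub>R snd w)))" (is ?B)
    and "(\<integral>\<theta>. ln \<bar>x0 \<bullet> \<theta>\<bar> \<partial>P) + ln (p x) - e \<le> (\<integral>\<theta>. ln ((x \<bullet> \<theta>)\<^sup>2 + \<epsilon>\<^sup>2) / 2 \<partial>P)" (is ?C)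
proof -
  interpret P: prob_space P by (rule P)
  let ?W = "gauss \<Otimes>\<^sub>M M"
  have W: "standard_gaussian ?W" by (intro standard_gaussian_pair standard_gaussian_gauss M)
  note [measurable_cong] = P(2) standard_gaussianD(2)[OF M]
  have sW[measurable_cong]: "sets ?W = sets (borel \<Otimes>\<^sub>M borel)" by (rule sets_pair_measure_cong) (auto simp: standard_gaussianD(2)[OF M])
  interpret W: prob_space ?W by (rule standard_gaussianD(1)[OF W])
  interpret PW: pair_sigma_finite P ?W ..
  define z where "z w = fst w *\<^sub>R x + \<epsilon> *\<^sub>R snd w" for w :: "real \<times> 'a"
  have [measurable]: "z \<in> borel_measurable (borel \<Otimes>\<^sub>M borel)" unfolding z_def by measurable
  \<comment> \<open>As a function of \<open>w\<close>, \<open>z w \<bullet> \<theta>\<close> is linear with coefficient vector \<open>c \<theta>\<close>.\<close>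
  define c where "c = (\<lambda>\<theta>. (x \<bullet> \<theta>, \<epsilon> *\<^sub>R \<theta>))"
  have zc: "z w \<bullet> \<theta> = c \<theta> \<bullet> w" for w \<theta>
    by (simp add: z_def c_def inner_prod_def inner_add_left inner_commute[of "snd w"] mult.commute[of "fst w"])
  have nc: "norm (c \<theta>) = sqrt ((x \<bullet> \<theta>)\<^sup>2 + \<epsilon>\<^sup>2)" if "norm \<theta> = 1" for \<theta>
    using that \<epsilon> by (simp add: c_def norm_Pair)
  have pos: "0 < (x \<bullet> \<theta>)\<^sup>2 + \<epsilon>\<^sup>2" for \<theta> using \<epsilon> by (simp add: add_nonneg_pos)
  have inner_W: "(\<integral>w. ln \<bar>z w \<bullet> \<theta>\<bar> \<partial>?W) = ln ((x \<bullet> \<theta>)\<^sup>2 + \<epsilon>\<^sup>2) / 2 + log_moment" if "norm \<theta> = 1" for \<theta>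
  proof -
    have "(\<integral>w. ln \<bar>z w \<bullet> \<theta>\<bar> \<partial>?W) = (\<integral>g. ln \<bar>norm (c \<theta>) * g\<bar> \<partial>gauss)"
      unfolding zc by (rule standard_gaussian_integral_inner[OF W, of "\<lambda>u. ln \<bar>u\<bar>"]) measurable
    also have "\<dots> = ln \<bar>norm (c \<theta>)\<bar> + log_moment"
      using nc[OF that] pos[of \<theta>] by (intro integral_gauss_ln) auto
    finally show ?thesis using nc[OF that] pos[of \<theta>] by (simp add: ln_sqrt)
  qed
  \<comment> \<open>The standard deviation \<open>norm (c \<theta>)\<close> lies between \<open>\<epsilon>\<close> and \<open>sqrt ((norm x)\<^sup>2 + \<epsilon>\<^sup>2)\<close>, which makes Fubini applicable.\<close>
  define D where "D = \<bar>ln \<epsilon>\<bar> + \<bar>ln (sqrt ((norm x)\<^sup>2 + \<epsilon>\<^sup>2))\<bar> + (\<integral>g. \<bar>ln \<bar>1 * g\<bar>\<bar> \<partial>gauss)"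
  have absint: "(\<integral>w. norm (ln \<bar>z w \<bullet> \<theta>\<bar>) \<partial>?W) \<le> D" if "norm \<theta> = 1" for \<theta>
  proof -
    let ?s = "norm (c \<theta>)"
    have s: "\<epsilon> \<le> ?s" "?s \<le> sqrt ((norm x)\<^sup>2 + \<epsilon>\<^sup>2)"
    proof -
      show "\<epsilon> \<le> ?s" unfolding nc[OF that] by (rule real_le_rsqrt) simp
      have "\<bar>x \<bullet> \<theta>\<bar> \<le> norm x" using Cauchy_Schwarz_ineq2[of x \<theta>] that by simp
      then have "(x \<bullet> \<theta>)\<^sup>2 \<le> (norm x)\<^sup>2" by (metis abs_le_square_iff abs_norm_cancel)
      then show "?s \<le> sqrt ((norm x)\<^sup>2 + \<epsilon>\<^sup>2)" unfolding nc[OF that] by simp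
    qed
    then have "ln \<epsilon> \<le> ln ?s" "ln ?s \<le> ln (sqrt ((norm x)\<^sup>2 + \<epsilon>\<^sup>2))" using \<epsilon> by (auto intro!: ln_mono)
    then have lns: "\<bar>ln ?s\<bar> \<le> \<bar>ln \<epsilon>\<bar> + \<bar>ln (sqrt ((norm x)\<^sup>2 + \<epsilon>\<^sup>2))\<bar>" by linarith
    interpret g: prob_space gauss by (rule prob_space_gauss)
    have "(\<integral>w. norm (ln \<bar>z w \<bullet> \<theta>\<bar>) \<partial>?W) = (\<integral>g. \<bar>ln \<bar>?s * g\<bar>\<bar> \<partial>gauss)"
      unfolding zc real_norm_def by (rule standard_gaussian_integral_inner[OF W, of "\<lambda>u. \<bar>ln \<bar>u\<bar>\<bar>"]) measurable
    also have "\<dots> \<le> (\<integral>g. \<bar>ln ?s\<bar> + \<bar>ln \<bar>1 * g\<bar>\<bar> \<partial>gauss)"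
    proof (rule Bochner_Integration.integral_mono)
      show "integrable gauss (\<lambda>g. \<bar>ln \<bar>?s * g\<bar>\<bar>)" by (intro integrable_abs integrable_gauss_ln)
      show "integrable gauss (\<lambda>g. \<bar>ln ?s\<bar> + \<bar>ln \<bar>1 * g\<bar>\<bar>)"
        by (intro Bochner_Integration.integrable_add integrable_abs integrable_gauss_ln) auto
      fix g :: real
      show "\<bar>ln \<bar>?s * g\<bar>\<bar> \<le> \<bar>ln ?s\<bar> + \<bar>ln \<bar>1 * g\<bar>\<bar>"
      proof (cases "g = 0")
        case False
        then have "ln \<bar>?s * g\<bar> = ln ?s + ln \<bar>g\<bar>" using s \<epsilon> by (subst abs_mult, subst ln_mult_pos) auto
        then show ?thesis using abs_triangle_ineq[of "ln ?s" "ln \<bar>g\<bar>"] by simp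
      qed simp
    qed
    also have "\<dots> = \<bar>ln ?s\<bar> + (\<integral>g. \<bar>ln \<bar>1 * g\<bar>\<bar> \<partial>gauss)"
      using integrable_abs[OF integrable_gauss_ln[of 1]] g.prob_space by simp
    also have "\<dots> \<le> D" unfolding D_def using lns by linarith
    finally show ?thesis .
  qed
  have Fub: "integrable (P \<Otimes>\<^sub>M ?W) (\<lambda>q. ln \<bar>z (snd q) \<bullet> fst q\<bar>)"
  proof (rule PW.Fubini_integrable)
    show meas: "(\<lambda>q. ln \<bar>z (snd q) \<bullet> fst q\<bar>) \<in> borel_measurable (P \<Otimes>\<^sub>M ?W)" by measurable
    show "integrable P (\<lambda>\<theta>. \<integral>w. norm (ln \<bar>z (snd (\<theta>, w)) \<bullet> fst (\<theta>, w)\<bar>) \<partial>?W)"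
    proof (rule P.integrable_const_bound[where B=D])
      show "AE \<theta> in P. norm (\<integral>w. norm (ln \<bar>z (snd (\<theta>, w)) \<bullet> fst (\<theta>, w)\<bar>) \<partial>?W) \<le> D"
        using P(3) by eventually_elim (use absint in auto)
    qed measurable
    show "AE \<theta> in P. integrable ?W (\<lambda>w. ln \<bar>z (snd (\<theta>, w)) \<bullet> fst (\<theta>, w)\<bar>)"
      using standard_gaussian_integrable_ln_inner[OF W] by (simp add: zc)
  qed
  define \<Lambda> where "\<Lambda> y = (\<integral>\<theta>. ln \<bar>y \<bullet> \<theta>\<bar> \<partial>P)" for y
  have swap: "(\<integral>w. \<Lambda> (z w) \<partial>?W) = (\<integral>\<theta>. ln ((x \<bullet> \<theta>)\<^sup>2 + \<epsilon>\<^sup>2) / 2 + log_moment \<partial>P)"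
  proof -
    have "(\<integral>w. \<Lambda> (z w) \<partial>?W) = (\<integral>\<theta>. \<integral>w. ln \<bar>z w \<bullet> \<theta>\<bar> \<partial>?W \<partial>P)"
      unfolding \<Lambda>_def using PW.Fubini_integral[of "\<lambda>\<theta> w. ln \<bar>z w \<bullet> \<theta>\<bar>"] Fub by (simp add: case_prod_unfold)
    also have "\<dots> = (\<integral>\<theta>. ln ((x \<bullet> \<theta>)\<^sup>2 + \<epsilon>\<^sup>2) / 2 + log_moment \<partial>P)"
    proof (rule integral_cong_AE)
      show "AE \<theta> in P. (\<integral>w. ln \<bar>z w \<bullet> \<theta>\<bar> \<partial>?W) = ln ((x \<bullet> \<theta>)\<^sup>2 + \<epsilon>\<^sup>2) / 2 + log_moment"
        using P(3) by eventually_elim (rule inner_W)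
    qed measurable
    finally show ?thesis .
  qed
  have int\<Lambda>: "integrable ?W (\<lambda>w. \<Lambda> (z w))"
    unfolding \<Lambda>_def using PW.integrable_snd[of "\<lambda>\<theta> w. ln \<bar>z w \<bullet> \<theta>\<bar>"] Fub by (simp add: case_prod_unfold)
  have intreg: "integrable P (\<lambda>\<theta>. ln ((x \<bullet> \<theta>)\<^sup>2 + \<epsilon>\<^sup>2) / 2)"
  proof (rule P.integrable_const_bound[where B="\<bar>ln \<epsilon>\<bar> + \<bar>ln (sqrt ((norm x)\<^sup>2 + \<epsilon>\<^sup>2))\<bar>"])
    show "AE \<theta> in P. norm (ln ((x \<bullet> \<theta>)\<^sup>2 + \<epsilon>\<^sup>2) / 2) \<le> \<bar>ln \<epsilon>\<bar> + \<bar>ln (sqrt ((norm x)\<^sup>2 + \<epsilon>\<^sup>2))\<bar>"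
      using P(3)
    proof eventually_elim
      case (elim \<theta>)
      have "\<bar>x \<bullet> \<theta>\<bar> \<le> norm x" using Cauchy_Schwarz_ineq2[of x \<theta>] elim by simp
      then have "(x \<bullet> \<theta>)\<^sup>2 \<le> (norm x)\<^sup>2" by (metis abs_le_square_iff abs_norm_cancel)
      then have "ln (\<epsilon>\<^sup>2) \<le> ln ((x \<bullet> \<theta>)\<^sup>2 + \<epsilon>\<^sup>2)" "ln ((x \<bullet> \<theta>)\<^sup>2 + \<epsilon>\<^sup>2) \<le> ln ((norm x)\<^sup>2 + \<epsilon>\<^sup>2)"
        using \<epsilon> pos[of \<theta>] by (auto intro!: ln_mono add_nonneg_pos)
      moreover have "ln (\<epsilon>\<^sup>2) = 2 * ln \<epsilon>" using \<epsilon> by (simp add: ln_realpow)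
      moreover have "ln (sqrt ((norm x)\<^sup>2 + \<epsilon>\<^sup>2)) = ln ((norm x)\<^sup>2 + \<epsilon>\<^sup>2) / 2"
        using \<epsilon> by (intro ln_sqrt add_nonneg_pos) auto
      ultimately show ?case unfolding real_norm_def by linarith
    qed
  qed measurable
  \<comment> \<open>By homogeneity the oscillation bound on the unit sphere of \<open>p\<close> compares \<open>\<Lambda> y\<close> with \<open>ln (p y)\<close> everywhere.\<close>
  have dev: "\<bar>\<Lambda> y - \<Lambda> x0 - ln (p y)\<bar> \<le> e" if y: "y \<noteq> 0" for y
  proof -
    have py: "0 < p y" by (rule p_pos[OF y])
    define u where "u = y /\<^sub>R p y"
    have u: "p u = 1" "u \<noteq> 0" using py y by (auto simp: u_def homogeneous)
    have "\<Lambda> y = (\<integral>\<theta>. ln (p y) + ln \<bar>u \<bullet> \<theta>\<bar> \<partial>P)"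
      unfolding \<Lambda>_def
    proof (rule integral_cong_AE)
      show "AE \<theta> in P. ln \<bar>y \<bullet> \<theta>\<bar> = ln (p y) + ln \<bar>u \<bullet> \<theta>\<bar>"
        using null[OF u(2)]
      proof eventually_elim
        case (elim \<theta>)
        have "\<bar>y \<bullet> \<theta>\<bar> = p y * \<bar>u \<bullet> \<theta>\<bar>" using py by (simp add: u_def abs_mult)
        then show ?case using py elim by (simp add: ln_mult)
      qed
    qed measurable
    also have "\<dots> = ln (p y) + \<Lambda> u"
      using int[OF u(2)] P.prob_space by (simp add: \<Lambda>_def)
    finally have "\<Lambda> y = ln (p y) + \<Lambda> u" .
    then show ?thesis using osc[OF u(1) x0] unfolding \<Lambda>_def by linarith
  qed
  have zne: "AE w in ?W. z w \<noteq> 0"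
  proof -
    have "c x \<noteq> 0" using x by (simp add: c_def zero_prod_def)
    then have "AE w in ?W. c x \<bullet> w \<noteq> 0" by (rule standard_gaussian_AE_inner_nonzero[OF W])
    then show ?thesis by eventually_elim (auto simp flip: zc)
  qed
  have [measurable]: "\<Lambda> \<in> borel_measurable borel" unfolding \<Lambda>_def by measurable
  show B: ?B
    unfolding z_def[symmetric]
  proof (rule Bochner_Integration.integrable_bound)
    show "integrable ?W (\<lambda>w. \<bar>\<Lambda> (z w)\<bar> + (\<bar>\<Lambda> x0\<bar> + e))"
      by (intro Bochner_Integration.integrable_add integrable_abs int\<Lambda>) auto
    show "AE w in ?W. norm (ln (p (z w))) \<le> norm (\<bar>\<Lambda> (z w)\<bar> + (\<bar>\<Lambda> x0\<bar> + e))"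
      using zne
    proof eventually_elim
      case (elim w)
      then show ?case using dev[OF elim] unfolding real_norm_def by linarith
    qed
  qed measurable
  have "(\<integral>w. \<Lambda> (z w) - \<Lambda> x0 - ln (p (z w)) \<partial>?W)
      = (\<integral>\<theta>. ln ((x \<bullet> \<theta>)\<^sup>2 + \<epsilon>\<^sup>2) / 2 \<partial>P) + log_moment - \<Lambda> x0 - (\<integral>w. ln (p (z w)) \<partial>?W)"
    using int\<Lambda> B[unfolded z_def[symmetric]] swap intreg P.prob_space W.prob_space by simp
  moreover have "\<bar>\<integral>w. \<Lambda> (z w) - \<Lambda> x0 - ln (p (z w)) \<partial>?W\<bar> \<le> (\<integral>w. e \<partial>?W)"
  proof (rule order_trans[OF integral_abs_bound integral_mono_AE])
    show "integrable ?W (\<lambda>w. \<bar>\<Lambda> (z w) - \<Lambda> x0 - ln (p (z w))\<bar>)"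
      using B unfolding z_def[symmetric] by (intro integrable_abs Bochner_Integration.integrable_diff int\<Lambda>) auto
    show "AE w in ?W. \<bar>\<Lambda> (z w) - \<Lambda> x0 - ln (p (z w))\<bar> \<le> e"
      using zne by eventually_elim (rule dev)
  qed simp
  ultimately show ?A using W.prob_space unfolding z_def[symmetric] \<Lambda>_def by simp
  have "\<Lambda> x \<le> (\<integral>\<theta>. ln ((x \<bullet> \<theta>)\<^sup>2 + \<epsilon>\<^sup>2) / 2 \<partial>P)"
    unfolding \<Lambda>_def
  proof (rule integral_mono_AE[OF int[OF x] intreg])
    show "AE \<theta> in P. ln \<bar>x \<bullet> \<theta>\<bar> \<le> ln ((x \<bullet> \<theta>)\<^sup>2 + \<epsilon>\<^sup>2) / 2"
      using null[OF x]
    proof eventually_elim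
      case (elim \<theta>)
      have "2 * ln \<bar>x \<bullet> \<theta>\<bar> = ln ((x \<bullet> \<theta>)\<^sup>2)" using elim by (simp add: ln_power2_abs)
      also have "\<dots> \<le> ln ((x \<bullet> \<theta>)\<^sup>2 + \<epsilon>\<^sup>2)" using elim \<epsilon> by (intro ln_mono) auto
      finally show ?case by simp
    qed
  qed
  then show ?C using dev[OF x] unfolding \<Lambda>_def by linarith
qed

text \<open>The triangle inequality bounds \<open>p (g x + \<epsilon> \<zeta>)\<close> by \<open>\<bar>g\<bar> p x (1 + \<epsilon> p \<zeta> / (\<bar>g\<bar> p x))\<close>. The logarithm of the first factor
has mean \<open>log_moment + ln (p x)\<close>, and that of the second factor tends to 0 with \<open>\<epsilon>\<close> by
dominated convergence, since \<open>ln (A + B) \<le> A + B\<close> makes it integrable uniformly in \<open>\<epsilon> \<le> 1\<close>.\<close>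

lemma integral_log_perturbed_le:
  fixes M :: "'a measure"
  assumes M: "standard_gaussian M" and x: "x \<noteq> 0"
    and int: "\<And>\<epsilon>. 0 < \<epsilon> \<Longrightarrow> integrable (gauss \<Otimes>\<^sub>M M) (\<lambda>w. ln (p (fst w *\<^sub>R x + \<epsilon> *\<^sub>R snd w)))"
  obtains R :: "real \<Rightarrow> real" where "(R \<circ> (\<lambda>m. inverse (real (Suc m)))) \<longlonglongrightarrow> 0"
    "\<And>\<epsilon>. 0 < \<epsilon> \<Longrightarrow> \<epsilon> \<le> 1 \<Longrightarrow> (\<integral>w. ln (p (fst w *\<^sub>R x + \<epsilon> *\<^sub>R snd w)) \<partial>(gauss \<Otimes>\<^sub>M M)) \<le> log_moment + ln (p x) + R \<epsilon>"
proof -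
  let ?W = "gauss \<Otimes>\<^sub>M M"
  have W: "standard_gaussian ?W" by (intro standard_gaussian_pair standard_gaussian_gauss M)
  note [measurable_cong] = standard_gaussianD(2)[OF M]
  interpret M: prob_space M by (rule standard_gaussianD(1)[OF M])
  have sW[measurable_cong]: "sets ?W = sets (borel \<Otimes>\<^sub>M borel)"
    by (rule sets_pair_measure_cong) (auto simp: standard_gaussianD(2)[OF M])
  interpret W: prob_space ?W by (rule standard_gaussianD(1)[OF W])
  interpret g: prob_space gauss by (rule prob_space_gauss)
  have px: "0 < p x" by (rule p_pos[OF x])
  define A where "A w = \<bar>fst w\<bar> * p x" for w :: "real \<times> 'a"
  have A: "A w = p x * \<bar>fst w\<bar>" for w by (simp add: A_def)
  define l where "l \<epsilon> w = ln (1 + \<epsilon> * p (snd w) / A w)" for \<epsilon> w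
  have [measurable]: "A \<in> borel_measurable (borel \<Otimes>\<^sub>M borel)" unfolding A_def by measurable
  have [measurable]: "l \<epsilon> \<in> borel_measurable (borel \<Otimes>\<^sub>M borel)" for \<epsilon> unfolding l_def by measurable
  have AEg: "AE w in ?W. fst w \<noteq> 0"
    using standard_gaussian_AE_inner_nonzero[OF W, of "(1, 0)"] by (simp add: inner_prod_def zero_prod_def)
  have intA: "integrable ?W (\<lambda>w. ln (A w))"
  proof -
    have "integrable ?W (\<lambda>w. ln \<bar>(p x, 0) \<bullet> w\<bar>)" by (rule standard_gaussian_integrable_ln_inner[OF W])
    then show ?thesis using px by (simp add: inner_prod_def A abs_mult)
  qed
  have valA: "(\<integral>w. ln (A w) \<partial>?W) = log_moment + ln (p x)"
  proof -
    have "(\<integral>w. ln \<bar>(p x, 0) \<bullet> w\<bar> \<partial>?W) = (\<integral>g. ln \<bar>norm (p x, 0::'a) * g\<bar> \<partial>gauss)"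
      by (rule standard_gaussian_integral_inner[OF W, of "\<lambda>u. ln \<bar>u\<bar>"]) measurable
    also have "\<dots> = ln (p x) + log_moment" using px by (subst integral_gauss_ln) auto
    finally show ?thesis using px by (simp add: inner_prod_def A abs_mult)
  qed
  have bound: "AE w in ?W. 0 \<le> l \<epsilon> w \<and> l \<epsilon> w \<le> norm w * (p x + 1 / a) + \<bar>ln (A w)\<bar>"
    if "0 \<le> \<epsilon>" "\<epsilon> \<le> 1" for \<epsilon>
    using AEg
  proof eventually_elim
    case (elim w)
    then have A0: "0 < A w" using px by (simp add: A_def)
    have q: "0 \<le> \<epsilon> * p (snd w)" using that p_nonneg by simp
    have "l \<epsilon> w = ln (A w + \<epsilon> * p (snd w)) - ln (A w)"
    proof -
      have "1 + \<epsilon> * p (snd w) / A w = (A w + \<epsilon> * p (snd w)) / A w" using A0 by (simp add: add_divide_distrib)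
      then show ?thesis unfolding l_def using A0 q by (simp only:) (intro ln_divide_pos, auto)
    qed
    also have "ln (A w + \<epsilon> * p (snd w)) \<le> A w + \<epsilon> * p (snd w)"
      using A0 q by (intro less_imp_le[OF ln_less_self]) auto
    also have "A w + \<epsilon> * p (snd w) \<le> norm w * p x + norm w * (1 / a)"
    proof (rule add_mono)
      show "A w \<le> norm w * p x"
        unfolding A_def using px norm_fst_le[of "fst w" "snd w"] by (intro mult_right_mono) auto
      have "\<epsilon> * p (snd w) \<le> 1 * p (snd w)" using that p_nonneg by (intro mult_right_mono) auto
      also have "\<dots> \<le> norm (snd w) * (1 / a)" using lower[of "snd w"] a_pos by (simp add: field_simps)
      also have "\<dots> \<le> norm w * (1 / a)"
        using a_pos norm_snd_le[of "snd w" "fst w"] by (intro mult_right_mono) auto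
      finally show "\<epsilon> * p (snd w) \<le> norm w * (1 / a)" .
    qed
    finally have "l \<epsilon> w \<le> norm w * (p x + 1 / a) + \<bar>ln (A w)\<bar>"
      by (simp add: distrib_left)
    moreover have "0 \<le> l \<epsilon> w" unfolding l_def using A0 q by (intro ln_ge_zero) simp
    ultimately show ?case by simp
  qed
  have dom: "integrable ?W (\<lambda>w. norm w * (p x + 1 / a) + \<bar>ln (A w)\<bar>)"
    using standard_gaussian_integrable_norm[OF W] intA by simp
  have intl: "integrable ?W (l \<epsilon>)" if "0 \<le> \<epsilon>" "\<epsilon> \<le> 1" for \<epsilon>
  proof (rule Bochner_Integration.integrable_bound[OF dom])
    show "AE w in ?W. norm (l \<epsilon> w) \<le> norm (norm w * (p x + 1 / a) + \<bar>ln (A w)\<bar>)"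
      using bound[OF that] by eventually_elim (unfold real_norm_def, linarith)
  qed measurable
  define R where "R \<epsilon> = (\<integral>w. l \<epsilon> w \<partial>?W)" for \<epsilon>
  show thesis
  proof (rule that[of R])
    let ?e = "\<lambda>m. inverse (real (Suc m))"
    have "(\<lambda>m. \<integral>w. l (?e m) w \<partial>?W) \<longlonglongrightarrow> (\<integral>w. 0 \<partial>?W)"
    proof (rule integral_dominated_convergence[OF _ _ dom])
      show "AE w in ?W. (\<lambda>m. l (?e m) w) \<longlonglongrightarrow> 0"
      proof (intro AE_I2)
        fix w
        have "(\<lambda>m. ln (1 + ?e m * (p (snd w) / A w))) \<longlonglongrightarrow> ln (1 + 0 * (p (snd w) / A w))"
          by (intro tendsto_intros LIMSEQ_inverse_real_of_nat) auto
        then show "(\<lambda>m. l (?e m) w) \<longlonglongrightarrow> 0" by (simp add: l_def)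
      qed
      show "AE w in ?W. norm (l (?e m) w) \<le> norm w * (p x + 1 / a) + \<bar>ln (A w)\<bar>" for m
      proof -
        have "0 \<le> ?e m" "?e m \<le> 1" by (auto simp: inverse_le_1_iff)
        from bound[OF this] show ?thesis by eventually_elim (unfold real_norm_def, linarith)
      qed
    qed measurable
    then show "(R \<circ> ?e) \<longlonglongrightarrow> 0" by (simp add: R_def[abs_def] comp_def)
    fix \<epsilon> :: real assume \<epsilon>: "0 < \<epsilon>" "\<epsilon> \<le> 1"
    have "(\<integral>w. ln (p (fst w *\<^sub>R x + \<epsilon> *\<^sub>R snd w)) \<partial>?W) \<le> (\<integral>w. ln (A w) + l \<epsilon> w \<partial>?W)"
    proof (rule integral_mono_AE)
      show "integrable ?W (\<lambda>w. ln (p (fst w *\<^sub>R x + \<epsilon> *\<^sub>R snd w)))" using int[OF \<epsilon>(1)] .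
      show "integrable ?W (\<lambda>w. ln (A w) + l \<epsilon> w)"
        using intA intl \<epsilon> by (intro Bochner_Integration.integrable_add) auto
      have "AE w in ?W. fst w *\<^sub>R x + \<epsilon> *\<^sub>R snd w \<noteq> 0"
      proof -
        have "(x \<bullet> x, \<epsilon> *\<^sub>R x) \<noteq> 0" using x by (simp add: zero_prod_def)
        from standard_gaussian_AE_inner_nonzero[OF W this]
        show ?thesis
        proof eventually_elim
          case (elim w)
          have "(x \<bullet> x, \<epsilon> *\<^sub>R x) \<bullet> w = x \<bullet> (fst w *\<^sub>R x + \<epsilon> *\<^sub>R snd w)"
            by (simp add: inner_prod_def inner_add_right mult.commute)
          then show ?case using elim by auto
        qed
      qed
      then show "AE w in ?W. ln (p (fst w *\<^sub>R x + \<epsilon> *\<^sub>R snd w)) \<le> ln (A w) + l \<epsilon> w"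
        using AEg
      proof eventually_elim
        case (elim w)
        have A0: "0 < A w" using px elim by (simp add: A_def)
        have q: "0 \<le> \<epsilon> * p (snd w)" using \<epsilon> p_nonneg by simp
        have "p (fst w *\<^sub>R x + \<epsilon> *\<^sub>R snd w) \<le> A w + \<epsilon> * p (snd w)"
          using triangle[of "fst w *\<^sub>R x" "\<epsilon> *\<^sub>R snd w"] \<epsilon> by (simp add: homogeneous A_def)
        also have "\<dots> = A w * (1 + \<epsilon> * p (snd w) / A w)" using A0 by (simp add: field_simps)
        finally have "ln (p (fst w *\<^sub>R x + \<epsilon> *\<^sub>R snd w)) \<le> ln (A w * (1 + \<epsilon> * p (snd w) / A w))"
          using p_pos[OF elim(1)] by (intro ln_mono)
        also have "\<dots> = ln (A w) + l \<epsilon> w"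
          unfolding l_def using A0 q by (intro ln_mult_pos) (auto intro!: add_pos_nonneg)
        finally show ?case .
      qed
    qed
    also have "\<dots> = log_moment + ln (p x) + R \<epsilon>"
      using intA intl \<epsilon> valA by (simp add: R_def)
    finally show "(\<integral>w. ln (p (fst w *\<^sub>R x + \<epsilon> *\<^sub>R snd w)) \<partial>?W) \<le> log_moment + ln (p x) + R \<epsilon>" .
  qed
qed

text \<open>Let \<open>F x \<epsilon>\<close> be the integral of the regularized logarithm against the weak limit \<open>Q\<close>, and \<open>E x \<epsilon>\<close> the Gaussian mean
of \<open>ln (p (g x + \<epsilon> \<zeta>))\<close>. Weak convergence applies to the regularized
logarithm and shows that \<open>F x \<epsilon> - E x \<epsilon>\<close> does not depend on \<open>x\<close> and \<open>\<epsilon>\<close>; it is \<open>c - log_moment\<close>. The bound on \<open>E\<close> from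
the triangle inequality and the lower bound on \<open>F\<close> from the unregularized logarithm squeeze \<open>F x \<epsilon>\<close> to
\<open>ln (p x) + c\<close> as \<open>\<epsilon>\<close> tends to 0. The regularized logarithm decreases to \<open>ln \<bar>x \<bullet> \<theta>\<bar>\<close>, with limit \<open>- \<infinity>\<close> where \<open>x \<bullet> \<theta> = 0\<close>,
so monotone convergence yields both the integral and the fact that this exceptional set is null.\<close>

theorem log_representation_limit:
  fixes M :: "'a measure" and P :: "nat \<Rightarrow> 'a measure"
  assumes M: "standard_gaussian M"
    and P: "\<And>n. prob_space (P n)" "\<And>n. sets (P n) = sets borel" "\<And>n. AE \<theta> in P n. norm \<theta> = 1"
    and null: "\<And>n x. x \<noteq> 0 \<Longrightarrow> AE \<theta> in P n. x \<bullet> \<theta> \<noteq> 0"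
    and int: "\<And>n x. x \<noteq> 0 \<Longrightarrow> integrable (P n) (\<lambda>\<theta>. ln \<bar>x \<bullet> \<theta>\<bar>)"
    and osc: "\<And>n x y. p x = 1 \<Longrightarrow> p y = 1 \<Longrightarrow>
        \<bar>(\<integral>\<theta>. ln \<bar>x \<bullet> \<theta>\<bar> \<partial>P n) - (\<integral>\<theta>. ln \<bar>y \<bullet> \<theta>\<bar> \<partial>P n)\<bar> \<le> e n"
    and e: "e \<longlonglongrightarrow> 0"
  obtains Q c where "prob_space Q" "sets Q = sets borel" "AE \<theta> in Q. norm \<theta> = 1"
    "\<And>x. x \<noteq> 0 \<Longrightarrow> AE \<theta> in Q. x \<bullet> \<theta> \<noteq> 0"
    "\<And>x. x \<noteq> 0 \<Longrightarrow> has_bochner_integral Q (\<lambda>\<theta>. ln \<bar>x \<bullet> \<theta>\<bar>) (ln (p x) + c)"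
proof -
  let ?W = "gauss \<Otimes>\<^sub>M M"
  obtain b where b: "b \<in> (Basis :: 'a set)" using nonempty_Basis by blast
  then have b0: "b \<noteq> 0" by auto
  \<comment> \<open>A reference point of norm 1; \<open>lam n\<close> below is the additive constant of \<open>P n\<close>.\<close>
  define x0 where "x0 = b /\<^sub>R p b"
  have x0: "p x0 = 1" using p_pos[OF b0] by (simp add: x0_def homogeneous)
  have S: "compact (sphere (0::'a) 1)" "sphere (0::'a) 1 \<noteq> {}" using b by auto
  have PS: "AE \<theta> in P n. \<theta> \<in> sphere 0 1" for n using P(3)[of n] by simp
  obtain r Q where r: "strict_mono (r :: nat \<Rightarrow> nat)" and Q: "prob_space Q" "sets Q = sets borel"
    and QS: "AE \<theta> in Q. \<theta> \<in> sphere 0 1"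
    and lim: "\<And>f :: 'a \<Rightarrow> real. continuous_on UNIV f \<Longrightarrow> (\<lambda>n. \<integral>x. f x \<partial>P (r n)) \<longlonglongrightarrow> (\<integral>x. f x \<partial>Q)"
    by (rule prob_measures_on_compact_weakly_compact[OF S P(1) P(2) PS]) (rule that)
  have Q1: "AE \<theta> in Q. norm \<theta> = 1" using QS by simp
  interpret Q: prob_space Q by (rule Q)
  note [measurable_cong] = Q(2)
  define lam where "lam n = (\<integral>\<theta>. ln \<bar>x0 \<bullet> \<theta>\<bar> \<partial>P n)" for n
  define E where "E x \<epsilon> = (\<integral>w. ln (p (fst w *\<^sub>R x + \<epsilon> *\<^sub>R snd w)) \<partial>?W)" for x \<epsilon>
  define F where "F x \<epsilon> = (\<integral>\<theta>. ln ((x \<bullet> \<theta>)\<^sup>2 + \<epsilon>\<^sup>2) / 2 \<partial>Q)" for x :: 'a and \<epsilon> :: real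
  have er: "(\<lambda>n. e (r n)) \<longlonglongrightarrow> 0" using LIMSEQ_subseq_LIMSEQ[OF e r] by (simp add: comp_def)
  have reg1: "\<bar>(\<integral>\<theta>. ln ((x \<bullet> \<theta>)\<^sup>2 + \<epsilon>\<^sup>2) / 2 \<partial>P n) + log_moment - lam n - E x \<epsilon>\<bar> \<le> e n"
    and reg2: "integrable ?W (\<lambda>w. ln (p (fst w *\<^sub>R x + \<epsilon> *\<^sub>R snd w)))"
    and reg3: "lam n + ln (p x) - e n \<le> (\<integral>\<theta>. ln ((x \<bullet> \<theta>)\<^sup>2 + \<epsilon>\<^sup>2) / 2 \<partial>P n)"
    if x: "x \<noteq> 0" and \<epsilon>: "\<epsilon> > 0" for x \<epsilon> n
    unfolding lam_def E_def
    by ((rule integral_regularized_log[where e="e n", OF M P(1)[of n] P(2) P(3) _ _ _ x0 x \<epsilon>];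
        rule null int osc; assumption)+)
  have limF: "(\<lambda>n. \<integral>\<theta>. ln ((x \<bullet> \<theta>)\<^sup>2 + \<epsilon>\<^sup>2) / 2 \<partial>P (r n)) \<longlonglongrightarrow> F x \<epsilon>" if "\<epsilon> > 0" for x \<epsilon>
    unfolding F_def
  proof (rule lim)
    have "0 < (x \<bullet> \<theta>)\<^sup>2 + \<epsilon>\<^sup>2" for \<theta> using that by (simp add: add_nonneg_pos)
    then show "continuous_on UNIV (\<lambda>\<theta>. ln ((x \<bullet> \<theta>)\<^sup>2 + \<epsilon>\<^sup>2) / 2)"
      by (intro continuous_intros) (auto simp: less_imp_neq[symmetric])
  qed
  have limlam: "(\<lambda>n. lam (r n)) \<longlonglongrightarrow> F x \<epsilon> + log_moment - E x \<epsilon>" if x: "x \<noteq> 0" and \<epsilon>: "\<epsilon> > 0" for x \<epsilon>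
  proof -
    let ?diff = "\<lambda>n. (\<integral>\<theta>. ln ((x \<bullet> \<theta>)\<^sup>2 + \<epsilon>\<^sup>2) / 2 \<partial>P (r n)) + log_moment - lam (r n) - E x \<epsilon>"
    have "?diff \<longlonglongrightarrow> 0"
      by (rule Lim_null_comparison[OF _ er])
        (use reg1[OF x \<epsilon>] in simp)
    from tendsto_diff[OF tendsto_diff[OF tendsto_add[OF limF[OF \<epsilon>, of x] tendsto_const[of log_moment]] this] tendsto_const[of "E x \<epsilon>"]]
    show ?thesis by simp
  qed
  define c where "c = F x0 1 + log_moment - E x0 1"
  have x00: "x0 \<noteq> 0" using x0 by auto
  have FE: "F x \<epsilon> = E x \<epsilon> - log_moment + c" if x: "x \<noteq> 0" and \<epsilon>: "\<epsilon> > 0" for x \<epsilon>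
    using LIMSEQ_unique[OF limlam[OF x \<epsilon>] limlam[OF x00, of 1]] by (simp add: c_def)
  have lower: "c + ln (p x) \<le> F x \<epsilon>" if x: "x \<noteq> 0" and \<epsilon>: "\<epsilon> > 0" for x \<epsilon>
  proof (rule LIMSEQ_le[OF _ limF[OF \<epsilon>]])
    have "(\<lambda>n. lam (r n) + ln (p x) - e (r n)) \<longlonglongrightarrow> c + ln (p x) - 0"
      using limlam[OF x00, of 1] er by (intro tendsto_intros) (auto simp: c_def)
    then show "(\<lambda>n. lam (r n) + ln (p x) - e (r n)) \<longlonglongrightarrow> c + ln (p x)" by simp
    show "\<exists>N. \<forall>n\<ge>N. lam (r n) + ln (p x) - e (r n) \<le> (\<integral>\<theta>. ln ((x \<bullet> \<theta>)\<^sup>2 + \<epsilon>\<^sup>2) / 2 \<partial>P (r n))"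
      using reg3[OF x \<epsilon>] by blast
  qed
  let ?e = "\<lambda>m. inverse (real (Suc m))"
  have limFe: "(\<lambda>m. F x (?e m)) \<longlonglongrightarrow> ln (p x) + c" if x: "x \<noteq> 0" for x
  proof -
    have iE: "integrable ?W (\<lambda>w. ln (p (fst w *\<^sub>R x + \<epsilon> *\<^sub>R snd w)))" if "0 < \<epsilon>" for \<epsilon>
      by (rule reg2[OF x that])
    obtain R where R: "(R \<circ> ?e) \<longlonglongrightarrow> 0"
      "\<And>\<epsilon>. 0 < \<epsilon> \<Longrightarrow> \<epsilon> \<le> 1 \<Longrightarrow> (\<integral>w. ln (p (fst w *\<^sub>R x + \<epsilon> *\<^sub>R snd w)) \<partial>?W) \<le> log_moment + ln (p x) + R \<epsilon>"
      by (rule integral_log_perturbed_le[OF M x], rule iE, assumption) (rule that)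
    note R = R(1) R(2)[folded E_def]
    have up: "F x (?e m) \<le> ln (p x) + c + (R \<circ> ?e) m" for m
      using FE[OF x, of "?e m"] R(2)[of "?e m"] by (simp add: inverse_le_1_iff)
    have "(\<lambda>m. ln (p x) + c + (R \<circ> ?e) m) \<longlonglongrightarrow> ln (p x) + c + 0" by (intro tendsto_add tendsto_const R)
    then have ru: "(\<lambda>m. ln (p x) + c + (R \<circ> ?e) m) \<longlonglongrightarrow> ln (p x) + c" by simp
    show ?thesis
    proof (rule tendsto_sandwich[OF _ _ tendsto_const ru])
      show "\<forall>\<^sub>F m in sequentially. ln (p x) + c \<le> F x (?e m)"
        using lower[OF x] by (intro always_eventually allI) (simp add: add.commute)
      show "\<forall>\<^sub>F m in sequentially. F x (?e m) \<le> ln (p x) + c + (R \<circ> ?e) m" using up by simp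
    qed
  qed
  show thesis
  proof (rule that[OF Q Q1])
    fix x :: 'a assume x: "x \<noteq> 0"
    \<comment> \<open>Subtracting the regularized logarithm from the constant \<open>C\<close> makes it nonnegative and increasing in \<open>m\<close>.\<close>
    define C where "C = ln ((norm x)\<^sup>2 + 1) / 2"
    define f where "f m \<theta> = C - ln ((x \<bullet> \<theta>)\<^sup>2 + (?e m)\<^sup>2) / 2" for m \<theta>
    define G where "G \<theta> = (if x \<bullet> \<theta> = 0 then \<infinity> else ennreal (C - ln \<bar>x \<bullet> \<theta>\<bar>))" for \<theta>
    have e01: "0 < ?e m" "?e m \<le> 1" for m by (auto simp: inverse_le_1_iff)
    have pos: "0 < (x \<bullet> \<theta>)\<^sup>2 + (?e m)\<^sup>2" for \<theta> m
      using e01[of m] by (intro add_nonneg_pos) auto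
    have cs: "(x \<bullet> \<theta>)\<^sup>2 \<le> (norm x)\<^sup>2" if "norm \<theta> = 1" for \<theta>
      using Cauchy_Schwarz_ineq2[of x \<theta>] that by (metis abs_le_square_iff abs_norm_cancel mult.right_neutral)
    have fm: "f m \<in> borel_measurable Q" for m unfolding f_def by measurable
    have fnn: "AE \<theta> in Q. 0 \<le> f m \<theta>" for m
      using Q1
    proof eventually_elim
      case (elim \<theta>)
      have "(?e m)\<^sup>2 \<le> 1" using e01[of m] by (intro power_le_one) auto
      then have "ln ((x \<bullet> \<theta>)\<^sup>2 + (?e m)\<^sup>2) \<le> ln ((norm x)\<^sup>2 + 1)"
        using pos cs[OF elim] by (intro ln_mono add_mono) auto
      then show ?case by (simp add: f_def C_def)
    qed
    have fint: "integrable Q (f m)" for m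
    proof (rule Q.integrable_const_bound[where B="C - ln ((?e m)\<^sup>2) / 2"])
      show "AE \<theta> in Q. norm (f m \<theta>) \<le> C - ln ((?e m)\<^sup>2) / 2"
        using fnn[of m]
      proof eventually_elim
        case (elim \<theta>)
        have "ln ((?e m)\<^sup>2) \<le> ln ((x \<bullet> \<theta>)\<^sup>2 + (?e m)\<^sup>2)" using e01[of m] by (intro ln_mono) auto
        then show ?case using elim by (simp add: f_def)
      qed
    qed (rule fm)
    have fval: "(\<integral>\<theta>. f m \<theta> \<partial>Q) = C - F x (?e m)" for m
    proof -
      have "integrable Q (\<lambda>\<theta>. C - f m \<theta>)" by (intro Bochner_Integration.integrable_diff fint) auto
      then have "integrable Q (\<lambda>\<theta>. ln ((x \<bullet> \<theta>)\<^sup>2 + (?e m)\<^sup>2) / 2)" by (simp add: f_def)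
      then show ?thesis unfolding f_def F_def using Q.prob_space by (subst Bochner_Integration.integral_diff) auto
    qed
    have "(\<lambda>m. \<integral>\<^sup>+\<theta>. ennreal (f m \<theta>) \<partial>Q) \<longlonglongrightarrow> (\<integral>\<^sup>+\<theta>. G \<theta> \<partial>Q)"
    proof (rule nn_integral_LIMSEQ)
      show "incseq (\<lambda>m \<theta>. ennreal (f m \<theta>))"
      proof (intro incseq_SucI le_funI ennreal_leI)
        fix m \<theta>
        have "(?e (Suc m))\<^sup>2 \<le> (?e m)\<^sup>2" using e01[of "Suc m"] by (intro power_mono) (auto simp: field_simps)
        then have "ln ((x \<bullet> \<theta>)\<^sup>2 + (?e (Suc m))\<^sup>2) \<le> ln ((x \<bullet> \<theta>)\<^sup>2 + (?e m)\<^sup>2)"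
          by (intro ln_mono add_left_mono pos)
        then show "f m \<theta> \<le> f (Suc m) \<theta>" by (simp add: f_def)
      qed
      show "(\<lambda>\<theta>. ennreal (f m \<theta>)) \<in> borel_measurable Q" for m using fm by measurable
      fix \<theta>
      show "(\<lambda>m. ennreal (f m \<theta>)) \<longlonglongrightarrow> G \<theta>"
      proof (cases "x \<bullet> \<theta> = 0")
        case True
        have "f m \<theta> = C + ln (real (Suc m))" for m
          using True by (simp add: f_def ln_realpow ln_inverse)
        moreover have "filterlim (\<lambda>m. C + ln (real (Suc m))) at_top sequentially" by real_asymp
        ultimately have "filterlim (\<lambda>m. f m \<theta>) at_top sequentially" by simp
        then show ?thesis using True by (simp add: G_def ennreal_tendsto_top_eq_at_top)
      next
        case False
        have "(\<lambda>m. f m \<theta>) \<longlonglongrightarrow> C - ln ((x \<bullet> \<theta>)\<^sup>2 + 0\<^sup>2) / 2"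
          unfolding f_def using False by (intro tendsto_intros LIMSEQ_inverse_real_of_nat) auto
        also have "ln ((x \<bullet> \<theta>)\<^sup>2 + 0\<^sup>2) = 2 * ln \<bar>x \<bullet> \<theta>\<bar>"
          using False by (simp add: ln_power2_abs)
        finally show ?thesis using False by (auto simp: G_def intro: tendsto_ennrealI)
      qed
    qed
    moreover have "(\<integral>\<^sup>+\<theta>. ennreal (f m \<theta>) \<partial>Q) = ennreal (C - F x (?e m))" for m
      by (subst nn_integral_eq_integral[OF fint fnn]) (simp only: fval)
    moreover have "(\<lambda>m. ennreal (C - F x (?e m))) \<longlonglongrightarrow> ennreal (C - (ln (p x) + c))"
      by (intro tendsto_ennrealI tendsto_diff tendsto_const limFe x)
    ultimately have G: "(\<integral>\<^sup>+\<theta>. G \<theta> \<partial>Q) = ennreal (C - (ln (p x) + c))"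
      by (simp add: LIMSEQ_unique)
    have [measurable]: "G \<in> borel_measurable Q" unfolding G_def by measurable
    have "AE \<theta> in Q. G \<theta> \<noteq> \<infinity>" using G by (intro nn_integral_noteq_infinite) auto
    then show AE: "AE \<theta> in Q. x \<bullet> \<theta> \<noteq> 0" by eventually_elim (auto simp: G_def)
    have nn: "AE \<theta> in Q. 0 \<le> C - ln \<bar>x \<bullet> \<theta>\<bar>"
      using AE Q1
    proof eventually_elim
      case (elim \<theta>)
      have "2 * ln \<bar>x \<bullet> \<theta>\<bar> = ln ((x \<bullet> \<theta>)\<^sup>2)" using elim by (simp add: ln_power2_abs)
      also have "\<dots> \<le> ln ((norm x)\<^sup>2 + 1)" using elim cs[of \<theta>] by (intro ln_mono) auto
      finally show ?case by (simp add: C_def)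
    qed
    have CF: "0 \<le> C - (ln (p x) + c)"
    proof (rule LIMSEQ_le_const[OF tendsto_diff[OF tendsto_const limFe[OF x]]])
      show "\<exists>N. \<forall>m\<ge>N. 0 \<le> C - F x (?e m)"
        using integral_nonneg_AE[OF fnn] unfolding fval by auto
    qed
    have "(\<integral>\<^sup>+\<theta>. ennreal (C - ln \<bar>x \<bullet> \<theta>\<bar>) \<partial>Q) = ennreal (C - (ln (p x) + c))"
      unfolding G[symmetric] using AE by (intro nn_integral_cong_AE) (auto simp: G_def elim!: eventually_mono)
    then have "has_bochner_integral Q (\<lambda>\<theta>. C - ln \<bar>x \<bullet> \<theta>\<bar>) (C - (ln (p x) + c))"
      using nn CF by (intro has_bochner_integral_nn_integral) auto
    moreover have "has_bochner_integral Q (\<lambda>_. C) C"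
      using Q.prob_space by (simp add: has_bochner_integral_iff)
    ultimately have "has_bochner_integral Q (\<lambda>\<theta>. C - (C - ln \<bar>x \<bullet> \<theta>\<bar>)) (C - (C - (ln (p x) + c)))"
      by (rule has_bochner_integral_diff[rotated])
    then show "has_bochner_integral Q (\<lambda>\<theta>. ln \<bar>x \<bullet> \<theta>\<bar>) (ln (p x) + c)" by simp
  qed
qed

end

context equivalent_norm3
begin

theorem log_norm_representation3:
  obtains Q c where "prob_space Q" "sets Q = sets borel" "AE \<theta> in Q. norm \<theta> = 1"
    "\<And>x. x \<noteq> 0 \<Longrightarrow> AE \<theta> in Q. x \<bullet> \<theta> \<noteq> 0"
    "\<And>x. x \<noteq> 0 \<Longrightarrow> has_bochner_integral Q (\<lambda>\<theta>. ln \<bar>x \<bullet> \<theta>\<bar>) (ln (p x) + c)"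
proof -
  obtain e where e: "e \<longlonglongrightarrow> 0" and ev: "\<forall>\<^sub>F n in sequentially. 0 < total_weight (real n) \<and>
    (\<forall>x y. p x = real n \<longrightarrow> p y = real n \<longrightarrow> \<bar>log_discrepancy (real n) x y\<bar> \<le> e n * total_weight (real n))"
    by (rule log_discrepancy_uniform) (rule that)
  obtain N where N: "\<And>n. n \<ge> N \<Longrightarrow> 0 < total_weight (real n)"
    "\<And>n x y. n \<ge> N \<Longrightarrow> p x = real n \<Longrightarrow> p y = real n \<Longrightarrow> \<bar>log_discrepancy (real n) x y\<bar> \<le> e n * total_weight (real n)"
    using ev unfolding eventually_sequentially by blast
  \<comment> \<open>Positive radii from which on the estimates hold.\<close>
  define k where "k n = Suc (n + N)" for n
  define P where "P n = angular_measure (real (k n))" for n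
  have Z: "0 < total_weight (real (k n))" for n by (rule N(1)) (simp add: k_def)
  have ek: "(\<lambda>n. e (k n)) \<longlonglongrightarrow> 0"
    using LIMSEQ_ignore_initial_segment[OF e, of "Suc N"] by (simp add: k_def)
  show thesis
  proof (rule log_representation_limit[OF gauss3(1), of P "\<lambda>n. e (k n)"])
    show "prob_space (P n)" for n unfolding P_def by (rule prob_space_angular_measure[OF Z])
    show "sets (P n) = sets borel" for n unfolding P_def by (rule sets_angular_measure)
    show "AE \<theta> in P n. norm \<theta> = 1" for n
      unfolding P_def by (rule AE_angular_measure) (use gauss3_nonzero in \<open>auto elim!: eventually_mono\<close>)
    show "AE \<theta> in P n. x \<bullet> \<theta> \<noteq> 0" if "x \<noteq> 0" for n x
      unfolding P_def by (rule angular_measure_null[OF Z that])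
    show "integrable (P n) (\<lambda>\<theta>. ln \<bar>x \<bullet> \<theta>\<bar>)" if "x \<noteq> 0" for n x
      unfolding P_def by (rule angular_measure_integrable[OF Z that])
    show "\<bar>(\<integral>\<theta>. ln \<bar>x \<bullet> \<theta>\<bar> \<partial>P n) - (\<integral>\<theta>. ln \<bar>y \<bullet> \<theta>\<bar> \<partial>P n)\<bar> \<le> e (k n)"
      if "p x = 1" "p y = 1" for n x y
    proof -
      have "x \<noteq> 0" "y \<noteq> 0" using that by auto
      have "(\<integral>\<theta>. ln \<bar>x \<bullet> \<theta>\<bar> \<partial>P n) - (\<integral>\<theta>. ln \<bar>y \<bullet> \<theta>\<bar> \<partial>P n)
        = log_discrepancy (real (k n)) (real (k n) *\<^sub>R y) (real (k n) *\<^sub>R x) / total_weight (real (k n))"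
        unfolding P_def by (rule angular_measure_discrepancy[OF _ Z \<open>x \<noteq> 0\<close> \<open>y \<noteq> 0\<close>]) (simp add: k_def)
      moreover have "\<bar>log_discrepancy (real (k n)) (real (k n) *\<^sub>R y) (real (k n) *\<^sub>R x)\<bar> \<le> e (k n) * total_weight (real (k n))"
        using that by (intro N(2)) (auto simp: homogeneous k_def)
      ultimately show ?thesis using Z[of n] by (simp add: abs_divide divide_le_eq)
    qed
    show "(\<lambda>n. e (k n)) \<longlonglongrightarrow> 0" by (rule ek)
  qed (rule that)
qed

end

section \<open>The Minkowski functional of a symmetric convex body\<close>

locale symmetric_convex_body =
  fixes K :: "'a::euclidean_space set"
  assumes body: "convex_body K" and sym: "origin_symmetric K"
begin

lemma compact_K: "compact K" and convex_K: "convex K"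
  using body by (auto simp: convex_body_def)

lemma minus_mem: "x \<in> K \<Longrightarrow> - x \<in> K"
  using sym unfolding origin_symmetric_def by blast

text \<open>Averaging a ball in \<open>K\<close> with its reflection gives a ball around the origin.\<close>

lemma cball_subset: obtains a where "0 < a" "cball 0 a \<subseteq> K"
proof -
  obtain z r where r: "0 < r" "ball z r \<subseteq> K"
    using body unfolding convex_body_def mem_interior[symmetric] by (metis ex_in_conv mem_interior)
  have "cball 0 (r / 2) \<subseteq> K"
  proof
    fix x :: 'a assume x: "x \<in> cball 0 (r / 2)"
    have "z + x \<in> K" "z - x \<in> K" using x r by (auto intro!: subsetD[OF r(2)] simp: dist_norm)
    then have "(1 / 2) *\<^sub>R (z + x) + (1 / 2) *\<^sub>R - (z - x) \<in> K"
      by (intro convexD[OF convex_K] minus_mem) auto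
    then show "x \<in> K" by (simp add: algebra_simps flip: scaleR_add_left)
  qed
  then show thesis using that[of "r / 2"] r by auto
qed

lemma zero_mem: "0 \<in> K"
  using cball_subset by (metis centre_in_cball less_imp_le subsetD)

text \<open>The set of admissible factors is closed because \<open>K\<close> is compact, so it contains its infimum and the least
element in the definition exists.\<close>

lemma minkowski_functional_least:
  "0 \<le> minkowski_functional K x" (is ?nonneg)
  "x \<in> (\<lambda>y. minkowski_functional K x *\<^sub>R y) ` K" (is ?mem)
  "\<And>s. 0 \<le> s \<Longrightarrow> x \<in> (\<lambda>y. s *\<^sub>R y) ` K \<Longrightarrow> minkowski_functional K x \<le> s" (is "PROP ?least")
proof -
  let ?A = "{s. 0 \<le> s \<and> x \<in> (\<lambda>y. s *\<^sub>R y) ` K}"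
  obtain a where a: "0 < a" "cball 0 a \<subseteq> K" by (rule cball_subset)
  have ne: "norm x / a \<in> ?A"
  proof (cases "x = 0")
    case True
    then show ?thesis using zero_mem by auto
  next
    case False
    then have "(a / norm x) *\<^sub>R x \<in> K" using a by (intro subsetD[OF a(2)]) simp
    then show ?thesis using a False by (auto intro!: image_eqI[of _ _ "(a / norm x) *\<^sub>R x"])
  qed
  have cl: "closed ?A"
    unfolding closed_sequential_limits
  proof (intro allI impI)
    fix s l assume *: "(\<forall>n. s n \<in> ?A) \<and> s \<longlonglongrightarrow> l"
    then have "\<forall>n. \<exists>y\<in>K. x = s n *\<^sub>R y" by auto
    then obtain y where y: "\<And>n. y n \<in> K" "\<And>n. x = s n *\<^sub>R y n" by metis
    obtain y' r where r: "y' \<in> K" "strict_mono r" "(y \<circ> r) \<longlonglongrightarrow> y'"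
      using compact_K y(1) unfolding compact_def by metis
    have "(\<lambda>n. (s \<circ> r) n *\<^sub>R (y \<circ> r) n) \<longlonglongrightarrow> l *\<^sub>R y'"
      using * r by (intro tendsto_scaleR[OF LIMSEQ_subseq_LIMSEQ[OF _ r(2)] r(3)]) auto
    then have "x = l *\<^sub>R y'" using y(2) by (simp add: LIMSEQ_const_iff flip: y(2))
    moreover have "0 \<le> l" using * by (intro LIMSEQ_le_const[of s l]) auto
    ultimately show "l \<in> ?A" using r by auto
  qed
  have bb: "bdd_below ?A" by (rule bdd_belowI[of _ 0]) auto
  have Inf: "Inf ?A \<in> ?A" using closed_contains_Inf[OF _ bb cl] ne by blast
  have "minkowski_functional K x = Inf ?A"
    unfolding minkowski_functional_def
    by (rule Least_equality) (use Inf cInf_lower[OF _ bb] in auto)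
  then show ?nonneg ?mem "PROP ?least" using Inf cInf_lower[OF _ bb] by auto
qed

lemma minkowski_functional_norm:
  obtains a b where "equivalent_norm (minkowski_functional K) a b"
proof -
  let ?p = "minkowski_functional K"
  obtain a where a: "0 < a" "cball 0 a \<subseteq> K" by (rule cball_subset)
  obtain b where b: "0 < b" "\<And>y. y \<in> K \<Longrightarrow> norm y \<le> b"
    using compact_imp_bounded[OF compact_K] unfolding bounded_pos by blast
  have upper: "norm x \<le> b * ?p x" for x
  proof -
    obtain y where "y \<in> K" "x = ?p x *\<^sub>R y" using minkowski_functional_least(2) by blast
    then have "norm x = ?p x * norm y" "norm y \<le> b"
      using minkowski_functional_least(1)[of x] b by (metis abs_of_nonneg norm_scaleR, blast)
    then show ?thesis using mult_left_mono[of "norm y" b "?p x"] minkowski_functional_least(1)[of x]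
      by (simp add: mult.commute)
  qed
  have hom: "?p (c *\<^sub>R x) \<le> \<bar>c\<bar> * ?p x" for c x
  proof (rule minkowski_functional_least(3))
    obtain y where y: "y \<in> K" "x = ?p x *\<^sub>R y" using minkowski_functional_least(2) by blast
    show "c *\<^sub>R x \<in> (\<lambda>y. (\<bar>c\<bar> * ?p x) *\<^sub>R y) ` K"
    proof (cases "0 \<le> c")
      case True
      then show ?thesis using y by (intro image_eqI[of _ _ y]) (auto, metis scaleR_scaleR)
    next
      case False
      then show ?thesis using y minus_mem[OF y(1)]
        by (intro image_eqI[of _ _ "- y"]) (auto, metis scaleR_scaleR)
    qed
  qed (use minkowski_functional_least(1) in auto)
  have tri: "?p (x + y) \<le> ?p x + ?p y" for x y
  proof (cases "?p x + ?p y = 0")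
    case True
    then have "?p x = 0" "?p y = 0"
      using minkowski_functional_least(1)[of x] minkowski_functional_least(1)[of y] by auto
    then have "x = 0" "y = 0" using upper[of x] upper[of y] by auto
    then show ?thesis using \<open>?p x = 0\<close> by simp
  next
    case False
    let ?s = "?p x + ?p y"
    have s: "0 < ?s" using False minkowski_functional_least(1)[of x] minkowski_functional_least(1)[of y] by linarith
    obtain u v where uv: "u \<in> K" "x = ?p x *\<^sub>R u" "v \<in> K" "y = ?p y *\<^sub>R v"
      using minkowski_functional_least(2) by (metis imageE)
    have K: "(?p x / ?s) *\<^sub>R u + (?p y / ?s) *\<^sub>R v \<in> K"
      using uv s minkowski_functional_least(1)[of x] minkowski_functional_least(1)[of y]
      by (intro convexD[OF convex_K]) (auto simp flip: add_divide_distrib)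
    have "?s *\<^sub>R ((?p x / ?s) *\<^sub>R u + (?p y / ?s) *\<^sub>R v) = ?p x *\<^sub>R u + ?p y *\<^sub>R v"
      using s by (simp add: scaleR_add_right)
    also have "\<dots> = x + y" using uv by simp
    finally have "x + y \<in> (\<lambda>y. ?s *\<^sub>R y) ` K" using K by (metis image_eqI)
    then show ?thesis using s by (intro minkowski_functional_least(3)) auto
  qed
  have hom': "?p (c *\<^sub>R x) = \<bar>c\<bar> * ?p x" for c x
  proof (cases "c = 0")
    case True
    then show ?thesis using hom[of 0 x] minkowski_functional_least(1)[of "0 *\<^sub>R x"] by simp
  next
    case False
    have "?p ((1 / c) *\<^sub>R c *\<^sub>R x) \<le> \<bar>1 / c\<bar> * ?p (c *\<^sub>R x)" by (rule hom)
    then have "\<bar>c\<bar> * ?p x \<le> ?p (c *\<^sub>R x)" using False by (simp add: field_simps)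
    then show ?thesis using hom[of c x] by simp
  qed
  have lower: "a * ?p x \<le> norm x" for x
  proof (cases "x = 0")
    case True
    then show ?thesis using hom'[of 0 x] by simp
  next
    case False
    have "(a / norm x) *\<^sub>R x \<in> K" using a False by (intro subsetD[OF a(2)]) simp
    then have "?p ((a / norm x) *\<^sub>R x) \<le> 1" by (intro minkowski_functional_least(3)) auto
    then show ?thesis using a False by (simp add: hom' field_simps)
  qed
  have "equivalent_norm ?p a b"
    by unfold_locales (use tri hom' a b lower upper in auto)
  then show thesis by (rule that)
qed

end

lemma equivalent_norm_isometry:
  assumes "equivalent_norm p a b" and f: "linear f" "\<And>x. norm (f x) = norm x"
  shows "equivalent_norm (\<lambda>x. p (f x)) a b"
proof -
  interpret equivalent_norm p a b by fact
  show ?thesis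
  proof
    show "p (f (x + y)) \<le> p (f x) + p (f y)" for x y using triangle by (simp add: linear_add[OF f(1)])
    show "p (f (c *\<^sub>R x)) = \<bar>c\<bar> * p (f x)" for c x by (simp add: linear_scale[OF f(1)] homogeneous)
    show "a * p (f x) \<le> norm x" for x using lower[of "f x"] by (simp add: f)
    show "norm x \<le> b * p (f x)" for x using upper[of "f x"] by (simp add: f)
  qed (use a_pos b_pos in auto)
qed

lemma ext_integral_cong_AE:
  assumes "AE x in M. f x = g x"
  shows "ext_integral M f = ext_integral M g"
proof -
  have "(\<integral>\<^sup>+x. e2ennreal (f x) \<partial>M) = (\<integral>\<^sup>+x. e2ennreal (g x) \<partial>M)"
    "(\<integral>\<^sup>+x. e2ennreal (- f x) \<partial>M) = (\<integral>\<^sup>+x. e2ennreal (- g x) \<partial>M)"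
    using assms by (auto intro!: nn_integral_cong_AE elim!: eventually_mono)
  then show ?thesis by (simp add: ext_integral_def)
qed

text \<open>The measure is restricted to the sphere. For \<open>x \<noteq> 0\<close> the integrand is real almost everywhere, so the extended integral is an
ordinary one. For \<open>x = 0\<close> the integrand is \<open>- \<infinity>\<close> throughout, and so is the integral because the
measure is not zero.\<close>

lemma embeds_in_L0I:
  fixes p :: "'a::euclidean_space \<Rightarrow> real"
  assumes p: "equivalent_norm p a b"
    and Q: "prob_space Q" "sets Q = sets borel" "AE \<theta> in Q. norm \<theta> = 1"
    and null: "\<And>x. x \<noteq> 0 \<Longrightarrow> AE \<theta> in Q. x \<bullet> \<theta> \<noteq> 0"
    and int: "\<And>x. x \<noteq> 0 \<Longrightarrow> has_bochner_integral Q (\<lambda>\<theta>. ln \<bar>x \<bullet> \<theta>\<bar>) (ln (p x) + c)"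
  shows "embeds_in_L0 p"
proof -
  interpret equivalent_norm p a b by fact
  interpret Q: prob_space Q by fact
  define \<mu> where "\<mu> = restrict_space Q (sphere 0 1)"
  have [measurable_cong]: "sets Q = sets borel" by fact
  have spQ: "space Q = UNIV" using sets_eq_imp_space_eq[OF Q(2)] by simp
  have S: "sphere 0 1 \<inter> space Q \<in> sets Q" "sphere (0::'a) 1 \<in> sets Q" by (auto simp: spQ Q(2))
  have AES: "AE \<theta> in Q. \<theta> \<in> sphere 0 1" using Q(3) by simp
  have sets: "sets \<mu> = sets (restrict_space borel (sphere 0 1))"
    unfolding \<mu>_def by (rule sets_restrict_space_cong[OF Q(2)])
  have sp: "space \<mu> = sphere 0 1" by (simp add: \<mu>_def space_restrict_space spQ)
  have mass: "emeasure \<mu> (space \<mu>) = 1"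
  proof -
    have "emeasure \<mu> (space \<mu>) = emeasure Q (sphere 0 1)"
      unfolding sp unfolding \<mu>_def by (rule emeasure_restrict_space[OF S(1)]) simp
    also have "\<dots> = 1" using Q.emeasure_eq_1_AE[OF S(2) AES] .
    finally show ?thesis .
  qed
  have fin: "finite_measure \<mu>" by (rule finite_measureI) (simp add: mass)
  have ext: "ext_ln (p x) = ext_integral \<mu> (\<lambda>\<xi>. ext_ln \<bar>x \<bullet> \<xi>\<bar>) + ereal (- c)" for x
  proof (cases "x = 0")
    case True
    have "ext_integral \<mu> (\<lambda>\<xi>. ext_ln \<bar>x \<bullet> \<xi>\<bar>) = - \<infinity>"
      using True mass by (simp add: ext_integral_def ext_ln_def e2ennreal_neg zero_ennreal.rep_eq)
    then show ?thesis using True by (simp add: ext_ln_def)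
  next
    case False
    have nz: "AE \<xi> in \<mu>. x \<bullet> \<xi> \<noteq> 0"
      unfolding \<mu>_def using null[OF False] S(1) by (subst AE_restrict_space_iff) (auto elim!: eventually_mono)
    have i: "integrable \<mu> (\<lambda>\<xi>. ln \<bar>x \<bullet> \<xi>\<bar>)"
      unfolding \<mu>_def integrable_restrict_space[OF S(1)]
    proof (rule integrable_cong_AE_imp)
      show "integrable Q (\<lambda>\<theta>. ln \<bar>x \<bullet> \<theta>\<bar>)" using int[OF False] by (simp add: has_bochner_integral_iff)
      show "AE \<theta> in Q. ln \<bar>x \<bullet> \<theta>\<bar> = indicator (sphere 0 1) \<theta> *\<^sub>R ln \<bar>x \<bullet> \<theta>\<bar>"
        using AES by eventually_elim simp
      show "(\<lambda>\<theta>. indicator (sphere 0 1) \<theta> *\<^sub>R ln \<bar>x \<bullet> \<theta>\<bar>) \<in> borel_measurable Q" by measurable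
    qed
    have "(\<integral>\<xi>. ln \<bar>x \<bullet> \<xi>\<bar> \<partial>\<mu>) = (\<integral>\<theta>. indicator (sphere 0 1) \<theta> *\<^sub>R ln \<bar>x \<bullet> \<theta>\<bar> \<partial>Q)"
      unfolding \<mu>_def by (rule integral_restrict_space[OF S(1)])
    also have "\<dots> = (\<integral>\<theta>. ln \<bar>x \<bullet> \<theta>\<bar> \<partial>Q)"
    proof (rule integral_cong_AE)
      show "AE \<theta> in Q. indicator (sphere 0 1) \<theta> *\<^sub>R ln \<bar>x \<bullet> \<theta>\<bar> = ln \<bar>x \<bullet> \<theta>\<bar>"
        using AES by eventually_elim simp
    qed measurable
    also have "\<dots> = ln (p x) + c" using int[OF False] by (simp add: has_bochner_integral_iff)
    finally have v: "(\<integral>\<xi>. ln \<bar>x \<bullet> \<xi>\<bar> \<partial>\<mu>) = ln (p x) + c" .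
    have "ext_integral \<mu> (\<lambda>\<xi>. ext_ln \<bar>x \<bullet> \<xi>\<bar>) = ext_integral \<mu> (\<lambda>\<xi>. ereal (ln \<bar>x \<bullet> \<xi>\<bar>))"
      using nz by (intro ext_integral_cong_AE) (auto simp: ext_ln_def elim!: eventually_mono)
    also have "\<dots> = ereal (ln (p x) + c)" by (simp only: ext_integral_ereal[OF i] v)
    finally show ?thesis using p_pos[OF False] by (simp add: ext_ln_def)
  qed
  show ?thesis unfolding embeds_in_L0_def using sets fin ext by blast
qed

text \<open>The estimates were made in coordinates, on triples of real numbers. A linear isometry onto \<open>real ^ 3\<close>
transports the norm to triples and the measure back.\<close>

theorem corollary4p3:
  fixes K :: "(real ^ 3) set"
  assumes "convex_body K" and "origin_symmetric K"
  shows "embeds_in_L0 (minkowski_functional K)"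
proof -
  interpret symmetric_convex_body K using assms by unfold_locales
  obtain a b where p: "equivalent_norm (minkowski_functional K) a b" by (rule minkowski_functional_norm)
  have "DIM(r3) = DIM(real ^ 3)" by simp
  then obtain f :: "r3 \<Rightarrow> real ^ 3" and g where
    f: "linear f" "\<And>x. norm (f x) = norm x" and g: "linear g" "\<And>y. norm (g y) = norm y"
    and fg: "\<And>x. g (f x) = x" "\<And>y. f (g y) = y"
    by (rule isomorphisms_UNIV_UNIV) metis
  interpret N: equivalent_norm3 "\<lambda>x. minkowski_functional K (f x)" a b
    unfolding equivalent_norm3_def by (rule equivalent_norm_isometry[OF p f])
  obtain Q c where Q: "prob_space Q" "sets Q = sets borel" "AE \<theta> in Q. norm \<theta> = 1"
    "\<And>x. x \<noteq> 0 \<Longrightarrow> AE \<theta> in Q. x \<bullet> \<theta> \<noteq> 0"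
    "\<And>x. x \<noteq> 0 \<Longrightarrow> has_bochner_integral Q (\<lambda>\<theta>. ln \<bar>x \<bullet> \<theta>\<bar>) (ln (minkowski_functional K (f x)) + c)"
    by (rule N.log_norm_representation3) (rule that)
  have inner: "y \<bullet> f x = g y \<bullet> x" for x y
  proof -
    have "f u \<bullet> f v = u \<bullet> v" for u v
      by (simp add: dot_norm f(2) flip: linear_add[OF f(1)])
    from this[of "g y" x] show ?thesis by (simp add: fg)
  qed
  have fm: "f \<in> borel_measurable borel"
    using f(1) by (intro borel_measurable_continuous_onI linear_continuous_on) (simp add: linear_conv_bounded_linear)
  then have fQ[measurable]: "f \<in> borel_measurable Q" using measurable_cong_sets[OF Q(2) refl] by blast
  have gz: "g y \<noteq> 0" if "y \<noteq> 0" for y using that g(2)[of y] by auto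
  show ?thesis
  proof (rule embeds_in_L0I[OF p, of "distr Q borel f" c])
    show "prob_space (distr Q borel f)" by (rule prob_space.prob_space_distr[OF Q(1) fQ])
    show "AE \<theta> in distr Q borel f. norm \<theta> = 1" using Q(3) by (subst AE_distr_iff) (auto simp: f(2))
    fix y :: "real ^ 3" assume y: "y \<noteq> 0"
    show "AE \<theta> in distr Q borel f. y \<bullet> \<theta> \<noteq> 0" using Q(4)[OF gz[OF y]] by (subst AE_distr_iff) (auto simp: inner)
    show "has_bochner_integral (distr Q borel f) (\<lambda>\<theta>. ln \<bar>y \<bullet> \<theta>\<bar>) (ln (minkowski_functional K y) + c)"
      using Q(5)[OF gz[OF y]]
      by (simp add: has_bochner_integral_iff integrable_distr_eq integral_distr inner fg)
  qed simp
qed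

end
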